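(* Let $(U_t(x))_{t\ge 0, x\in\mathbb{R}}$ be the stationary pinned string in $\mathbb{R}^6$. Then almost surely, for all $\alpha>0$, $$\liminf_{t\to\infty} \frac{\inf_{x\in\mathbb{R}} |U_t(x)|}{t^{-\alpha}} = 0 .$$
   Context: Let $d=6$. Let $G_t(x) = (4\pi t)^{-1/2}\exp(-x^2/(4t))$ for $t>0$, $x\in\mathbb{R}$ (heat kernel of $\partial_t u=\partial_x^2 u$). Let $W$ and $\tilde W$ be independent $\mathbb{R}^d$-valued space-time white noises on $[0,\infty)\times\mathbb{R}$, each with independent components (each component is a centered Gaussian family indexed by $f\in L^2([0,\infty)\times\mathbb{R})$ with covariance $E[W^{(i)}(f)W^{(i)}(g)]=\int_0^\infty\int_{\mathbb{R}} f(r,z)g(r,z)\,dz\,dr$), $W$ being adapted to a filtration $(\mathcal F_t)$ on a probability space $(\Omega,\mathcal F,P)$, with $\mathcal F$ complete and $(\mathcal F_t)$ right continuous: $W(f)$ is $\mathcal F_t$-measurable whenever $f$ is supported in $[0,t]\times\mathbb{R}$. The stationary pinned string in $\mathbb{R}^d$ is the continuous $\mathbb{R}^d$-valued random field $(U_t(x))_{t\ge0,x\in\mathbb{R}}$, solving $\partial_t u_t(x) = \partial_x^2 u_t(x) + \dot W(x,t)$, with $$U_0(x) = \int_0^\infty\int_{\mathbb{R}} \big(G_r(x-z)-G_r(z)\big)\,\tilde W(dz\,dr)$$ and, for $t>0$, $U_t(x)$ a continuous version of $$\int_{\mathbb{R}} G_t(x-z)U_0(z)\,dz + \int_0^t\int_{\mathbb{R}}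 G_{t-r}(x-z)\,W(dz\,dr).$$ $|\cdot|$ denotes the Euclidean norm on $\mathbb{R}^6$. *)

theory Defs
  imports "HOL-Probability.Probability"
begin

definition heat_kernel :: "real \<Rightarrow> real \<Rightarrow> real" where
  "heat_kernel t x = (4 * pi * t) powr (- 1 / 2) * exp (- x\<^sup>2 / (4 * t))"

text \<open>Space-time points are pairs (time, position).\<close>

definition spacetime :: "(real \<times> real) measure" where
  "spacetime = restrict_space lborel ({0..} \<times> UNIV)"

text \<open>
  \<open>L2_spacetime\<close> consists of representatives, not of classes modulo null sets. That a white noise
  takes almost surely the same value on two representatives of a class follows from its
  covariance.
\<close>

definition L2_spacetime :: "(real \<times> real \<Rightarrow> real) set" where
  "L2_spacetime = {f \<in> borel_measurable spacetime. integrable spacetime (\<lambda>p. (f p)\<^sup>2)}"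

definition centered_gaussian :: "'a measure \<Rightarrow> ('a \<Rightarrow> real) \<Rightarrow> bool" where
  "centered_gaussian M X \<longleftrightarrow> X \<in> borel_measurable M \<and>
     ((AE \<omega> in M. X \<omega> = 0) \<or> (\<exists>\<sigma>>0. distributed M lborel X (normal_density 0 \<sigma>)))"

definition centered_gaussian_family :: "'a measure \<Rightarrow> 'i set \<Rightarrow> ('i \<Rightarrow> 'a \<Rightarrow> real) \<Rightarrow> bool" where
  "centered_gaussian_family M I X \<longleftrightarrow>
     (\<forall>J c. finite J \<longrightarrow> J \<subseteq> I \<longrightarrow> centered_gaussian M (\<lambda>\<omega>. \<Sum>j\<in>J. c j * X j \<omega>))"

text \<open>
  \<open>W f\<close> is the stochastic integral of the deterministic function \<open>f\<close> against the noise.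
\<close>

definition white_noise :: "'a measure \<Rightarrow> ((real \<times> real \<Rightarrow> real) \<Rightarrow> 'a \<Rightarrow> real) \<Rightarrow> bool" where
  "white_noise M W \<longleftrightarrow> centered_gaussian_family M L2_spacetime W \<and>
     (\<forall>f\<in>L2_spacetime. \<forall>g\<in>L2_spacetime.
        prob_space.expectation M (\<lambda>\<omega>. W f \<omega> * W g \<omega>) = (LINT p|spacetime. f p * g p))"

definition vector_white_noise ::
  "'a measure \<Rightarrow> ((real \<times> real \<Rightarrow> real) \<Rightarrow> 'a \<Rightarrow> real ^ 'd) \<Rightarrow> bool" where
  "vector_white_noise M W \<longleftrightarrow>
     (\<forall>i. white_noise M (\<lambda>f \<omega>. W f \<omega> $ i)) \<and>
     prob_space.indep_vars M (\<lambda>i. Pi\<^sub>M L2_spacetime (\<lambda>f. borel))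
       (\<lambda>i \<omega>. \<lambda>f\<in>L2_spacetime. W f \<omega> $ i) UNIV"

definition independent_noises ::
  "'a measure \<Rightarrow> ((real \<times> real \<Rightarrow> real) \<Rightarrow> 'a \<Rightarrow> real ^ 'd) \<Rightarrow>
     ((real \<times> real \<Rightarrow> real) \<Rightarrow> 'a \<Rightarrow> real ^ 'd) \<Rightarrow> bool" where
  "independent_noises M W W' \<longleftrightarrow>
     prob_space.indep_var M
       (Pi\<^sub>M L2_spacetime (\<lambda>f. borel)) (\<lambda>\<omega>. \<lambda>f\<in>L2_spacetime. W f \<omega>)
       (Pi\<^sub>M L2_spacetime (\<lambda>f. borel)) (\<lambda>\<omega>. \<lambda>f\<in>L2_spacetime. W' f \<omega>)"

text \<open>
  Filtrations are indexed by \<open>real\<close>, but only times \<open>t \<ge> 0\<close> are relevant; this is why the library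
  locale \<open>filtration\<close>, which constrains every index, is not used.
\<close>

definition right_continuous_filtration :: "'a measure \<Rightarrow> (real \<Rightarrow> 'a measure) \<Rightarrow> bool" where
  "right_continuous_filtration M F \<longleftrightarrow>
     (\<forall>t\<ge>0. subalgebra M (F t)) \<and>
     (\<forall>s t. 0 \<le> s \<longrightarrow> s \<le> t \<longrightarrow> sets (F s) \<subseteq> sets (F t)) \<and>
     (\<forall>t\<ge>0. sets (F t) = (\<Inter>s\<in>{t<..}. sets (F s)))"

definition adapted_noise ::
  "(real \<Rightarrow> 'a measure) \<Rightarrow> ((real \<times> real \<Rightarrow> real) \<Rightarrow> 'a \<Rightarrow> real ^ 'd) \<Rightarrow> bool" where
  "adapted_noise F W \<longleftrightarrow>
     (\<forall>t\<ge>0. \<forall>f\<in>L2_spacetime.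
        (AE p in spacetime. p \<notin> {0..t} \<times> UNIV \<longrightarrow> f p = 0) \<longrightarrow> W f \<in> borel_measurable (F t))"

text \<open>
  The first argument of \<open>U\<close> is time, the second is position; values at negative times are
  irrelevant. In the second integrand \<open>indicator {0..<t} r\<close> restricts the stochastic integral to
  \<open>[0,t)\<close>. The formulas hold almost surely for each fixed point, so that \<open>U\<close> is a continuous
  version of the field that they define.
\<close>

definition stationary_pinned_string ::
  "'a measure \<Rightarrow> ((real \<times> real \<Rightarrow> real) \<Rightarrow> 'a \<Rightarrow> real ^ 'd) \<Rightarrow>
     ((real \<times> real \<Rightarrow> real) \<Rightarrow> 'a \<Rightarrow> real ^ 'd) \<Rightarrow> (real \<Rightarrow> real \<Rightarrow> 'a \<Rightarrow> real ^ 'd) \<Rightarrow> bool" where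
  "stationary_pinned_string M W W' U \<longleftrightarrow>
     (\<forall>t\<ge>0. \<forall>x. U t x \<in> borel_measurable M) \<and>
     (AE \<omega> in M. continuous_on ({0..} \<times> UNIV) (\<lambda>(t, x). U t x \<omega>)) \<and>
     (\<forall>x. AE \<omega> in M. U 0 x \<omega> = W' (\<lambda>(r, z). heat_kernel r (x - z) - heat_kernel r z) \<omega>) \<and>
     (\<forall>t>0. \<forall>x. AE \<omega> in M. U t x \<omega> =
        (LINT z|lborel. heat_kernel t (x - z) *\<^sub>R U 0 z \<omega>) +
        W (\<lambda>(r, z). indicator {0..<t} r * heat_kernel (t - r) (x - z)) \<omega>)"

end

theory Submission
  imports Defs
begin

text \<open>
  Each component of \<open>U\<^sub>t(x)\<close> is a centred Gaussian field, and the variance of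
  \<open>U\<^sub>t(x) - U\<^sub>s(y)\<close> is of the order of \<open>\<surd>\<bar>t - s\<bar> + \<bar>x - y\<bar>\<close>. Resolving the string to accuracy \<open>\<epsilon>\<close>
  takes cells of size \<open>\<epsilon>\<^sup>4\<close> in time and \<open>\<epsilon>\<^sup>2\<close> in space, so the parameter space has effective
  dimension six, and a string in \<open>\<real>\<^sup>6\<close> is the critical case. In a parabolic box of length \<open>A = 16\<^sup>n\<close> in
  space and \<open>A\<^sup>2\<close> in time, the expected number of cells in which the string comes \<open>\<epsilon>\<close>-close to the
  origin is of order one for every small \<open>\<epsilon>\<close>, but close visits cluster: given one visit, the expected
  number of others is of the order of the logarithm of \<open>A/\<epsilon>\<^sup>2\<close>. With \<open>\<epsilon>\<^sup>2 = 16\<^sup>-\<^sup>b\<^sup>n\<close> this logarithm is of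
  order \<open>n\<close>, so scale \<open>n\<close> sees a visit with probability of order \<open>1/n\<close>. Distinct scales decorrelate
  geometrically and \<open>\<Sum> 1/n\<close> diverges, hence visits occur on infinitely many scales almost surely.
  Since \<open>b\<close> is arbitrary, every power \<open>t\<^sup>-\<^sup>\<alpha>\<close> is beaten.

  To make this precise, visits are counted smoothly, by \<open>exp (- \<lambda>\<bar>U\<bar>\<^sup>2/2)\<close> with \<open>\<lambda> = \<epsilon>\<^sup>-\<^sup>2\<close> summed over the
  corners of the cells. The one- and two-point expectations of these bumps are explicit inverse
  powers of determinants (\<open>two_point_expectation\<close>); they come from characteristic functions of linear
  combinations alone, so no multivariate normal density enters. Let \<open>Y\<^sub>n\<close> (\<open>occupation\<close>) be the sum over
  scale \<open>n\<close> divided by its mean. Then \<open>E Y\<^sub>n\<^sup>2 = O(n)\<close> (\<open>occupation_second_moment\<close>) and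
  \<open>E Y\<^sub>n Y\<^sub>m \<le> 1 + O(16\<^sup>n\<^sup>-\<^sup>m)\<close> for \<open>n < m\<close> (\<open>occupation_decorrelation\<close>), so \<open>Z = \<Sum> Y\<^sub>n/n\<close> has variance
  at most a multiple of its mean, and Chebyshev's inequality gives \<open>Y\<^sub>n > 1/2\<close> for infinitely many \<open>n\<close>
  (\<open>second_moment_infinitely_often\<close>). When \<open>Y\<^sub>n > 1/2\<close>, some bump is at least a constant times a fixed
  power of \<open>16\<^sup>-\<^sup>n\<close>, which forces \<open>\<bar>U\<bar>\<^sup>2 = O(n 16\<^sup>-\<^sup>b\<^sup>n)\<close> there (\<open>occupied_imp_near_origin\<close>).

  The Gaussian structure rests on the representation \<open>U\<^sub>t(x) = W'(h) + W(g)\<close> with deterministic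
  integrands \<open>h\<close> and \<open>g\<close> (\<open>string_representation\<close>), which requires exchanging the spatial heat smoothing
  of \<open>U\<^sub>0\<close> with the stochastic integral (\<open>smoothed_initial_component\<close>). All covariances are expressed
  through one function, \<open>string_variance\<close>, and the two estimates that drive the moments are
  \<open>string_covariance_nondegenerate\<close> within a box and \<open>string_covariance_decay\<close> between boxes.
\<close>

section \<open>Square integrability and Gaussian expectations\<close>

lemma integrable_mult_of_squares:
  fixes X Y :: "'a \<Rightarrow> real"
  assumes [measurable]: "X \<in> borel_measurable M" "Y \<in> borel_measurable M"
    and "integrable M (\<lambda>\<omega>. (X \<omega>)\<^sup>2)" "integrable M (\<lambda>\<omega>. (Y \<omega>)\<^sup>2)"
  shows "integrable M (\<lambda>\<omega>. X \<omega> * Y \<omega>)"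
proof (rule Bochner_Integration.integrable_bound)
  show "integrable M (\<lambda>\<omega>. (X \<omega>)\<^sup>2 + (Y \<omega>)\<^sup>2)" using assms by simp
  show "AE \<omega> in M. norm (X \<omega> * Y \<omega>) \<le> norm ((X \<omega>)\<^sup>2 + (Y \<omega>)\<^sup>2)"
  proof (intro AE_I2)
    fix \<omega>
    have "2 * (\<bar>X \<omega>\<bar> * \<bar>Y \<omega>\<bar>) \<le> (X \<omega>)\<^sup>2 + (Y \<omega>)\<^sup>2"
      using sum_squares_bound[of "\<bar>X \<omega>\<bar>" "\<bar>Y \<omega>\<bar>"] by simp
    moreover have "0 \<le> \<bar>X \<omega>\<bar> * \<bar>Y \<omega>\<bar>" by simp
    ultimately have "\<bar>X \<omega>\<bar> * \<bar>Y \<omega>\<bar> \<le> (X \<omega>)\<^sup>2 + (Y \<omega>)\<^sup>2" by linarith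
    then show "norm (X \<omega> * Y \<omega>) \<le> norm ((X \<omega>)\<^sup>2 + (Y \<omega>)\<^sup>2)" by (simp add: abs_mult)
  qed
qed measurable

text \<open>
  The function \<open>exp (- x\<^sup>2 / 2)\<close> is the characteristic function of the standard normal law, so
  \<open>exp (- (X\<^sup>2 + Y\<^sup>2) / 2)\<close> is the mean of \<open>exp (\<i> (\<xi> X + \<eta> Y))\<close> over independent standard normal \<open>\<xi>\<close> and
  \<open>\<eta>\<close>. Exchanging the two expectations leaves a Gaussian integral in \<open>\<xi>\<close> and \<open>\<eta>\<close>, whose value is the
  inverse square root of the determinant of the identity plus the covariance matrix. Only the
  characteristic functions of linear combinations of \<open>X\<close> and \<open>Y\<close> are used.
\<close>

lemma (in prob_space) expectation_exp_sq_unit: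
  assumes [measurable]: "X \<in> borel_measurable M" "Y \<in> borel_measurable M"
    and char: "\<And>u v. (LINT \<omega>|M. iexp (u * X \<omega> + v * Y \<omega>)) =
      complex_of_real (exp (- (u\<^sup>2 * a + 2 * u * v * c + v\<^sup>2 * b) / 2))"
    and ab: "0 \<le> a" "0 \<le> b" "c\<^sup>2 \<le> a * b"
  shows "expectation (\<lambda>\<omega>. exp (- ((X \<omega>)\<^sup>2 + (Y \<omega>)\<^sup>2) / 2)) = 1 / sqrt ((1 + a) * (1 + b) - c\<^sup>2)"
proof -
  let ?S = "std_normal_distribution"
  interpret S: prob_space ?S
    by (rule prob_space_normal_density) simp
  interpret P: pair_prob_space M ?S ..
  have std: "(LINT x|?S. iexp (t * x)) = complex_of_real (exp (- t\<^sup>2 / 2))" for t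
    using fun_cong[OF char_std_normal_distribution, of t] by (simp add: char_def)
  \<comment> \<open>The factors \<open>\<beta>\<close> and \<open>\<gamma>\<close> of the determinant arise from integrating out \<open>\<eta>\<close> and then \<open>\<xi>\<close>.\<close>
  define \<beta> where "\<beta> = 1 + b"
  define \<gamma> where "\<gamma> = 1 + a - c\<^sup>2 / \<beta>"
  have \<beta>: "\<beta> > 0" using ab by (simp add: \<beta>_def)
  have bg: "\<beta> * \<gamma> = (1 + a) * (1 + b) - c\<^sup>2"
    using \<beta> by (simp add: \<gamma>_def \<beta>_def field_simps)
  have "(1 + a) * (1 + b) - c\<^sup>2 > 0" using ab by (simp add: field_simps)
  then have \<gamma>: "\<gamma> > 0" using bg \<beta> by (metis zero_less_mult_pos)
  \<comment> \<open>Completing the square.\<close>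
  have gauss: "(LINT x|?S. exp (- (p * x\<^sup>2) / 2 - q * x)) = exp (q\<^sup>2 / (2 * (1 + p))) / sqrt (1 + p)"
    if p: "1 + p > 0" for p q :: real
  proof -
    have "(LINT x|?S. exp (- (p * x\<^sup>2) / 2 - q * x)) =
      (LINT x|lborel. std_normal_density x * exp (- (p * x\<^sup>2) / 2 - q * x))"
      by (subst integral_density) (auto)
    also have "\<dots> = (LINT x|lborel. exp (q\<^sup>2 / (2 * (1 + p))) / sqrt (1 + p) *
        normal_density (- q / (1 + p)) (1 / sqrt (1 + p)) x)"
    proof (rule Bochner_Integration.integral_cong[OF refl])
      fix x :: real
      define k where "k = q / (1 + p)"
      have q: "q = k * (1 + p)" using p by (simp add: k_def)
      have "q\<^sup>2 / (2 * (1 + p)) = k\<^sup>2 * (1 + p) / 2"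
        unfolding q using p by (simp add: power2_eq_square divide_simps)
      then have "- x\<^sup>2 / 2 + (- (p * x\<^sup>2) / 2 - q * x) =
        q\<^sup>2 / (2 * (1 + p)) - (x + q / (1 + p))\<^sup>2 * (1 + p) / 2"
        unfolding k_def[symmetric] by (simp add: q power2_eq_square field_simps)
      moreover have "sqrt (2 * pi * (1 / sqrt (1 + p))\<^sup>2) = sqrt (2 * pi) / sqrt (1 + p)"
        using p by (simp add: power_divide real_sqrt_divide real_sqrt_mult)
      ultimately show "std_normal_density x * exp (- (p * x\<^sup>2) / 2 - q * x) =
        exp (q\<^sup>2 / (2 * (1 + p))) / sqrt (1 + p) *
        normal_density (- q / (1 + p)) (1 / sqrt (1 + p)) x"
        using p unfolding std_normal_density_def normal_density_def
        by (simp add: exp_add[symmetric] exp_diff[symmetric] power_divide mult.assoc[symmetric])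
    qed
    also have "\<dots> = exp (q\<^sup>2 / (2 * (1 + p))) / sqrt (1 + p)"
      using p by (simp add: integral_normal_density[of "1 / sqrt (1 + p)"])
    finally show ?thesis .
  qed
  have "complex_of_real (expectation (\<lambda>\<omega>. exp (- ((X \<omega>)\<^sup>2 + (Y \<omega>)\<^sup>2) / 2))) =
    (LINT \<omega>|M. complex_of_real (exp (- (X \<omega>)\<^sup>2 / 2)) * complex_of_real (exp (- (Y \<omega>)\<^sup>2 / 2)))"
    by (subst integral_complex_of_real[symmetric])
       (simp add: exp_add[symmetric] of_real_mult[symmetric] add_divide_distrib diff_divide_distrib del: of_real_mult)
  also have "\<dots> = (LINT \<omega>|M. (LINT x|?S. iexp (X \<omega> * x) * complex_of_real (exp (- (Y \<omega>)\<^sup>2 / 2))))"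
    unfolding std[symmetric] by simp
  also have "\<dots> = (LINT x|?S. (LINT \<omega>|M. iexp (X \<omega> * x) * complex_of_real (exp (- (Y \<omega>)\<^sup>2 / 2))))"
    by (rule P.Fubini_integral[symmetric], rule P.integrable_const_bound[where B=1])
       (auto simp: norm_mult)
  also have "\<dots> = (LINT x|?S. (LINT \<omega>|M. (LINT y|?S. iexp (X \<omega> * x) * iexp (Y \<omega> * y))))"
    unfolding std[symmetric] by simp
  also have "\<dots> = (LINT x|?S. (LINT y|?S. (LINT \<omega>|M. iexp (X \<omega> * x) * iexp (Y \<omega> * y))))"
    by (intro Bochner_Integration.integral_cong refl P.Fubini_integral[symmetric]
          P.integrable_const_bound[where B=1]) (auto simp: norm_mult)
  also have "\<dots> = (LINT x|?S. (LINT y|?S. (LINT \<omega>|M. iexp (x * X \<omega> + y * Y \<omega>))))"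
    by (simp add: exp_add[symmetric] algebra_simps)
  also have "\<dots> = complex_of_real (LINT x|?S. (LINT y|?S. exp (- (x\<^sup>2 * a + 2 * x * y * c + y\<^sup>2 * b) / 2)))"
    unfolding char integral_complex_of_real ..
  also have "(LINT x|?S. (LINT y|?S. exp (- (x\<^sup>2 * a + 2 * x * y * c + y\<^sup>2 * b) / 2))) =
    (LINT x|?S. exp (- (x\<^sup>2 * a) / 2) * (LINT y|?S. exp (- (b * y\<^sup>2) / 2 - (x * c) * y)))"
    by (simp add: integral_mult_right_zero[symmetric] exp_add[symmetric] add_divide_distrib
          diff_divide_distrib algebra_simps del: integral_mult_right_zero)
  also have "\<dots> = (LINT x|?S. exp (- ((\<gamma> - 1) * x\<^sup>2) / 2 - 0 * x) / sqrt \<beta>)"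
  proof (rule Bochner_Integration.integral_cong[OF refl])
    fix x :: real
    have "- (x\<^sup>2 * a) / 2 + (x * c)\<^sup>2 / (2 * \<beta>) = - ((\<gamma> - 1) * x\<^sup>2) / 2 - 0 * x"
      using \<beta> by (simp add: \<gamma>_def power_mult_distrib field_simps)
    then show "exp (- (x\<^sup>2 * a) / 2) * (LINT y|?S. exp (- (b * y\<^sup>2) / 2 - (x * c) * y)) =
      exp (- ((\<gamma> - 1) * x\<^sup>2) / 2 - 0 * x) / sqrt \<beta>"
      using \<beta> gauss[of b "x * c"] by (simp add: \<beta>_def[symmetric] exp_add[symmetric])
  qed
  also have "\<dots> = 1 / sqrt (\<beta> * \<gamma>)"
    using gauss[of "\<gamma> - 1" 0] \<gamma> by (simp add: real_sqrt_mult mult.commute)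
  finally show ?thesis unfolding bg of_real_eq_iff .
qed

lemma (in prob_space) expectation_exp_sq:
  assumes [measurable]: "X \<in> borel_measurable M" "Y \<in> borel_measurable M"
    and char: "\<And>u v. (LINT \<omega>|M. iexp (u * X \<omega> + v * Y \<omega>)) =
      complex_of_real (exp (- (u\<^sup>2 * a + 2 * u * v * c + v\<^sup>2 * b) / 2))"
    and ab: "0 \<le> a" "0 \<le> b" "c\<^sup>2 \<le> a * b" and lm: "0 \<le> l" "0 \<le> m"
  shows "expectation (\<lambda>\<omega>. exp (- (l * (X \<omega>)\<^sup>2 + m * (Y \<omega>)\<^sup>2) / 2)) =
    1 / sqrt ((1 + l * a) * (1 + m * b) - l * m * c\<^sup>2)"
proof -
  have "expectation (\<lambda>\<omega>. exp (- ((sqrt l * X \<omega>)\<^sup>2 + (sqrt m * Y \<omega>)\<^sup>2) / 2)) =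
    1 / sqrt ((1 + l * a) * (1 + m * b) - (sqrt l * sqrt m * c)\<^sup>2)"
  proof (rule expectation_exp_sq_unit)
    fix u v
    show "(LINT \<omega>|M. iexp (u * (sqrt l * X \<omega>) + v * (sqrt m * Y \<omega>))) =
      complex_of_real (exp (- (u\<^sup>2 * (l * a) + 2 * u * v * (sqrt l * sqrt m * c) + v\<^sup>2 * (m * b)) / 2))"
      using char[of "u * sqrt l" "v * sqrt m"] lm by (simp add: power_mult_distrib algebra_simps)
    show "(sqrt l * sqrt m * c)\<^sup>2 \<le> l * a * (m * b)"
      using lm mult_left_mono[OF ab(3), of "l * m"] by (simp add: power_mult_distrib algebra_simps)
  qed (use ab lm in auto)
  then show ?thesis using lm by (simp add: power_mult_distrib)
qed

text \<open>
  Scaling reduces the nondegenerate case to the standard normal law.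
\<close>

lemma (in prob_space) centered_gaussian_moments:
  assumes "centered_gaussian M X"
  shows "X \<in> borel_measurable M" "integrable M (\<lambda>\<omega>. (X \<omega>)\<^sup>2)"
    "(LINT \<omega>|M. iexp (X \<omega>)) = complex_of_real (exp (- expectation (\<lambda>\<omega>. (X \<omega>)\<^sup>2) / 2))"
proof -
  show [measurable]: "X \<in> borel_measurable M" using assms by (simp add: centered_gaussian_def)
  consider "AE \<omega> in M. X \<omega> = 0" | \<sigma> where "\<sigma> > 0" "distributed M lborel X (normal_density 0 \<sigma>)"
    using assms by (auto simp: centered_gaussian_def)
  then have "integrable M (\<lambda>\<omega>. (X \<omega>)\<^sup>2) \<and>
    (LINT \<omega>|M. iexp (X \<omega>)) = complex_of_real (exp (- expectation (\<lambda>\<omega>. (X \<omega>)\<^sup>2) / 2))"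
  proof cases
    case 1
    have "integrable M (\<lambda>\<omega>. (X \<omega>)\<^sup>2) \<longleftrightarrow> integrable M (\<lambda>\<omega>. 0 :: real)"
      by (rule integrable_cong_AE) (use 1 in auto)
    moreover have "expectation (\<lambda>\<omega>. (X \<omega>)\<^sup>2) = expectation (\<lambda>\<omega>. 0)"
      by (rule integral_cong_AE) (use 1 in auto)
    moreover have "(LINT \<omega>|M. iexp (X \<omega>)) = (LINT \<omega>|M. 1)"
      by (rule integral_cong_AE) (use 1 in auto)
    ultimately show ?thesis by (simp add: prob_space)
  next
    case 2
    let ?S = "std_normal_distribution"
    define Z where "Z = (\<lambda>\<omega>. X \<omega> / \<sigma>)"
    have XZ: "X \<omega> = \<sigma> * Z \<omega>" for \<omega> using 2 by (simp add: Z_def)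
    have [measurable]: "Z \<in> borel_measurable M" unfolding Z_def by measurable
    have "distributed M lborel Z std_normal_density"
      using normal_standard_normal_convert[of \<sigma> X 0] 2 by (simp add: Z_def)
    then have d: "distr M borel Z = ?S"
      by (simp add: distributed_def cong: distr_cong)
    have i2: "integrable ?S (\<lambda>x. x\<^sup>2)" and m2: "(LINT x|?S. x\<^sup>2) = 1"
      using std_normal_distribution_even_moments[of 1] by (simp_all add: fact_numeral)
    have "integrable M (\<lambda>\<omega>. (Z \<omega>)\<^sup>2)"
      using i2 unfolding d[symmetric] by (subst (asm) integrable_distr_eq) auto
    moreover have "expectation (\<lambda>\<omega>. (Z \<omega>)\<^sup>2) = 1"
      using m2 unfolding d[symmetric] by (subst (asm) integral_distr) auto
    moreover have "(LINT \<omega>|M. iexp (X \<omega>)) = (LINT x|?S. iexp (\<sigma> * x))"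
      unfolding d[symmetric] XZ by (subst integral_distr) auto
    moreover have "\<dots> = complex_of_real (exp (- \<sigma>\<^sup>2 / 2))"
      using fun_cong[OF char_std_normal_distribution, of \<sigma>] by (simp add: char_def)
    ultimately show ?thesis by (simp add: XZ power_mult_distrib)
  qed
  then show "integrable M (\<lambda>\<omega>. (X \<omega>)\<^sup>2)"
    "(LINT \<omega>|M. iexp (X \<omega>)) = complex_of_real (exp (- expectation (\<lambda>\<omega>. (X \<omega>)\<^sup>2) / 2))" by auto
qed

section \<open>Independence of pairs and mean-square integrals\<close>

text \<open>
  The rectangles generate the product \<open>\<sigma>\<close>-algebras and are stable under intersection, so independence
  need only be tested on them; there the independence of the two families splits each probability
  into an \<open>A\<close>-factor and a \<open>B\<close>-factor.
\<close>

lemma (in prob_space) indep_vars_pair: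
  assumes I: "I \<noteq> {}" "finite I"
    and A: "indep_vars M1 A I" and B: "indep_vars M2 B I"
    and AB: "indep_var (PiM I M1) (\<lambda>\<omega>. \<lambda>i\<in>I. A i \<omega>) (PiM I M2) (\<lambda>\<omega>. \<lambda>i\<in>I. B i \<omega>)"
  shows "indep_vars (\<lambda>i. M1 i \<Otimes>\<^sub>M M2 i) (\<lambda>i \<omega>. (A i \<omega>, B i \<omega>)) I"
proof -
  let ?E = "\<lambda>i. {a \<times> b | a b. a \<in> sets (M1 i) \<and> b \<in> sets (M2 i)}"
  have rvA: "i \<in> I \<Longrightarrow> random_variable (M1 i) (A i)" for i using A by (simp add: indep_vars_def)
  have rvB: "i \<in> I \<Longrightarrow> random_variable (M2 i) (B i)" for i using B by (simp add: indep_vars_def)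
  have "indep_vars (\<lambda>i. M1 i \<Otimes>\<^sub>M M2 i) (\<lambda>i \<omega>. (A i \<omega>, B i \<omega>)) I \<longleftrightarrow>
    (\<forall>C\<in>(\<Pi> i\<in>I. ?E i). prob (\<Inter>j\<in>I. (\<lambda>\<omega>. (A j \<omega>, B j \<omega>)) -` C j \<inter> space M) =
      (\<Prod>j\<in>I. prob ((\<lambda>\<omega>. (A j \<omega>, B j \<omega>)) -` C j \<inter> space M)))"
  proof (rule indep_vars_finite[OF I])
    fix i assume i: "i \<in> I"
    show "sets (M1 i \<Otimes>\<^sub>M M2 i) = sigma_sets (space (M1 i \<Otimes>\<^sub>M M2 i)) (?E i)"
      by (simp add: sets_pair_measure space_pair_measure)
    show "(\<lambda>\<omega>. (A i \<omega>, B i \<omega>)) \<in> M \<rightarrow>\<^sub>M M1 i \<Otimes>\<^sub>M M2 i"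
      using rvA[OF i] rvB[OF i] by (rule measurable_Pair)
    show "Int_stable (?E i)" by (rule Int_stable_pair_measure_generator)
    show "space (M1 i \<Otimes>\<^sub>M M2 i) \<in> ?E i" by (auto simp: space_pair_measure)
    show "?E i \<subseteq> Pow (space (M1 i \<Otimes>\<^sub>M M2 i))" using sets.space_closed by (fastforce simp: space_pair_measure)
  qed
  moreover have "prob (\<Inter>j\<in>I. (\<lambda>\<omega>. (A j \<omega>, B j \<omega>)) -` C j \<inter> space M) =
      (\<Prod>j\<in>I. prob ((\<lambda>\<omega>. (A j \<omega>, B j \<omega>)) -` C j \<inter> space M))" if C: "C \<in> (\<Pi> i\<in>I. ?E i)" for C
  proof -
    have "\<forall>i\<in>I. \<exists>ab. C i = fst ab \<times> snd ab \<and> fst ab \<in> sets (M1 i) \<and> snd ab \<in> sets (M2 i)"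
      using C by (fastforce simp: Pi_iff)
    then obtain ab where ab: "\<And>i. i \<in> I \<Longrightarrow> C i = fst (ab i) \<times> snd (ab i)"
      "\<And>i. i \<in> I \<Longrightarrow> fst (ab i) \<in> sets (M1 i)" "\<And>i. i \<in> I \<Longrightarrow> snd (ab i) \<in> sets (M2 i)"
      by (metis bchoice)
    have each: "prob ((\<lambda>\<omega>. (A j \<omega>, B j \<omega>)) -` C j \<inter> space M) =
      prob (A j -` fst (ab j) \<inter> space M) * prob (B j -` snd (ab j) \<inter> space M)" if j: "j \<in> I" for j
    proof -
      have "indep_var (M1 j) ((\<lambda>\<phi>. \<phi> j) \<circ> (\<lambda>\<omega>. \<lambda>i\<in>I. A i \<omega>)) (M2 j) ((\<lambda>\<phi>. \<phi> j) \<circ> (\<lambda>\<omega>. \<lambda>i\<in>I. B i \<omega>))"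
        by (rule indep_var_compose[OF AB]) (use j in auto)
      then have "indep_var (M1 j) (A j) (M2 j) (B j)" using j by (simp add: comp_def)
      from indep_varD[OF this ab(2)[OF j] ab(3)[OF j]] show ?thesis by (simp add: ab(1)[OF j])
    qed
    let ?a = "\<Pi>\<^sub>E i\<in>I. fst (ab i)" and ?b = "\<Pi>\<^sub>E i\<in>I. snd (ab i)"
    have "(\<Inter>j\<in>I. (\<lambda>\<omega>. (A j \<omega>, B j \<omega>)) -` C j \<inter> space M) =
      (\<lambda>\<omega>. (\<lambda>i\<in>I. A i \<omega>, \<lambda>i\<in>I. B i \<omega>)) -` (?a \<times> ?b) \<inter> space M"
      using I by (auto simp: ab(1) PiE_iff)
    then have "prob (\<Inter>j\<in>I. (\<lambda>\<omega>. (A j \<omega>, B j \<omega>)) -` C j \<inter> space M) =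
      prob ((\<lambda>\<omega>. \<lambda>i\<in>I. A i \<omega>) -` ?a \<inter> space M) * prob ((\<lambda>\<omega>. \<lambda>i\<in>I. B i \<omega>) -` ?b \<inter> space M)"
      using indep_varD[OF AB, of ?a ?b] I ab by (simp add: sets_PiM_I_finite)
    also have "(\<lambda>\<omega>. \<lambda>i\<in>I. A i \<omega>) -` ?a \<inter> space M = (\<Inter>j\<in>I. A j -` fst (ab j) \<inter> space M)"
      using I by (auto simp: PiE_iff)
    also have "(\<lambda>\<omega>. \<lambda>i\<in>I. B i \<omega>) -` ?b \<inter> space M = (\<Inter>j\<in>I. B j -` snd (ab j) \<inter> space M)"
      using I by (auto simp: PiE_iff)
    also have "prob (\<Inter>j\<in>I. A j -` fst (ab j) \<inter> space M) = (\<Prod>j\<in>I. prob (A j -` fst (ab j) \<inter> space M))"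
      by (rule indep_varsD_finite[OF A I]) (use ab in auto)
    also have "prob (\<Inter>j\<in>I. B j -` snd (ab j) \<inter> space M) = (\<Prod>j\<in>I. prob (B j -` snd (ab j) \<inter> space M))"
      by (rule indep_varsD_finite[OF B I]) (use ab in auto)
    finally show ?thesis by (simp add: each prod.distrib)
  qed
  ultimately show ?thesis by blast
qed

text \<open>
  Fubini's theorem for the random integral \<open>\<integral> S z d\<mu>(z)\<close> of a mean-square integrable field. The last
  part identifies its inner product with any square integrable \<open>Y\<close>; with \<open>Y\<close> ranging over values of
  the field and over the integral itself, it determines all second moments.
\<close>

lemma (in pair_prob_space) mean_square_integral:
  fixes S :: "'a \<Rightarrow> 'b \<Rightarrow> real"
  assumes [measurable]: "case_prod S \<in> borel_measurable (M1 \<Otimes>\<^sub>M M2)"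
    and sq: "integrable (M1 \<Otimes>\<^sub>M M2) (\<lambda>(z, \<omega>). (S z \<omega>)\<^sup>2)"
  shows "AE \<omega> in M2. integrable M1 (\<lambda>z. S z \<omega>)"
    "(\<lambda>\<omega>. LINT z|M1. S z \<omega>) \<in> borel_measurable M2"
    "integrable M2 (\<lambda>\<omega>. (LINT z|M1. S z \<omega>)\<^sup>2)"
    "\<And>Y. Y \<in> borel_measurable M2 \<Longrightarrow> integrable M2 (\<lambda>\<omega>. (Y \<omega>)\<^sup>2) \<Longrightarrow>
      (LINT \<omega>|M2. (LINT z|M1. S z \<omega>) * Y \<omega>) = (LINT z|M1. (LINT \<omega>|M2. S z \<omega> * Y \<omega>))"
proof -
  have slice: "\<And>\<omega>. \<omega> \<in> space M2 \<Longrightarrow> (\<lambda>z. S z \<omega>) \<in> borel_measurable M1" by measurable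
  have ae: "AE \<omega> in M2. integrable M1 (\<lambda>z. (S z \<omega>)\<^sup>2)"
    by (rule AE_integrable_snd[OF sq])
  then show ae1: "AE \<omega> in M2. integrable M1 (\<lambda>z. S z \<omega>)"
    using AE_space by eventually_elim (rule M1.square_integrable_imp_integrable, auto intro: slice)
  show meas[measurable]: "(\<lambda>\<omega>. LINT z|M1. S z \<omega>) \<in> borel_measurable M2"
    by measurable
  show "integrable M2 (\<lambda>\<omega>. (LINT z|M1. S z \<omega>)\<^sup>2)"
  proof (rule Bochner_Integration.integrable_bound)
    show "integrable M2 (\<lambda>\<omega>. LINT z|M1. (S z \<omega>)\<^sup>2)" by (rule integrable_snd[OF sq])
    show "AE \<omega> in M2. norm ((LINT z|M1. S z \<omega>)\<^sup>2) \<le> norm (LINT z|M1. (S z \<omega>)\<^sup>2)"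
      using ae ae1
    proof eventually_elim
      case (elim \<omega>)
      have "0 \<le> M1.variance (\<lambda>z. S z \<omega>)" by (rule M1.variance_positive)
      also have "\<dots> = M1.expectation (\<lambda>z. (S z \<omega>)\<^sup>2) - (M1.expectation (\<lambda>z. S z \<omega>))\<^sup>2"
        by (rule M1.variance_eq) (use elim in auto)
      finally show ?case by (simp add: abs_le_iff)
    qed
  qed measurable
  fix Y :: "'b \<Rightarrow> real"
  assume [measurable]: "Y \<in> borel_measurable M2" and Y: "integrable M2 (\<lambda>\<omega>. (Y \<omega>)\<^sup>2)"
  have "integrable (M1 \<Otimes>\<^sub>M M2) (\<lambda>p. (Y (snd p))\<^sup>2)"
    by (rule Fubini_integrable) (use Y in \<open>auto\<close>)
  then have "integrable (M1 \<Otimes>\<^sub>M M2) (\<lambda>p. S (fst p) (snd p) * Y (snd p))"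
    using sq by (intro integrable_mult_of_squares) (auto simp: split_beta')
  then have *: "integrable (M1 \<Otimes>\<^sub>M M2) (\<lambda>(z, \<omega>). S z \<omega> * Y \<omega>)" by (simp add: split_beta')
  have "(LINT \<omega>|M2. (LINT z|M1. S z \<omega>) * Y \<omega>) = (LINT \<omega>|M2. (LINT z|M1. S z \<omega> * Y \<omega>))"
    by simp
  also have "\<dots> = (LINT z|M1. (LINT \<omega>|M2. S z \<omega> * Y \<omega>))"
    by (rule Fubini_integral[OF *])
  finally show "(LINT \<omega>|M2. (LINT z|M1. S z \<omega>) * Y \<omega>) = (LINT z|M1. (LINT \<omega>|M2. S z \<omega> * Y \<omega>))" .
qed

section \<open>The heat kernel and the variance of the string\<close>

lemma heat_kernel_eq:
  assumes "t > 0"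
  shows "heat_kernel t x = 1 / sqrt (4 * pi) / sqrt t * exp (- x\<^sup>2 / (4 * t))"
proof -
  have "(4 * pi * t) powr (- 1 / 2) = inverse ((4 * pi * t) powr (1 / 2))"
    by (metis powr_minus minus_divide_left)
  also have "\<dots> = 1 / sqrt (4 * pi) / sqrt t"
    using assms by (simp add: powr_half_sqrt real_sqrt_mult divide_simps)
  finally show ?thesis unfolding heat_kernel_def by simp
qed

lemma heat_kernel_eq_normal_density:
  assumes "t > 0"
  shows "heat_kernel t x = normal_density 0 (sqrt (2 * t)) x"
  using assms by (simp add: heat_kernel_eq normal_density_def real_sqrt_mult field_simps)

lemma heat_kernel_0 [simp]: "heat_kernel 0 x = 0"
  by (simp add: heat_kernel_def)

lemma heat_kernel_nonneg [simp]: "0 \<le> heat_kernel t x"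
  by (simp add: heat_kernel_def)

lemma heat_kernel_minus [simp]: "heat_kernel t (- x) = heat_kernel t x"
  by (simp add: heat_kernel_def)

lemma heat_kernel_commute: "heat_kernel t (x - y) = heat_kernel t (y - x)"
  by (metis heat_kernel_minus minus_diff_eq)

lemma measurable_heat_kernel [measurable (raw)]:
  assumes [measurable]: "f \<in> borel_measurable M" "g \<in> borel_measurable M"
  shows "(\<lambda>p. heat_kernel (f p) (g p)) \<in> borel_measurable M"
  unfolding heat_kernel_def by measurable

lemma heat_kernel_le_centre: "t \<ge> 0 \<Longrightarrow> heat_kernel t x \<le> heat_kernel t 0"
  by (simp add: heat_kernel_def mult_left_le)

lemma heat_kernel_le_earlier_centre:
  assumes "u > 0" "t \<ge> 0"
  shows "heat_kernel (t + u) y \<le> heat_kernel u 0"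
proof -
  have "heat_kernel (t + u) y \<le> heat_kernel (t + u) 0" using assms by (intro heat_kernel_le_centre) auto
  also have "\<dots> \<le> heat_kernel u 0" using assms by (simp add: heat_kernel_eq frac_le)
  finally show ?thesis .
qed

lemma has_bochner_integral_heat_kernel:
  assumes "t > 0"
  shows "has_bochner_integral lborel (\<lambda>z. heat_kernel t (x - z)) 1"
proof -
  have "has_bochner_integral lborel (heat_kernel t) 1"
    using integrable_normal_density[of "sqrt (2 * t)" 0] integral_normal_density[of "sqrt (2 * t)" 0] assms
    by (simp add: has_bochner_integral_iff heat_kernel_eq_normal_density cong: Bochner_Integration.integral_cong Bochner_Integration.integrable_cong)
  from lborel_has_bochner_integral_real_affine_iff[of "-1" "heat_kernel t" 1 x] this
  show ?thesis by simp
qed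

lemma nn_integral_heat_kernel_mult:
  assumes "s > 0" "t > 0"
  shows "(\<integral>\<^sup>+z. ennreal (heat_kernel s (x - z) * heat_kernel t (y - z)) \<partial>lborel) =
    ennreal (heat_kernel (s + t) (x - y))"
proof -
  let ?f = "\<lambda>z. ennreal (normal_density 0 (sqrt (2 * s)) ((x - y) - z) * normal_density 0 (sqrt (2 * t)) z)"
  have "ennreal (heat_kernel (s + t) (x - y)) = (\<integral>\<^sup>+z. ?f z \<partial>lborel)"
    using fun_cong[OF conv_normal_density_zero_mean[of "sqrt (2 * s)" "sqrt (2 * t)"], of "x - y"] assms
    by (simp add: heat_kernel_eq_normal_density)
  also have "\<dots> = (\<integral>\<^sup>+z. ?f (- y + 1 * z) \<partial>lborel)"
    by (subst nn_integral_real_affine[where c=1 and t="- y"]) auto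
  also have "\<dots> = (\<integral>\<^sup>+z. ennreal (heat_kernel s (x - z) * heat_kernel t (y - z)) \<partial>lborel)"
    unfolding heat_kernel_commute[of t y] using assms
    by (simp add: heat_kernel_eq_normal_density)
  finally show ?thesis by simp
qed

lemma has_bochner_integral_heat_kernel_mult:
  assumes "s > 0" "t > 0"
  shows "has_bochner_integral lborel (\<lambda>z. heat_kernel s (x - z) * heat_kernel t (y - z))
    (heat_kernel (s + t) (x - y))"
  using nn_integral_heat_kernel_mult[OF assms]
  by (intro has_bochner_integral_nn_integral) auto

text \<open>
  The variance of a component of \<open>U\<^sub>t(x)\<close>, and also, by stationarity of the increments, of
  \<open>U\<^sub>s\<^sub>+\<^sub>t(y + x) - U\<^sub>s(y)\<close>. It equals \<open>\<integral> (G\<^sub>u(0) - G\<^sub>t\<^sub>+\<^sub>u(x)) du\<close> over \<open>u > 0\<close>; the form chosen here separates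
  the part \<open>2 \<kappa> \<surd>t\<close> due to time from an integrand that is nonnegative and vanishes for \<open>x = 0\<close>.
\<close>

definition string_variance :: "real \<Rightarrow> real \<Rightarrow> real" where
  "string_variance t x = 2 * (1 / sqrt (4 * pi)) * sqrt t +
     (LINT u:{t<..}|lborel. heat_kernel u 0 - heat_kernel u x)"

lemma string_variance_minus [simp]: "string_variance t (- x) = string_variance t x"
  by (simp add: string_variance_def)

lemma string_variance_commute: "string_variance t (x - y) = string_variance t (y - x)"
  by (metis string_variance_minus minus_diff_eq)

text \<open>
  The constant with \<open>G\<^sub>t(0) = \<kappa> / \<surd>t\<close> for \<open>t > 0\<close>.
\<close>

abbreviation (input) "\<kappa> \<equiv> 1 / sqrt (4 * pi) :: real"

text \<open>
  The rational function \<open>y / (1 + y)\<close> has the right behaviour at \<open>0\<close> and at \<open>\<infinity>\<close>, and after the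
  substitution \<open>y = x\<^sup>2 / (4 u)\<close> it leads to an integral with an elementary antiderivative.
\<close>

lemma one_minus_exp_bounds:
  fixes y :: real
  assumes "y \<ge> 0"
  shows "y / (1 + y) \<le> 1 - exp (- y)" "1 - exp (- y) \<le> 2 * (y / (1 + y))"
proof -
  have "exp (- y) \<le> 1 / (1 + y)"
    using exp_ge_add_one_self[of y] assms by (simp add: exp_minus divide_simps)
  then show "y / (1 + y) \<le> 1 - exp (- y)" using assms by (simp add: field_simps)
  show "1 - exp (- y) \<le> 2 * (y / (1 + y))"
  proof (cases "y \<le> 1")
    case True
    have "1 - exp (- y) \<le> y" using exp_ge_add_one_self[of "- y"] by simp
    also have "y \<le> 2 * (y / (1 + y))"
      using assms True mult_left_mono[of "1 + y" 2 y] by (simp add: pos_le_divide_eq mult.commute)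
    finally show ?thesis .
  next
    case False
    then have "1 \<le> 2 * (y / (1 + y))" by (simp add: field_simps)
    then show ?thesis using exp_ge_zero[of "- y"] by linarith
  qed
qed

text \<open>
  The antiderivative is \<open>\<bar>x\<bar> arctan (2 \<surd>u / \<bar>x\<bar>)\<close>.
\<close>

lemma arctan_kernel_integral:
  fixes x :: real
  assumes "x \<noteq> 0"
  shows "set_integrable lborel {0<..} (\<lambda>u. x\<^sup>2 / (sqrt u * (4 * u + x\<^sup>2)))"
    "(LINT u:{0<..}|lborel. x\<^sup>2 / (sqrt u * (4 * u + x\<^sup>2))) = \<bar>x\<bar> * pi / 2"
proof -
  let ?F = "\<lambda>u. \<bar>x\<bar> * arctan (2 * sqrt u / \<bar>x\<bar>)"
  have e: "einterval 0 \<infinity> = {0::real<..}"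
    by (auto simp: einterval_def)
  have deriv: "(?F has_real_derivative x\<^sup>2 / (sqrt u * (4 * u + x\<^sup>2))) (at u)" if "u > 0" for u
    using that assms
    by (auto intro!: derivative_eq_intros simp: power_divide divide_simps)
       (simp add: power2_eq_square algebra_simps flip: abs_mult)
  have l0: "((?F \<circ> real_of_ereal) \<longlongrightarrow> 0) (at_right (0::ereal))"
  proof -
    have "(?F \<longlongrightarrow> ?F 0) (at_right 0)"
      by (intro tendsto_intros) (use assms in auto)
    then show ?thesis by (simp only: zero_ereal_def ereal_tendsto_simps) simp
  qed
  have l1: "((?F \<circ> real_of_ereal) \<longlongrightarrow> \<bar>x\<bar> * (pi / 2)) (at_left (\<infinity>::ereal))"
  proof -
    have "filterlim (\<lambda>u. 2 / \<bar>x\<bar> * sqrt u) at_top at_top"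
      using assms by (intro filterlim_tendsto_pos_mult_at_top[OF tendsto_const] sqrt_at_top) auto
    then have "filterlim (\<lambda>u. 2 * sqrt u / \<bar>x\<bar>) at_top at_top" by simp
    from filterlim_compose[OF tendsto_arctan_at_top this]
    have "(?F \<longlongrightarrow> \<bar>x\<bar> * (pi / 2)) at_top" by (intro tendsto_intros)
    then show ?thesis by (simp only: ereal_tendsto_simps)
  qed
  have "isCont (\<lambda>u. x\<^sup>2 / (sqrt u * (4 * u + x\<^sup>2))) u" if "u > 0" for u
    using that by (intro continuous_intros) (auto simp: add_pos_nonneg less_imp_neq[symmetric])
  then have *: "set_integrable lborel (einterval 0 \<infinity>) (\<lambda>u. x\<^sup>2 / (sqrt u * (4 * u + x\<^sup>2)))"
    "(LBINT u=0..\<infinity>. x\<^sup>2 / (sqrt u * (4 * u + x\<^sup>2))) = \<bar>x\<bar> * (pi / 2) - 0"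
    using interval_integral_FTC_nonneg[OF _ deriv _ _ l0 l1] by auto
  then show "set_integrable lborel {0<..} (\<lambda>u. x\<^sup>2 / (sqrt u * (4 * u + x\<^sup>2)))"
    "(LINT u:{0<..}|lborel. x\<^sup>2 / (sqrt u * (4 * u + x\<^sup>2))) = \<bar>x\<bar> * pi / 2"
    by (simp_all add: e interval_lebesgue_integral_def)
qed

text \<open>
  The bounds on \<open>1 - exp (- y)\<close> for \<open>y = x\<^sup>2 / (4 u)\<close>, multiplied by \<open>G\<^sub>u(0) = \<kappa> / \<surd>u\<close>.
\<close>

lemma kernel_gap_bounds:
  assumes "u > 0"
  shows "\<kappa> * (x\<^sup>2 / (sqrt u * (4 * u + x\<^sup>2))) \<le> heat_kernel u 0 - heat_kernel u x"
    "heat_kernel u 0 - heat_kernel u x \<le> 2 * \<kappa> * (x\<^sup>2 / (sqrt u * (4 * u + x\<^sup>2)))"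
proof -
  define y where "y = x\<^sup>2 / (4 * u)"
  have y: "y \<ge> 0" using assms by (simp add: y_def)
  have 1: "heat_kernel u 0 - heat_kernel u x = \<kappa> / sqrt u * (1 - exp (- y))"
    using assms by (simp add: heat_kernel_eq y_def right_diff_distrib)
  have "y / (1 + y) = x\<^sup>2 / (4 * u + x\<^sup>2)"
    using assms by (simp add: y_def divide_simps)
  then have 2: "\<kappa> * (x\<^sup>2 / (sqrt u * (4 * u + x\<^sup>2))) = \<kappa> / sqrt u * (y / (1 + y))"
    by simp
  show "\<kappa> * (x\<^sup>2 / (sqrt u * (4 * u + x\<^sup>2))) \<le> heat_kernel u 0 - heat_kernel u x"
    unfolding 1 2 by (rule mult_left_mono[OF one_minus_exp_bounds(1)[OF y]]) (use assms in simp)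
  have "\<kappa> / sqrt u * (1 - exp (- y)) \<le> \<kappa> / sqrt u * (2 * (y / (1 + y)))"
    by (rule mult_left_mono[OF one_minus_exp_bounds(2)[OF y]]) (use assms in simp)
  then show "heat_kernel u 0 - heat_kernel u x \<le> 2 * \<kappa> * (x\<^sup>2 / (sqrt u * (4 * u + x\<^sup>2)))"
    unfolding 1 mult.assoc 2 by (simp add: algebra_simps)
qed

lemma kernel_gap_integrable:
  assumes "t \<ge> 0"
  shows "set_integrable lborel {t<..} (\<lambda>u. heat_kernel u 0 - heat_kernel u x)"
proof -
  have "set_integrable lborel {0<..} (\<lambda>u. heat_kernel u 0 - heat_kernel u x)"
  proof (cases "x = 0")
    case True then show ?thesis by (simp add: set_integrable_def)
  next
    case False
    have "set_integrable lborel {0<..} (\<lambda>u. 2 * \<kappa> * (x\<^sup>2 / (sqrt u * (4 * u + x\<^sup>2))))"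
      by (rule set_integrable_mult_right) (rule arctan_kernel_integral(1)[OF False])
    then show ?thesis
      unfolding set_integrable_def
    proof (rule Bochner_Integration.integrable_bound)
      show "AE u in lborel. norm (indicat_real {0<..} u *\<^sub>R (heat_kernel u 0 - heat_kernel u x))
        \<le> norm (indicat_real {0<..} u *\<^sub>R (2 * \<kappa> * (x\<^sup>2 / (sqrt u * (4 * u + x\<^sup>2)))))"
      proof (intro AE_I2)
        fix u :: real
        show "norm (indicat_real {0<..} u *\<^sub>R (heat_kernel u 0 - heat_kernel u x))
        \<le> norm (indicat_real {0<..} u *\<^sub>R (2 * \<kappa> * (x\<^sup>2 / (sqrt u * (4 * u + x\<^sup>2)))))"
        using kernel_gap_bounds(2)[of u x] heat_kernel_le_centre[of u x]
        by (auto simp: indicator_def abs_le_iff intro: order_trans[OF _ abs_ge_self])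
      qed
    qed auto
  qed
  then show ?thesis by (rule set_integrable_subset) (use assms in auto)
qed

lemma string_variance_lower: "t \<ge> 0 \<Longrightarrow> 2 * \<kappa> * sqrt t \<le> string_variance t x"
  unfolding string_variance_def set_lebesgue_integral_def
  by (simp, rule Bochner_Integration.integral_nonneg) (auto simp: indicator_def heat_kernel_le_centre)

lemma string_variance_nonneg: "t \<ge> 0 \<Longrightarrow> 0 \<le> string_variance t x"
  by (rule order_trans[OF _ string_variance_lower]) auto

lemma string_variance_0_0 [simp]: "string_variance 0 0 = 0"
  by (simp add: string_variance_def set_lebesgue_integral_def)

lemma measurable_string_variance [measurable]: "string_variance s \<in> borel_measurable borel"
proof -
  have "(\<lambda>x. string_variance s x) \<in> borel_measurable borel"
    unfolding string_variance_def set_lebesgue_integral_def by measurable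
  then show ?thesis by simp
qed

lemma string_variance_pos: "t > 0 \<Longrightarrow> 0 < string_variance t x"
  by (rule less_le_trans[OF _ string_variance_lower]) auto

lemma string_variance_upper:
  assumes "t \<ge> 0"
  shows "string_variance t x \<le> 2 * \<kappa> * sqrt t + 4 * \<kappa> * \<bar>x\<bar>"
proof (cases "x = 0")
  case True then show ?thesis by (simp add: string_variance_def set_lebesgue_integral_def)
next
  case False
  have "(LINT u:{t<..}|lborel. heat_kernel u 0 - heat_kernel u x) \<le>
    (LINT u:{0<..}|lborel. 2 * \<kappa> * (x\<^sup>2 / (sqrt u * (4 * u + x\<^sup>2))))"
    unfolding set_lebesgue_integral_def
  proof (rule integral_mono)
    show "integrable lborel (\<lambda>u. indicat_real {t<..} u *\<^sub>R (heat_kernel u 0 - heat_kernel u x))"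
      using kernel_gap_integrable[OF assms] by (simp add: set_integrable_def)
    have "set_integrable lborel {0<..} (\<lambda>u. 2 * \<kappa> * (x\<^sup>2 / (sqrt u * (4 * u + x\<^sup>2))))"
      by (rule set_integrable_mult_right) (rule arctan_kernel_integral(1)[OF False])
    then show "integrable lborel (\<lambda>u. indicat_real {0<..} u *\<^sub>R (2 * \<kappa> * (x\<^sup>2 / (sqrt u * (4 * u + x\<^sup>2)))))"
      by (simp add: set_integrable_def)
    fix u :: real
    show "indicat_real {t<..} u *\<^sub>R (heat_kernel u 0 - heat_kernel u x)
        \<le> indicat_real {0<..} u *\<^sub>R (2 * \<kappa> * (x\<^sup>2 / (sqrt u * (4 * u + x\<^sup>2))))"
      using kernel_gap_bounds(2)[of u x] assms
      by (auto simp: indicator_def intro!: mult_nonneg_nonneg divide_nonneg_nonneg)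
  qed
  also have "\<dots> = 2 * \<kappa> * (\<bar>x\<bar> * pi / 2)"
    unfolding set_integral_mult_right arctan_kernel_integral(2)[OF False] ..
  also have "\<dots> \<le> 2 * \<kappa> * (\<bar>x\<bar> * 2)"
    using mult_left_mono[of pi 4 "\<bar>x\<bar>"] pi_less_4 by (intro mult_left_mono) auto
  finally show ?thesis by (simp add: string_variance_def)
qed

text \<open>
  The exact value is \<open>\<bar>x\<bar> / 2\<close>; comparison with the arctangent integral already gives
  \<open>\<kappa> \<bar>x\<bar> \<pi> / 2\<close>.
\<close>

lemma string_variance_at_0: "\<kappa> * \<bar>x\<bar> \<le> string_variance 0 x"
proof (cases "x = 0")
  case True then show ?thesis by (simp add: string_variance_def set_lebesgue_integral_def)
next
  case False
  have "\<kappa> * \<bar>x\<bar> \<le> \<kappa> * (\<bar>x\<bar> * pi / 2)"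
    using pi_ge_two by (intro mult_left_mono) (auto simp: mult_left_mono)
  also have "\<dots> = (LINT u:{0<..}|lborel. \<kappa> * (x\<^sup>2 / (sqrt u * (4 * u + x\<^sup>2))))"
    unfolding set_integral_mult_right arctan_kernel_integral(2)[OF False] ..
  also have "\<dots> \<le> (LINT u:{0<..}|lborel. heat_kernel u 0 - heat_kernel u x)"
  proof (rule set_integral_mono)
    show "set_integrable lborel {0<..} (\<lambda>u. \<kappa> * (x\<^sup>2 / (sqrt u * (4 * u + x\<^sup>2))))"
      by (rule set_integrable_mult_right) (rule arctan_kernel_integral(1)[OF False])
  qed (use kernel_gap_integrable[of 0] kernel_gap_bounds(1) in auto)
  finally show ?thesis by (simp add: string_variance_def)
qed

lemma heat_kernel_centre_time_integral:
  assumes "0 \<le> s" "s \<le> t"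
  shows "set_integrable lborel {s<..t} (\<lambda>u. heat_kernel u 0)"
    "(LINT u:{s<..t}|lborel. heat_kernel u 0) = 2 * \<kappa> * (sqrt t - sqrt s)"
proof -
  have "set_integrable lborel {s<..t} (\<lambda>u. heat_kernel u 0) \<and>
    (LINT u:{s<..t}|lborel. heat_kernel u 0) = 2 * \<kappa> * (sqrt t - sqrt s)"
  proof (cases "s = t")
    case True then show ?thesis by (simp add: set_integrable_def set_lebesgue_integral_def)
  next
    case False
    then have st: "ereal s < ereal t" using assms by simp
    let ?F = "\<lambda>u. 2 * \<kappa> * sqrt u"
    have e: "einterval s t = {s<..<t}" by (auto simp: einterval_def)
    have deriv: "(?F has_real_derivative heat_kernel u 0) (at u)"
      if "ereal s < ereal u" "ereal u < ereal t" for u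
      using that assms by (auto intro!: derivative_eq_intros simp: heat_kernel_eq divide_simps)
    have cont: "isCont (\<lambda>u. heat_kernel u 0) u" if "ereal s < ereal u" "ereal u < ereal t" for u
      unfolding heat_kernel_def using that assms by (intro continuous_intros) auto
    have l0: "((?F \<circ> real_of_ereal) \<longlongrightarrow> ?F s) (at_right (ereal s))"
      unfolding ereal_tendsto_simps by (auto intro!: tendsto_intros)
    have l1: "((?F \<circ> real_of_ereal) \<longlongrightarrow> ?F t) (at_left (ereal t))"
      unfolding ereal_tendsto_simps by (auto intro!: tendsto_intros)
    have *: "set_integrable lborel (einterval s t) (\<lambda>u. heat_kernel u 0)"
      "(LBINT u=s..t. heat_kernel u 0) = ?F t - ?F s"
      using interval_integral_FTC_nonneg[OF st deriv cont _ l0 l1] by auto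
    have ae: "AE u in lborel. indicat_real {s<..<t} u *\<^sub>R heat_kernel u 0 = indicat_real {s<..t} u *\<^sub>R heat_kernel u 0"
      using AE_lborel_singleton[of t] by eventually_elim (auto simp: indicator_def)
    have "set_integrable lborel {s<..t} (\<lambda>u. heat_kernel u 0)"
      using *(1) unfolding e set_integrable_def
      by (rule integrable_cong_AE_imp) (use ae in auto)
    moreover have "(LINT u:{s<..t}|lborel. heat_kernel u 0) = (LINT u:{s<..<t}|lborel. heat_kernel u 0)"
      unfolding set_lebesgue_integral_def by (rule integral_cong_AE) (use ae in auto)
    ultimately show ?thesis using *(2) st
      by (simp add: e interval_lebesgue_integral_def right_diff_distrib)
  qed
  then show "set_integrable lborel {s<..t} (\<lambda>u. heat_kernel u 0)"
    "(LINT u:{s<..t}|lborel. heat_kernel u 0) = 2 * \<kappa> * (sqrt t - sqrt s)" by auto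
qed

text \<open>
  Increasing \<open>t\<close> moves the lower limit of integration, and \<open>2 \<kappa> \<surd>t\<close> is an antiderivative of
  \<open>G\<^sub>t(0)\<close>; the two contributions of \<open>G\<^sub>u(0)\<close> cancel.
\<close>

lemma string_variance_time_diff:
  assumes "0 \<le> s" "s \<le> t"
  shows "set_integrable lborel {s<..t} (\<lambda>u. heat_kernel u x)"
    "(LINT u:{s<..t}|lborel. heat_kernel u x) = string_variance t x - string_variance s x"
proof -
  have gap: "set_integrable lborel {s<..t} (\<lambda>u. heat_kernel u 0 - heat_kernel u x)"
    by (rule set_integrable_subset[OF kernel_gap_integrable[OF assms(1)]]) auto
  note i0 = heat_kernel_centre_time_integral[OF assms]
  from set_integral_diff(1)[OF i0(1) gap]
  show "set_integrable lborel {s<..t} (\<lambda>u. heat_kernel u x)" by simp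
  have U: "{s<..} = {s<..t} \<union> {t<..}" using assms by auto
  have "(LINT u:{s<..}|lborel. heat_kernel u 0 - heat_kernel u x) =
    (LINT u:{s<..t}|lborel. heat_kernel u 0 - heat_kernel u x) +
    (LINT u:{t<..}|lborel. heat_kernel u 0 - heat_kernel u x)"
    unfolding U by (rule set_integral_Un) (use gap kernel_gap_integrable[of t x] assms in auto)
  moreover have "(LINT u:{s<..t}|lborel. heat_kernel u x) =
     (LINT u:{s<..t}|lborel. heat_kernel u 0) - (LINT u:{s<..t}|lborel. heat_kernel u 0 - heat_kernel u x)"
    using set_integral_diff(2)[OF i0(1) gap] by simp
  ultimately show "(LINT u:{s<..t}|lborel. heat_kernel u x) = string_variance t x - string_variance s x"
    unfolding string_variance_def i0(2) by (simp add: algebra_simps diff_divide_distrib)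
qed

lemma string_variance_time_bounds:
  assumes "0 \<le> s" "s \<le> t"
  shows "string_variance s x \<le> string_variance t x"
    "string_variance t x - string_variance s x \<le> 2 * \<kappa> * (sqrt t - sqrt s)"
proof -
  note d = string_variance_time_diff[OF assms]
  have "0 \<le> (LINT u:{s<..t}|lborel. heat_kernel u x)"
    unfolding set_lebesgue_integral_def by (rule Bochner_Integration.integral_nonneg) simp
  then show "string_variance s x \<le> string_variance t x" using d(2) by simp
  have "(LINT u:{s<..t}|lborel. heat_kernel u x) \<le> (LINT u:{s<..t}|lborel. heat_kernel u 0)"
    by (rule set_integral_mono) (use assms d heat_kernel_centre_time_integral[OF assms] in \<open>auto intro: heat_kernel_le_centre\<close>)
  then show "string_variance t x - string_variance s x \<le> 2 * \<kappa> * (sqrt t - sqrt s)"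
    using d(2) heat_kernel_centre_time_integral(2)[OF assms] by simp
qed

text \<open>
  The difference is an integral of \<open>G\<^sub>u(y) - G\<^sub>u(x)\<close> over \<open>u > t\<close>, and there the mean value theorem
  gives the integrable bound \<open>\<kappa> \<bar>x\<^sup>2 - y\<^sup>2\<bar> / (4 u \<surd>u)\<close>.
\<close>

lemma string_variance_space_bound:
  assumes "t > 0"
  shows "\<bar>string_variance t x - string_variance t y\<bar> \<le> \<kappa> * \<bar>x\<^sup>2 - y\<^sup>2\<bar> / (2 * sqrt t)"
proof -
  let ?m = "\<lambda>u. \<kappa> * \<bar>x\<^sup>2 - y\<^sup>2\<bar> / 4 * (1 / (u * sqrt u))"
  let ?F = "\<lambda>u. - 2 * (1 / sqrt u)"
  have e: "einterval t \<infinity> = {t<..}" by (auto simp: einterval_def)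
  have deriv: "(?F has_real_derivative (1 / (u * sqrt u))) (at u)" if "ereal t < ereal u" for u
    using that assms by (auto intro!: derivative_eq_intros simp: divide_simps)
  have cont: "isCont (\<lambda>u. 1 / (u * sqrt u)) u" if "ereal t < ereal u" for u
    using that assms by (intro continuous_intros) auto
  have l0: "((?F \<circ> real_of_ereal) \<longlongrightarrow> ?F t) (at_right (ereal t))"
    unfolding ereal_tendsto_simps using assms by (auto intro!: tendsto_intros)
  have "(?F \<longlongrightarrow> - 2 * 0) at_top"
    by (intro tendsto_mult tendsto_const tendsto_divide_0[OF tendsto_const] filterlim_at_top_imp_at_infinity sqrt_at_top)
  then have l1: "((?F \<circ> real_of_ereal) \<longlongrightarrow> 0) (at_left (\<infinity>::ereal))"
    by (simp only: ereal_tendsto_simps) simp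
  have *: "set_integrable lborel {t<..} (\<lambda>u. 1 / (u * sqrt u))"
    "(LINT u:{t<..}|lborel. 1 / (u * sqrt u)) = 2 / sqrt t"
    using interval_integral_FTC_nonneg[OF _ deriv cont _ l0 l1] assms
    by (auto simp: e interval_lebesgue_integral_def)
  have diff: "set_integrable lborel {t<..} (\<lambda>u. heat_kernel u y - heat_kernel u x)"
    "(LINT u:{t<..}|lborel. heat_kernel u y - heat_kernel u x) = string_variance t x - string_variance t y"
    for x y
    using set_integral_diff[OF kernel_gap_integrable[of t x] kernel_gap_integrable[of t y]] assms
    by (auto simp: string_variance_def)
  note d = diff[of y x] and d' = diff[of x y]
  have le: "\<bar>heat_kernel u y - heat_kernel u x\<bar> \<le> ?m u" if "u > t" for u
  proof -
    have lip: "\<bar>exp (- a) - exp (- b)\<bar> \<le> \<bar>b - a\<bar>" if "0 \<le> a" "0 \<le> b" for a b :: real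
    proof -
      have "exp (- a) - exp (- b) \<le> b - a" if ab: "0 \<le> a" "a \<le> b" for a b :: real
      proof -
        have "exp (- a) - exp (- b) = exp (- a) * (1 - exp (a - b))"
          by (simp add: algebra_simps exp_add[symmetric])
        also have "\<dots> \<le> 1 * (b - a)"
        proof (rule mult_mono)
          show "1 - exp (a - b) \<le> b - a" using exp_ge_add_one_self[of "a - b"] by linarith
        qed (use ab in auto)
        finally show ?thesis by simp
      qed
      from this[of a b] this[of b a] that show ?thesis by (cases "a \<le> b") auto
    qed
    have u: "u > 0" using that assms by simp
    have "\<bar>heat_kernel u y - heat_kernel u x\<bar> = \<kappa> / sqrt u * \<bar>exp (- (y\<^sup>2 / (4 * u))) - exp (- (x\<^sup>2 / (4 * u)))\<bar>"
    proof -
      have "heat_kernel u y - heat_kernel u x = \<kappa> / sqrt u * (exp (- (y\<^sup>2 / (4 * u))) - exp (- (x\<^sup>2 / (4 * u))))"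
        using u by (simp add: heat_kernel_eq right_diff_distrib)
      then show ?thesis using u by (simp only: abs_mult) simp
    qed
    also have "\<dots> \<le> \<kappa> / sqrt u * \<bar>x\<^sup>2 / (4 * u) - y\<^sup>2 / (4 * u)\<bar>"
      using u by (intro mult_left_mono lip) auto
    also have "\<dots> = ?m u"
      using u by (simp add: diff_divide_distrib[symmetric] field_simps)
    finally show ?thesis .
  qed
  have mi: "set_integrable lborel {t<..} ?m" by (intro set_integrable_mult_right *(1))
  have "\<bar>LINT u:{t<..}|lborel. heat_kernel u y - heat_kernel u x\<bar> \<le> (LINT u:{t<..}|lborel. ?m u)"
  proof (rule abs_leI)
    show "(LINT u:{t<..}|lborel. heat_kernel u y - heat_kernel u x) \<le> (LINT u:{t<..}|lborel. ?m u)"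
      by (rule set_integral_mono[OF d(1) mi]) (use le in \<open>auto simp: abs_le_iff\<close>)
    have "- (LINT u:{t<..}|lborel. heat_kernel u y - heat_kernel u x) =
      (LINT u:{t<..}|lborel. heat_kernel u x - heat_kernel u y)"
      unfolding d(2) d'(2) by simp
    also have "\<dots> \<le> (LINT u:{t<..}|lborel. ?m u)"
      by (rule set_integral_mono[OF d'(1) mi]) (use le in \<open>auto simp: abs_le_iff\<close>)
    finally show "- (LINT u:{t<..}|lborel. heat_kernel u y - heat_kernel u x) \<le> (LINT u:{t<..}|lborel. ?m u)" .
  qed
  also have "(LINT u:{t<..}|lborel. ?m u) = \<kappa> * \<bar>x\<^sup>2 - y\<^sup>2\<bar> / 4 * (2 / sqrt t)"
    unfolding set_integral_mult_right *(2) ..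
  finally show ?thesis unfolding d(2) by simp
qed

text \<open>
  This is the form in which the variance appears when the kernels are integrated over space-time.
  The difference \<open>G\<^sub>u(0) - G\<^sub>t\<^sub>+\<^sub>u(x)\<close> is split at \<open>G\<^sub>t\<^sub>+\<^sub>u(0)\<close>, into a part with antiderivative
  \<open>2 \<kappa> (\<surd>u - \<surd>(t + u))\<close> and a shifted copy of the integrand in the definition.
\<close>

lemma nn_integral_string_variance:
  assumes "t \<ge> 0"
  shows "(\<integral>\<^sup>+u. ennreal (heat_kernel u 0 - heat_kernel (t + u) x) * indicator {0<..} u \<partial>lborel) =
    ennreal (string_variance t x)"
proof -
  let ?F = "\<lambda>u. 2 * \<kappa> * (sqrt u - sqrt (t + u))"
  have e: "einterval 0 \<infinity> = {0::real<..}" by (auto simp: einterval_def)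
  have mono: "heat_kernel (t + u) y \<le> heat_kernel u 0" if "u > 0" for u y
    by (rule heat_kernel_le_earlier_centre[OF that assms])
  have deriv: "(?F has_real_derivative heat_kernel u 0 - heat_kernel (t + u) 0) (at u)" if "u > 0" for u
    using that assms by (auto intro!: derivative_eq_intros simp: heat_kernel_eq divide_simps)
  have cont: "isCont (\<lambda>u. heat_kernel u 0 - heat_kernel (t + u) 0) u" if "u > 0" for u
    unfolding heat_kernel_def using that assms by (intro continuous_intros) auto
  have "(?F \<longlongrightarrow> ?F 0) (at_right 0)" by (intro tendsto_intros)
  then have l0: "((?F \<circ> real_of_ereal) \<longlongrightarrow> - (2 * \<kappa> * sqrt t)) (at_right (0::ereal))"
    by (simp only: zero_ereal_def ereal_tendsto_simps) simp
  have "((\<lambda>u. sqrt (t + u) - sqrt u) \<longlongrightarrow> 0) at_top"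
  proof (rule tendsto_sandwich[where f="\<lambda>_. 0" and h="\<lambda>u. t / sqrt u"])
    show "\<forall>\<^sub>F u in at_top. sqrt (t + u) - sqrt u \<le> t / sqrt u"
      using eventually_gt_at_top[of 0]
    proof eventually_elim
      case (elim u)
      have "(sqrt (t + u) - sqrt u) * (sqrt (t + u) + sqrt u) = t"
        using elim assms by (simp add: algebra_simps)
      moreover have "(sqrt (t + u) - sqrt u) * sqrt u \<le> (sqrt (t + u) - sqrt u) * (sqrt (t + u) + sqrt u)"
        using elim assms by (intro mult_left_mono) auto
      ultimately show ?case using elim by (simp add: pos_le_divide_eq)
    qed
    show "((\<lambda>u. t / sqrt u) \<longlongrightarrow> 0) at_top"
      by (intro tendsto_divide_0[OF tendsto_const] filterlim_at_top_imp_at_infinity sqrt_at_top)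
  qed (use assms in \<open>auto simp: eventually_at_top_linorder\<close>)
  then have "((\<lambda>u. 2 * \<kappa> * - (sqrt (t + u) - sqrt u)) \<longlongrightarrow> 2 * \<kappa> * - 0) at_top"
    by (intro tendsto_intros)
  then have "(?F \<longlongrightarrow> 0) at_top" by simp
  then have l1: "((?F \<circ> real_of_ereal) \<longlongrightarrow> 0) (at_left (\<infinity>::ereal))"
    by (simp only: ereal_tendsto_simps)
  have 1: "set_integrable lborel {0<..} (\<lambda>u. heat_kernel u 0 - heat_kernel (t + u) 0)"
    "(LINT u:{0<..}|lborel. heat_kernel u 0 - heat_kernel (t + u) 0) = 2 * \<kappa> * sqrt t"
    using interval_integral_FTC_nonneg[OF _ deriv cont _ l0 l1] mono
    by (auto simp: e interval_lebesgue_integral_def)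
  let ?g = "\<lambda>u. indicat_real {t<..} u *\<^sub>R (heat_kernel u 0 - heat_kernel u x)"
  have shift: "?g (t + 1 * u) = indicat_real {0<..} u *\<^sub>R (heat_kernel (t + u) 0 - heat_kernel (t + u) x)" for u
    by (auto simp: indicator_def)
  have 2: "set_integrable lborel {0<..} (\<lambda>u. heat_kernel (t + u) 0 - heat_kernel (t + u) x)"
    using lborel_integrable_real_affine[of ?g 1 t] kernel_gap_integrable[OF assms, of x]
    by (simp only: shift set_integrable_def)
  have 3: "(LINT u:{0<..}|lborel. heat_kernel (t + u) 0 - heat_kernel (t + u) x) =
      (LINT u:{t<..}|lborel. heat_kernel u 0 - heat_kernel u x)"
    using lborel_integral_real_affine[of 1 ?g t] by (simp only: shift set_lebesgue_integral_def) simp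
  have 4: "set_integrable lborel {0<..} (\<lambda>u. heat_kernel u 0 - heat_kernel (t + u) x)"
    "(LINT u:{0<..}|lborel. heat_kernel u 0 - heat_kernel (t + u) x) = string_variance t x"
    using set_integral_add[OF 1(1) 2] 1(2) 3 by (auto simp: string_variance_def)
  have "(\<integral>\<^sup>+u. ennreal (heat_kernel u 0 - heat_kernel (t + u) x) * indicator {0<..} u \<partial>lborel) =
    (\<integral>\<^sup>+u. ennreal (indicat_real {0<..} u *\<^sub>R (heat_kernel u 0 - heat_kernel (t + u) x)) \<partial>lborel)"
    by (intro nn_integral_cong) (auto simp: indicator_def)
  also have "\<dots> = ennreal (string_variance t x)"
    using 4 mono unfolding set_integrable_def set_lebesgue_integral_def
    by (subst nn_integral_eq_integral) (auto simp: indicator_def)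
  finally show ?thesis .
qed

text \<open>
  Smoothing by \<open>G\<^sub>t\<close> advances the time argument, because \<open>G\<^sub>t\<close> maps \<open>G\<^sub>s\<^sub>+\<^sub>u\<close> to \<open>G\<^sub>t\<^sub>+\<^sub>s\<^sub>+\<^sub>u\<close> and fixes
  the constant \<open>G\<^sub>u(0)\<close> in the integral representation. The integrand is nonnegative, so Tonelli's
  theorem applies.
\<close>

lemma nn_integral_heat_kernel_string_variance:
  assumes "t > 0" "s \<ge> 0"
  shows "(\<integral>\<^sup>+z. ennreal (heat_kernel t (x - z) * string_variance s (z - y)) \<partial>lborel) =
    ennreal (string_variance (t + s) (x - y))"
proof -
  have inner: "(\<integral>\<^sup>+z. ennreal (heat_kernel t (x - z)) * ennreal (heat_kernel u 0 - heat_kernel (s + u) (z - y)) \<partial>lborel)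
    = ennreal (heat_kernel u 0 - heat_kernel (t + s + u) (x - y))" if u: "u > 0" for u
  proof -
    have le: "heat_kernel (s + u) (z - y) \<le> heat_kernel u 0" for z
      by (rule heat_kernel_le_earlier_centre[OF u assms(2)])
    have "has_bochner_integral lborel (\<lambda>z. heat_kernel t (x - z) * heat_kernel u 0 - heat_kernel t (x - z) * heat_kernel (s + u) (y - z))
      (1 * heat_kernel u 0 - heat_kernel (t + (s + u)) (x - y))"
      using assms u by (intro has_bochner_integral_diff has_bochner_integral_mult_left
          has_bochner_integral_heat_kernel has_bochner_integral_heat_kernel_mult) auto
    then have *: "has_bochner_integral lborel (\<lambda>z. heat_kernel t (x - z) * (heat_kernel u 0 - heat_kernel (s + u) (z - y)))
      (heat_kernel u 0 - heat_kernel (t + s + u) (x - y))"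
      by (simp add: algebra_simps heat_kernel_commute[of "s + u" y])
    show ?thesis using nn_integral_eq_integral[of lborel "\<lambda>z. heat_kernel t (x - z) * (heat_kernel u 0 - heat_kernel (s + u) (z - y))"] *
      le by (simp add: has_bochner_integral_iff ennreal_mult)
  qed
  have "(\<integral>\<^sup>+z. ennreal (heat_kernel t (x - z) * string_variance s (z - y)) \<partial>lborel) =
    (\<integral>\<^sup>+z. (\<integral>\<^sup>+u. ennreal (heat_kernel t (x - z)) * (ennreal (heat_kernel u 0 - heat_kernel (s + u) (z - y)) * indicator {0<..} u) \<partial>lborel) \<partial>lborel)"
    by (subst nn_integral_cmult) (simp_all add: nn_integral_string_variance assms ennreal_mult')
  also have "\<dots> = (\<integral>\<^sup>+u. (\<integral>\<^sup>+z. ennreal (heat_kernel t (x - z)) * (ennreal (heat_kernel u 0 - heat_kernel (s + u) (z - y)) * indicator {0<..} u) \<partial>lborel) \<partial>lborel)"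
    by (rule lborel_pair.Fubini') measurable
  also have "\<dots> = (\<integral>\<^sup>+u. ennreal (heat_kernel u 0 - heat_kernel (t + s + u) (x - y)) * indicator {0<..} u \<partial>lborel)"
    by (intro nn_integral_cong) (auto simp: indicator_def inner)
  also have "\<dots> = ennreal (string_variance (t + s) (x - y))"
    using assms by (intro nn_integral_string_variance) simp
  finally show ?thesis .
qed

text \<open>
  The covariance of equal components of \<open>U\<^sub>t(x)\<close> and \<open>U\<^sub>s(y)\<close>, obtained by polarization.
\<close>

definition string_covariance :: "real \<Rightarrow> real \<Rightarrow> real \<Rightarrow> real \<Rightarrow> real" where
  "string_covariance t x s y =
     (string_variance t x + string_variance s y - string_variance \<bar>t - s\<bar> (x - y)) / 2"

section \<open>Covariances of the stochastic integrals\<close>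

text \<open>
  The integrand of \<open>W'\<close> in \<open>U\<^sub>t(x)\<close>: the kernel of \<open>U\<^sub>0\<close> after smoothing by \<open>G\<^sub>t\<close>.
\<close>

definition init_kernel :: "real \<Rightarrow> real \<Rightarrow> real \<times> real \<Rightarrow> real" where
  "init_kernel t x = (\<lambda>(r, z). heat_kernel (t + r) (x - z) - heat_kernel r z)"

text \<open>
  The integrand of \<open>W\<close> in \<open>U\<^sub>t(x)\<close>.
\<close>

definition noise_kernel :: "real \<Rightarrow> real \<Rightarrow> real \<times> real \<Rightarrow> real" where
  "noise_kernel t x = (\<lambda>(r, z). indicator {0..<t} r * heat_kernel (t - r) (x - z))"

lemma measurable_init_kernel [measurable]: "init_kernel t x \<in> borel_measurable borel"
proof -
  have "init_kernel t x \<in> borel_measurable (borel \<Otimes>\<^sub>M borel)"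
    unfolding init_kernel_def by measurable
  then show ?thesis by (simp add: borel_prod)
qed

lemma measurable_noise_kernel [measurable]: "noise_kernel t x \<in> borel_measurable borel"
proof -
  have "noise_kernel t x \<in> borel_measurable (borel \<Otimes>\<^sub>M borel)"
    unfolding noise_kernel_def by measurable
  then show ?thesis by (simp add: borel_prod)
qed

lemma half_plane_sets [measurable]: "({0..} \<times> UNIV :: (real \<times> real) set) \<in> sets borel"
  by (intro borel_closed closed_Times) auto

lemma measurable_kernels_spacetime [measurable]:
  "init_kernel t x \<in> borel_measurable spacetime" "noise_kernel t x \<in> borel_measurable spacetime"
  unfolding spacetime_def by (auto intro!: measurable_restrict_space1)

lemma nn_integral_spacetime:
  assumes [measurable]: "f \<in> borel_measurable borel"
  shows "(\<integral>\<^sup>+p. f p \<partial>spacetime) = (\<integral>\<^sup>+r. (\<integral>\<^sup>+z. f (r, z) \<partial>lborel) * indicator {0..} r \<partial>lborel)"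
proof -
  have "(\<integral>\<^sup>+p. f p \<partial>spacetime) = (\<integral>\<^sup>+p. f p * indicator ({0..} \<times> UNIV) p \<partial>lborel)"
    unfolding spacetime_def by (rule nn_integral_restrict_space) simp
  also have "\<dots> = (\<integral>\<^sup>+p. f p * indicator ({0..} \<times> UNIV) p \<partial>(lborel \<Otimes>\<^sub>M lborel))"
    by (simp add: lborel_prod)
  also have "\<dots> = (\<integral>\<^sup>+r. (\<integral>\<^sup>+z. f (r, z) * indicator ({0..} \<times> UNIV) (r, z) \<partial>lborel) \<partial>lborel)"
    by (rule lborel.nn_integral_fst[symmetric]) (simp add: lborel_prod)
  also have "\<dots> = (\<integral>\<^sup>+r. (\<integral>\<^sup>+z. f (r, z) \<partial>lborel) * indicator {0..} r \<partial>lborel)"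
    by (intro nn_integral_cong) (auto simp: indicator_def)
  finally show ?thesis .
qed

lemma ennreal_half:
  assumes "ennreal 2 * X = ennreal D"
  shows "X = ennreal (D / 2)"
proof -
  have "ennreal (1 / 2) * ennreal 2 = 1" by (subst ennreal_mult[symmetric]) auto
  then have "X = ennreal (1 / 2) * (ennreal 2 * X)" by (simp only: mult.assoc[symmetric] mult_1)
  also have "\<dots> = ennreal (D / 2)" unfolding assms by (subst ennreal_mult'[symmetric]) auto
  finally show ?thesis .
qed

text \<open>
  By the semigroup property the spatial integral at time \<open>r\<close> is \<open>G\<^sub>t\<^sub>+\<^sub>s\<^sub>-\<^sub>2\<^sub>r(x - y)\<close>; as \<open>r\<close> runs
  through \<open>[0, min t s)\<close> the time argument runs down from \<open>t + s\<close> to \<open>\<bar>t - s\<bar>\<close> at speed two.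
\<close>

lemma noise_kernel_inner:
  assumes "t > 0" "s > 0"
  shows "has_bochner_integral spacetime (\<lambda>p. noise_kernel t x p * noise_kernel s y p)
    ((string_variance (t + s) (x - y) - string_variance \<bar>t - s\<bar> (x - y)) / 2)"
proof -
  let ?f = "\<lambda>u. ennreal (heat_kernel u (x - y)) * indicator {\<bar>t - s\<bar><..t + s} u"
  have le: "string_variance \<bar>t - s\<bar> (x - y) \<le> string_variance (t + s) (x - y)"
    by (rule string_variance_time_bounds) (use assms in auto)
  have "(\<integral>\<^sup>+p. ennreal (noise_kernel t x p * noise_kernel s y p) \<partial>spacetime) =
    (\<integral>\<^sup>+r. (\<integral>\<^sup>+z. ennreal (noise_kernel t x (r, z) * noise_kernel s y (r, z)) \<partial>lborel) * indicator {0..} r \<partial>lborel)"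
    by (rule nn_integral_spacetime) measurable
  also have "\<dots> = (\<integral>\<^sup>+r. ?f (t + s + (- 2) * r) \<partial>lborel)"
  proof (rule nn_integral_cong)
    fix r :: real
    show "(\<integral>\<^sup>+z. ennreal (noise_kernel t x (r, z) * noise_kernel s y (r, z)) \<partial>lborel) * indicator {0..} r =
      ?f (t + s + (- 2) * r)"
    proof (cases "0 \<le> r \<and> r < t \<and> r < s")
      case True
      then have "(\<integral>\<^sup>+z. ennreal (noise_kernel t x (r, z) * noise_kernel s y (r, z)) \<partial>lborel) =
        ennreal (heat_kernel (t - r + (s - r)) (x - y))"
        by (simp add: noise_kernel_def nn_integral_heat_kernel_mult)
      moreover have e: "t + s + (- 2) * r = t - r + (s - r)" by simp
      moreover have "t - r + (s - r) \<in> {\<bar>t - s\<bar><..t + s}" using True by auto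
      ultimately show ?thesis using True by (simp only: e) simp
    next
      case False
      then have "t + s + (- 2) * r \<notin> {\<bar>t - s\<bar><..t + s}" by auto
      then show ?thesis using False by (auto simp: noise_kernel_def indicator_def)
    qed
  qed
  finally have X: "(\<integral>\<^sup>+p. ennreal (noise_kernel t x p * noise_kernel s y p) \<partial>spacetime) =
    (\<integral>\<^sup>+r. ?f (t + s + (- 2) * r) \<partial>lborel)" .
  have "(\<integral>\<^sup>+u. ?f u \<partial>lborel) = ennreal \<bar>- 2\<bar> * (\<integral>\<^sup>+r. ?f (t + s + (- 2) * r) \<partial>lborel)"
    by (rule nn_integral_real_affine) auto
  then have "ennreal 2 * (\<integral>\<^sup>+p. ennreal (noise_kernel t x p * noise_kernel s y p) \<partial>spacetime) =
    (\<integral>\<^sup>+u. ?f u \<partial>lborel)"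
    unfolding X by (simp only: abs_neg_numeral)
  also have "\<dots> = (\<integral>\<^sup>+u. ennreal (indicat_real {\<bar>t - s\<bar><..t + s} u *\<^sub>R heat_kernel u (x - y)) \<partial>lborel)"
    by (intro nn_integral_cong) (auto simp: indicator_def)
  also have "\<dots> = ennreal (string_variance (t + s) (x - y) - string_variance \<bar>t - s\<bar> (x - y))"
    using string_variance_time_diff[of "\<bar>t - s\<bar>" "t + s" "x - y"] assms
    unfolding set_integrable_def set_lebesgue_integral_def
    by (subst nn_integral_eq_integral) auto
  finally have *: "(\<integral>\<^sup>+p. ennreal (noise_kernel t x p * noise_kernel s y p) \<partial>spacetime) =
    ennreal ((string_variance (t + s) (x - y) - string_variance \<bar>t - s\<bar> (x - y)) / 2)"
    by (rule ennreal_half)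
  show ?thesis
  proof (rule has_bochner_integral_nn_integral[OF _ _ _ *])
    show "AE p in spacetime. 0 \<le> noise_kernel t x p * noise_kernel s y p"
      by (simp add: noise_kernel_def split_beta)
  qed (use le in simp_all)
qed

lemma half_time_gap_integral:
  assumes "t \<ge> 0"
  shows "has_bochner_integral lborel (\<lambda>r. indicat_real {0<..} r * (heat_kernel (2 * r) 0 - heat_kernel (t + 2 * r) x))
    (string_variance t x / 2)"
proof -
  let ?f = "\<lambda>u. ennreal (heat_kernel u 0 - heat_kernel (t + u) x) * indicator {0<..} u"
  have mono: "heat_kernel (t + u) y \<le> heat_kernel u 0" if "u > 0" for u y
    by (rule heat_kernel_le_earlier_centre[OF that assms])
  have "ennreal 2 * (\<integral>\<^sup>+r. ?f (0 + 2 * r) \<partial>lborel) = (\<integral>\<^sup>+u. ?f u \<partial>lborel)"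
    using nn_integral_real_affine[of ?f 2 0] by simp
  also have "\<dots> = ennreal (string_variance t x)" by (rule nn_integral_string_variance[OF assms])
  finally have "(\<integral>\<^sup>+r. ?f (0 + 2 * r) \<partial>lborel) = ennreal (string_variance t x / 2)"
    by (rule ennreal_half)
  moreover have "?f (0 + 2 * r) = ennreal (indicat_real {0<..} r * (heat_kernel (2 * r) 0 - heat_kernel (t + 2 * r) x))" for r
    by (auto simp: indicator_def)
  moreover have "string_variance t x \<ge> 0"
    by (rule order_trans[OF _ string_variance_lower]) (use assms in auto)
  ultimately show ?thesis
    by (intro has_bochner_integral_nn_integral AE_I2) (auto simp: indicator_def mono)
qed

lemma init_kernel_slice:
  assumes "t \<ge> 0" "s \<ge> 0" "r > 0"
  shows "has_bochner_integral lborel (\<lambda>z. init_kernel t x (r, z) * init_kernel s y (r, z))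
    (heat_kernel (t + s + 2 * r) (x - y) - heat_kernel (t + 2 * r) x - (heat_kernel (s + 2 * r) y - heat_kernel (2 * r) 0))"
proof -
  have "has_bochner_integral lborel (\<lambda>z. heat_kernel (t + r) (x - z) * heat_kernel (s + r) (y - z)
      - heat_kernel (t + r) (x - z) * heat_kernel r (0 - z)
      - (heat_kernel (s + r) (y - z) * heat_kernel r (0 - z) - heat_kernel r (0 - z) * heat_kernel r (0 - z)))
    (heat_kernel (t + r + (s + r)) (x - y) - heat_kernel (t + r + r) (x - 0)
      - (heat_kernel (s + r + r) (y - 0) - heat_kernel (r + r) (0 - 0)))"
    using assms by (intro has_bochner_integral_diff has_bochner_integral_heat_kernel_mult) auto
  moreover have "(a - c) * (b - c) = a * b - a * c - (b * c - c * c)" for a b c :: real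
    by (simp add: algebra_simps)
  ultimately show ?thesis
    by (simp only: init_kernel_def prod.case diff_0 diff_0_right diff_self heat_kernel_minus
        add.assoc add.left_commute mult_2)
qed

text \<open>
  Expanding the product gives four heat kernels whose time integrals diverge one by one. Regrouped
  as three differences \<open>G\<^sub>2\<^sub>r(0) - G\<^sub>\<tau>\<^sub>+\<^sub>2\<^sub>r(\<xi>)\<close>, each of them converges.
\<close>

lemma init_kernel_slice_integral:
  assumes "t \<ge> 0" "s \<ge> 0"
  shows "has_bochner_integral lborel (\<lambda>r. indicat_real {0<..} r *
      (LINT z|lborel. init_kernel t x (r, z) * init_kernel s y (r, z)))
    ((string_variance t x + string_variance s y - string_variance (t + s) (x - y)) / 2)"
proof -
  have "has_bochner_integral lborel (\<lambda>r.
      indicat_real {0<..} r * (heat_kernel (2 * r) 0 - heat_kernel (t + 2 * r) x) +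
      indicat_real {0<..} r * (heat_kernel (2 * r) 0 - heat_kernel (s + 2 * r) y) -
      indicat_real {0<..} r * (heat_kernel (2 * r) 0 - heat_kernel (t + s + 2 * r) (x - y)))
    (string_variance t x / 2 + string_variance s y / 2 - string_variance (t + s) (x - y) / 2)"
    using assms by (intro has_bochner_integral_diff has_bochner_integral_add half_time_gap_integral) auto
  moreover have "indicat_real {0<..} r * (heat_kernel (2 * r) 0 - heat_kernel (t + 2 * r) x) +
      indicat_real {0<..} r * (heat_kernel (2 * r) 0 - heat_kernel (s + 2 * r) y) -
      indicat_real {0<..} r * (heat_kernel (2 * r) 0 - heat_kernel (t + s + 2 * r) (x - y)) =
    indicat_real {0<..} r * (LINT z|lborel. init_kernel t x (r, z) * init_kernel s y (r, z))" for r
    using has_bochner_integral_integral_eq[OF init_kernel_slice[OF assms, of r x y]]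
    by (cases "r > 0") auto
  ultimately show ?thesis by (simp add: add_divide_distrib diff_divide_distrib)
qed

lemma L2_mult_integrable:
  assumes "f \<in> L2_spacetime" "g \<in> L2_spacetime"
  shows "integrable spacetime (\<lambda>p. f p * g p)"
  using assms by (intro integrable_mult_of_squares) (auto simp: L2_spacetime_def)

lemma noise_kernel_L2: "t > 0 \<Longrightarrow> noise_kernel t x \<in> L2_spacetime"
  using noise_kernel_inner[of t t x x]
  by (simp add: L2_spacetime_def has_bochner_integral_iff power2_eq_square)

lemma init_kernel_L2:
  assumes "t \<ge> 0"
  shows "init_kernel t x \<in> L2_spacetime"
proof -
  let ?i = "\<lambda>r. indicat_real {0<..} r * (LINT z|lborel. init_kernel t x (r, z) * init_kernel t x (r, z))"
  \<comment> \<open>The slice at \<open>r = 0\<close> is excluded by a null set, as the formula for slices needs \<open>r > 0\<close>.\<close>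
  have "(\<integral>\<^sup>+p. ennreal ((init_kernel t x p)\<^sup>2) \<partial>spacetime) =
    (\<integral>\<^sup>+r. (\<integral>\<^sup>+z. ennreal ((init_kernel t x (r, z))\<^sup>2) \<partial>lborel) * indicator {0..} r \<partial>lborel)"
    by (rule nn_integral_spacetime) measurable
  also have "\<dots> = (\<integral>\<^sup>+r. ennreal (?i r) \<partial>lborel)"
  proof (rule nn_integral_cong_AE)
    show "AE r in lborel. (\<integral>\<^sup>+z. ennreal ((init_kernel t x (r, z))\<^sup>2) \<partial>lborel) * indicator {0..} r = ennreal (?i r)"
      using AE_lborel_singleton[of 0]
    proof eventually_elim
      case (elim r)
      show ?case
      proof (cases "r > 0")
        case True
        have "(\<integral>\<^sup>+z. ennreal ((init_kernel t x (r, z))\<^sup>2) \<partial>lborel) =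
          ennreal (LINT z|lborel. init_kernel t x (r, z) * init_kernel t x (r, z))"
          using init_kernel_slice[OF assms assms True, of x x] unfolding power2_eq_square
          by (intro nn_integral_eq_integral) (auto simp: has_bochner_integral_iff)
        then show ?thesis using True by simp
      qed (use elim in simp)
    qed
  qed
  also have "\<dots> = ennreal (LINT r|lborel. ?i r)"
    using init_kernel_slice_integral[OF assms assms, of x x]
    by (intro nn_integral_eq_integral) (auto simp: has_bochner_integral_iff intro!: mult_nonneg_nonneg)
  finally have "(\<integral>\<^sup>+p. ennreal ((init_kernel t x p)\<^sup>2) \<partial>spacetime) < \<infinity>" by simp
  then have "integrable spacetime (\<lambda>p. (init_kernel t x p)\<^sup>2)"
    by (intro integrableI_bounded) auto
  then show ?thesis by (simp add: L2_spacetime_def)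
qed

lemma init_kernel_inner:
  assumes "t \<ge> 0" "s \<ge> 0"
  shows "(LINT p|spacetime. init_kernel t x p * init_kernel s y p) =
    (string_variance t x + string_variance s y - string_variance (t + s) (x - y)) / 2"
proof -
  let ?f = "\<lambda>p. indicat_real ({0..} \<times> UNIV) p *\<^sub>R (init_kernel t x p * init_kernel s y p)"
  have "integrable spacetime (\<lambda>p. init_kernel t x p * init_kernel s y p)"
    by (intro L2_mult_integrable init_kernel_L2 assms)
  then have int: "integrable (lborel \<Otimes>\<^sub>M lborel) ?f"
    unfolding spacetime_def by (subst (asm) integrable_restrict_space) (auto simp: lborel_prod)
  have "(LINT p|spacetime. init_kernel t x p * init_kernel s y p) = (LINT p|(lborel \<Otimes>\<^sub>M lborel). ?f p)"
    unfolding spacetime_def by (subst integral_restrict_space) (auto simp: lborel_prod)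
  also have "\<dots> = (LINT r|lborel. (LINT z|lborel. ?f (r, z)))"
    by (rule lborel_pair.integral_fst'[symmetric, OF int])
  also have "\<dots> = (LINT r|lborel. indicat_real {0<..} r *
      (LINT z|lborel. init_kernel t x (r, z) * init_kernel s y (r, z)))"
  proof (rule integral_cong_AE)
    show "(\<lambda>r. LINT z|lborel. ?f (r, z)) \<in> borel_measurable lborel"
      using int by (intro lborel.borel_measurable_lebesgue_integral) auto
    show "(\<lambda>r. indicat_real {0<..} r * (LINT z|lborel. init_kernel t x (r, z) * init_kernel s y (r, z))) \<in> borel_measurable lborel"
      using init_kernel_slice_integral[OF assms] by (simp add: has_bochner_integral_iff borel_measurable_integrable)
    show "AE r in lborel. (LINT z|lborel. ?f (r, z)) = indicat_real {0<..} r * (LINT z|lborel. init_kernel t x (r, z) * init_kernel s y (r, z))"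
      using AE_lborel_singleton[of 0] by eventually_elim (auto simp: indicator_def)
  qed
  also have "\<dots> = (string_variance t x + string_variance s y - string_variance (t + s) (x - y)) / 2"
    by (rule has_bochner_integral_integral_eq[OF init_kernel_slice_integral[OF assms]])
  finally show ?thesis .
qed

text \<open>
  The case \<open>f = g\<close> is separate because the family is indexed by functions, so that equal
  integrands give a single index.
\<close>

lemma (in prob_space) white_noise_combination:
  assumes W: "white_noise M W" and fg: "f \<in> L2_spacetime" "g \<in> L2_spacetime"
  shows "centered_gaussian M (\<lambda>\<omega>. u * W f \<omega> + v * W g \<omega>)"
proof -
  have fam: "centered_gaussian_family M L2_spacetime W" using W by (simp add: white_noise_def)
  show ?thesis
  proof (cases "f = g")
    case True
    have "centered_gaussian M (\<lambda>\<omega>. \<Sum>j\<in>{f}. (u + v) * W j \<omega>)"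
      using fam[unfolded centered_gaussian_family_def, rule_format, of "{f}" "\<lambda>_. u + v"] fg by simp
    then show ?thesis using True by (simp add: distrib_right)
  next
    case False
    have "centered_gaussian M (\<lambda>\<omega>. \<Sum>j\<in>{f, g}. (if j = f then u else v) * W j \<omega>)"
      using fam[unfolded centered_gaussian_family_def, rule_format, of "{f, g}" "\<lambda>j. if j = f then u else v"] fg by simp
    then show ?thesis using False by simp
  qed
qed

lemma (in prob_space) white_noise_moments:
  assumes W: "white_noise M W" and fg: "f \<in> L2_spacetime"
  shows "W f \<in> borel_measurable M" "integrable M (\<lambda>\<omega>. (W f \<omega>)\<^sup>2)"
  using centered_gaussian_moments[OF white_noise_combination[OF W fg fg, of 1 0]] by auto

lemma (in prob_space) white_noise_char:
  assumes W: "white_noise M W" and fg: "f \<in> L2_spacetime" "g \<in> L2_spacetime"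
  shows "(LINT \<omega>|M. iexp (u * W f \<omega> + v * W g \<omega>)) = complex_of_real (exp (-
     (u\<^sup>2 * (LINT p|spacetime. f p * f p) + 2 * u * v * (LINT p|spacetime. f p * g p) +
      v\<^sup>2 * (LINT p|spacetime. g p * g p)) / 2))"
proof -
  have cov: "expectation (\<lambda>\<omega>. W f \<omega> * W g \<omega>) = (LINT p|spacetime. f p * g p)"
    if "f \<in> L2_spacetime" "g \<in> L2_spacetime" for f g
    using W that by (simp add: white_noise_def)
  note m = white_noise_moments[OF W]
  have int: "integrable M (\<lambda>\<omega>. W f \<omega> * W g \<omega>)" if "f \<in> L2_spacetime" "g \<in> L2_spacetime" for f g
    by (intro integrable_mult_of_squares m that)
  have "expectation (\<lambda>\<omega>. (u * W f \<omega> + v * W g \<omega>)\<^sup>2) =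
    expectation (\<lambda>\<omega>. u\<^sup>2 * (W f \<omega> * W f \<omega>) + (2 * u * v) * (W f \<omega> * W g \<omega>) + v\<^sup>2 * (W g \<omega> * W g \<omega>))"
    by (intro Bochner_Integration.integral_cong refl) (simp add: power2_eq_square algebra_simps)
  also have "\<dots> = u\<^sup>2 * (LINT p|spacetime. f p * f p) + 2 * u * v * (LINT p|spacetime. f p * g p) +
      v\<^sup>2 * (LINT p|spacetime. g p * g p)"
    using int fg by (simp add: cov)
  finally show ?thesis
    using centered_gaussian_moments(3)[OF white_noise_combination[OF W fg, of u v]] by simp
qed

section \<open>The string as a stochastic integral\<close>

lemma vec_nth_measurable [measurable]: "(\<lambda>v :: real ^ 'd. v $ k) \<in> borel_measurable borel"
  by (intro borel_measurable_continuous_onI continuous_intros)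

text \<open>
  Rational step functions of \<open>z\<close>, through which a path-continuous field becomes a limit of jointly
  measurable ones.
\<close>

lemma floor_approx: "(\<lambda>n. real_of_int \<lfloor>real (Suc n) * z\<rfloor> / real (Suc n)) \<longlonglongrightarrow> z"
proof (rule tendsto_sandwich)
  have "(\<lambda>n. z - 1 / real (Suc n)) \<longlonglongrightarrow> z - 0"
    by (intro tendsto_diff tendsto_const LIMSEQ_Suc lim_1_over_n)
  then show "(\<lambda>n. z - 1 / real (Suc n)) \<longlonglongrightarrow> z" by simp
  show "\<forall>\<^sub>F n in sequentially. z - 1 / real (Suc n) \<le> real_of_int \<lfloor>real (Suc n) * z\<rfloor> / real (Suc n)"
  proof (intro always_eventually allI)
    fix n
    have "real (Suc n) * z - 1 \<le> real_of_int \<lfloor>real (Suc n) * z\<rfloor>" by linarith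
    then have "(real (Suc n) * z - 1) / real (Suc n) \<le> real_of_int \<lfloor>real (Suc n) * z\<rfloor> / real (Suc n)"
      by (rule divide_right_mono) simp
    then show "z - 1 / real (Suc n) \<le> real_of_int \<lfloor>real (Suc n) * z\<rfloor> / real (Suc n)"
      by (simp add: diff_divide_distrib del: of_nat_Suc)
  qed
  show "\<forall>\<^sub>F n in sequentially. real_of_int \<lfloor>real (Suc n) * z\<rfloor> / real (Suc n) \<le> z"
    by (intro always_eventually allI) (simp add: divide_le_eq mult.commute del: of_nat_Suc)
qed (rule tendsto_const)

text \<open>
  The law of \<open>x\<close> plus a centred Gaussian variable of variance \<open>2 t\<close>, against which \<open>U\<^sub>0\<close> is averaged.
\<close>

definition heat_measure :: "real \<Rightarrow> real \<Rightarrow> real measure" where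
  "heat_measure t x = density lborel (\<lambda>z. ennreal (heat_kernel t (x - z)))"

lemma prob_space_heat_measure:
  assumes "t > 0"
  shows "prob_space (heat_measure t x)"
proof (rule prob_spaceI)
  have "(\<integral>\<^sup>+z. ennreal (heat_kernel t (x - z)) \<partial>lborel) = ennreal 1"
    using has_bochner_integral_heat_kernel[OF assms, of x]
    by (subst nn_integral_eq_integral) (auto simp: has_bochner_integral_iff)
  then show "emeasure (heat_measure t x) (space (heat_measure t x)) = 1"
    by (simp add: heat_measure_def emeasure_density)
qed

lemma sets_heat_measure [measurable_cong, simp]: "sets (heat_measure t x) = sets borel"
  by (simp add: heat_measure_def)

lemma space_heat_measure [simp]: "space (heat_measure t x) = UNIV"
  by (simp add: heat_measure_def)

lemma integral_heat_measure:
  fixes f :: "real \<Rightarrow> real"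
  assumes "f \<in> borel_measurable borel"
  shows "(LINT z|heat_measure t x. f z) = (LINT z|lborel. heat_kernel t (x - z) * f z)"
    "integrable (heat_measure t x) f \<longleftrightarrow> integrable lborel (\<lambda>z. heat_kernel t (x - z) * f z)"
  using assms unfolding heat_measure_def by (simp_all add: integral_density integrable_density)

lemma heat_measure_string_variance:
  assumes "t > 0" "s \<ge> 0"
  shows "has_bochner_integral (heat_measure t x) (\<lambda>z. string_variance s (z - y)) (string_variance (t + s) (x - y))"
proof -
  have "has_bochner_integral lborel (\<lambda>z. heat_kernel t (x - z) * string_variance s (z - y)) (string_variance (t + s) (x - y))"
    using assms by (intro has_bochner_integral_nn_integral nn_integral_heat_kernel_string_variance AE_I2 mult_nonneg_nonneg string_variance_nonneg)
      auto
  then show ?thesis by (simp add: has_bochner_integral_iff integral_heat_measure)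
qed

locale pinned_string = prob_space M for M :: "'a measure" +
  fixes W W' :: "(real \<times> real \<Rightarrow> real) \<Rightarrow> 'a \<Rightarrow> real ^ 'd"
    and U :: "real \<Rightarrow> real \<Rightarrow> 'a \<Rightarrow> real ^ 'd"
  assumes noise: "vector_white_noise M W"
    and noise': "vector_white_noise M W'"
    and noises_indep: "independent_noises M W W'"
    and string: "stationary_pinned_string M W W' U"
begin

lemma component_noise: "white_noise M (\<lambda>f \<omega>. W f \<omega> $ k)"
  and component_noise': "white_noise M (\<lambda>f \<omega>. W' f \<omega> $ k)"
  using noise noise' by (simp_all add: vector_white_noise_def)

lemma U_measurable: "t \<ge> 0 \<Longrightarrow> U t x \<in> borel_measurable M"
  using string by (simp add: stationary_pinned_string_def)

lemma U_component_measurable [measurable]: "t \<ge> 0 \<Longrightarrow> (\<lambda>\<omega>. U t x \<omega> $ k) \<in> borel_measurable M"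
  by (rule measurable_compose[OF U_measurable]) (auto intro!: borel_measurable_continuous_onI continuous_intros)

lemma U_0: "AE \<omega> in M. U 0 z \<omega> $ k = W' (init_kernel 0 z) \<omega> $ k"
proof -
  have "AE \<omega> in M. U 0 z \<omega> = W' (\<lambda>(r, y). heat_kernel r (z - y) - heat_kernel r y) \<omega>"
    using string by (simp add: stationary_pinned_string_def)
  then have "AE \<omega> in M. U 0 z \<omega> = W' (init_kernel 0 z) \<omega>" by (simp add: init_kernel_def)
  then show ?thesis by eventually_elim simp
qed

lemma U_0_continuous: "AE \<omega> in M. continuous_on UNIV (\<lambda>z. U 0 z \<omega>)"
proof -
  have "AE \<omega> in M. continuous_on ({0..} \<times> UNIV) (\<lambda>(t, x). U t x \<omega>)"
    using string by (simp add: stationary_pinned_string_def)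
  then show ?thesis
  proof eventually_elim
    case (elim \<omega>)
    have "continuous_on UNIV (\<lambda>z. (\<lambda>(t, x). U t x \<omega>) (0::real, z::real))"
      by (rule continuous_on_compose2[OF elim]) (auto intro!: continuous_intros)
    then show ?case by simp
  qed
qed

lemma U_0_product:
  assumes f: "f \<in> L2_spacetime"
  shows "integrable M (\<lambda>\<omega>. (U 0 z \<omega> $ k)\<^sup>2)"
    "expectation (\<lambda>\<omega>. U 0 z \<omega> $ k * W' f \<omega> $ k) = (LINT p|spacetime. init_kernel 0 z p * f p)"
    "expectation (\<lambda>\<omega>. U 0 z \<omega> $ k * U 0 y \<omega> $ k) = (LINT p|spacetime. init_kernel 0 z p * init_kernel 0 y p)"
proof -
  note m = white_noise_moments[OF component_noise']
  have i: "init_kernel 0 z \<in> L2_spacetime" for z by (rule init_kernel_L2) simp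
  have [measurable]: "(\<lambda>\<omega>. W' f \<omega> $ k) \<in> borel_measurable M" "\<And>z. (\<lambda>\<omega>. W' (init_kernel 0 z) \<omega> $ k) \<in> borel_measurable M"
    "\<And>z. (\<lambda>\<omega>. U 0 z \<omega> $ k) \<in> borel_measurable M"
    using m(1)[OF f] m(1)[OF i] by auto
  have "integrable M (\<lambda>\<omega>. (U 0 z \<omega> $ k)\<^sup>2) \<longleftrightarrow> integrable M (\<lambda>\<omega>. (W' (init_kernel 0 z) \<omega> $ k)\<^sup>2)"
    by (rule integrable_cong_AE) (use U_0[of z k] in auto)
  then show "integrable M (\<lambda>\<omega>. (U 0 z \<omega> $ k)\<^sup>2)" using m(2)[OF i] by simp
  have "expectation (\<lambda>\<omega>. U 0 z \<omega> $ k * W' f \<omega> $ k) = expectation (\<lambda>\<omega>. W' (init_kernel 0 z) \<omega> $ k * W' f \<omega> $ k)"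
    by (rule integral_cong_AE) (use U_0[of z k] in auto)
  also have "\<dots> = (LINT p|spacetime. init_kernel 0 z p * f p)"
    using component_noise' f i by (simp add: white_noise_def)
  finally show "expectation (\<lambda>\<omega>. U 0 z \<omega> $ k * W' f \<omega> $ k) = (LINT p|spacetime. init_kernel 0 z p * f p)" .
  have "expectation (\<lambda>\<omega>. U 0 z \<omega> $ k * U 0 y \<omega> $ k) =
    expectation (\<lambda>\<omega>. W' (init_kernel 0 z) \<omega> $ k * W' (init_kernel 0 y) \<omega> $ k)"
    by (rule integral_cong_AE) (use U_0[of z k] U_0[of y k] in auto)
  also have "\<dots> = (LINT p|spacetime. init_kernel 0 z p * init_kernel 0 y p)"
    using component_noise' i by (simp add: white_noise_def)
  finally show "expectation (\<lambda>\<omega>. U 0 z \<omega> $ k * U 0 y \<omega> $ k) = (LINT p|spacetime. init_kernel 0 z p * init_kernel 0 y p)" .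
qed

text \<open>
  Let \<open>X\<close> be the average of \<open>U\<^sub>0\<close> under the heat measure and \<open>Y\<close> the stochastic integral of the smoothed
  kernel. The exchange of averaging with the stochastic integral is the identity \<open>X = Y\<close>; it follows
  from \<open>E X\<^sup>2 = E X Y = E Y\<^sup>2\<close>. Each of these moments is computed by averaging covariances, and smoothing
  a covariance only advances the time argument of \<open>string_variance\<close>.
\<close>

lemma smoothed_initial_component:
  assumes t: "t > 0"
  shows "AE \<omega> in M. integrable lborel (\<lambda>z. heat_kernel t (x - z) * U 0 z \<omega> $ k) \<and>
    (LINT z|lborel. heat_kernel t (x - z) * U 0 z \<omega> $ k) = W' (init_kernel t x) \<omega> $ k"
proof -
  let ?N = "heat_measure t x"
  interpret N: prob_space ?N by (rule prob_space_heat_measure[OF t])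
  interpret P: pair_prob_space ?N M ..
  let ?h = "init_kernel t x"
  have h: "?h \<in> L2_spacetime" using t by (intro init_kernel_L2) simp
  define Y where "Y \<omega> = W' ?h \<omega> $ k" for \<omega>
  have Y[measurable]: "Y \<in> borel_measurable M" and Y2: "integrable M (\<lambda>\<omega>. (Y \<omega>)\<^sup>2)"
    using white_noise_moments[OF component_noise' h] by (auto simp: Y_def[abs_def])
  \<comment> \<open>A jointly measurable modification of the component: the limit along rational step functions
    agrees with the field on every continuous path.\<close>
  define S where "S z \<omega> = lim (\<lambda>n. U 0 (real_of_int \<lfloor>real (Suc n) * z\<rfloor> / real (Suc n)) \<omega> $ k)" for z \<omega>
  have step: "(\<lambda>p. U 0 (real_of_int \<lfloor>real (Suc n) * fst p\<rfloor> / real (Suc n)) (snd p) $ k) \<in> borel_measurable (?N \<Otimes>\<^sub>M M)" for n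
    by (rule measurable_compose_countable[where f="\<lambda>i p. U 0 (real_of_int i / real (Suc n)) (snd p) $ k"]) measurable
  have Smeas[measurable]: "case_prod S \<in> borel_measurable (?N \<Otimes>\<^sub>M M)"
    unfolding S_def[abs_def] split_beta' by (rule borel_measurable_lim_metric) (rule step)
  have S1: "S z \<in> borel_measurable M" for z
  proof -
    have "(\<lambda>\<omega>. case_prod S (z, \<omega>)) \<in> borel_measurable M"
      by (rule measurable_compose[OF measurable_Pair1' Smeas]) simp
    then show ?thesis by simp
  qed
  have good: "AE \<omega> in M. \<forall>z. S z \<omega> = U 0 z \<omega> $ k"
    using U_0_continuous
  proof eventually_elim
    case (elim \<omega>)
    have "(\<lambda>n. U 0 (real_of_int \<lfloor>real (Suc n) * z\<rfloor> / real (Suc n)) \<omega> $ k) \<longlonglongrightarrow> U 0 z \<omega> $ k" for z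
      by (intro tendsto_vec_nth continuous_on_tendsto_compose[OF elim floor_approx]) auto
    then show ?case unfolding S_def by (auto intro: limI)
  qed
  have SU: "AE \<omega> in M. S z \<omega> = U 0 z \<omega> $ k" for z using good by eventually_elim simp
  note P0 = U_0_product[OF h]
  have U1[measurable]: "(\<lambda>\<omega>. U 0 z \<omega> $ k) \<in> borel_measurable M" for z by measurable
  have SS: "expectation (\<lambda>\<omega>. S z \<omega> * S y \<omega>) = (string_variance 0 z + string_variance 0 y - string_variance 0 (z - y)) / 2" for z y
  proof -
    have "expectation (\<lambda>\<omega>. S z \<omega> * S y \<omega>) = expectation (\<lambda>\<omega>. U 0 z \<omega> $ k * U 0 y \<omega> $ k)"
      by (rule integral_cong_AE) (use SU[of z] SU[of y] S1 in auto)
    then show ?thesis by (simp add: P0(3) init_kernel_inner)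
  qed
  have SY: "expectation (\<lambda>\<omega>. S z \<omega> * Y \<omega>) = (string_variance 0 z + string_variance t x - string_variance t (z - x)) / 2" for z
  proof -
    have "expectation (\<lambda>\<omega>. S z \<omega> * Y \<omega>) = expectation (\<lambda>\<omega>. U 0 z \<omega> $ k * W' ?h \<omega> $ k)"
      unfolding Y_def by (rule integral_cong_AE) (use SU[of z] S1 Y[unfolded Y_def] in auto)
    then show ?thesis using t by (simp add: P0(2) init_kernel_inner)
  qed
  have S2: "integrable M (\<lambda>\<omega>. (S z \<omega>)\<^sup>2)" for z
  proof -
    have "integrable M (\<lambda>\<omega>. (S z \<omega>)\<^sup>2) \<longleftrightarrow> integrable M (\<lambda>\<omega>. (U 0 z \<omega> $ k)\<^sup>2)"
      by (rule integrable_cong_AE) (use SU[of z] S1 in auto)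
    then show ?thesis using P0(1) by simp
  qed
  have v0: "has_bochner_integral ?N (string_variance 0) (string_variance t x)"
    using heat_measure_string_variance[OF t, of 0 x 0] by simp
  have sq: "integrable (?N \<Otimes>\<^sub>M M) (\<lambda>(z, \<omega>). (S z \<omega>)\<^sup>2)"
  proof (rule P.Fubini_integrable)
    show "(\<lambda>(z, \<omega>). (S z \<omega>)\<^sup>2) \<in> borel_measurable (?N \<Otimes>\<^sub>M M)"
      using Smeas unfolding split_beta' by (rule borel_measurable_power)
    have "(LINT \<omega>|M. norm (case (z, \<omega>) of (z, \<omega>) \<Rightarrow> (S z \<omega>)\<^sup>2)) = string_variance 0 z" for z
      using SS[of z z] by (simp add: power2_eq_square)
    then show "integrable ?N (\<lambda>z. LINT \<omega>|M. norm (case (z, \<omega>) of (z, \<omega>) \<Rightarrow> (S z \<omega>)\<^sup>2))"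
      using v0 by (simp only: has_bochner_integral_iff)
    show "AE z in ?N. integrable M (\<lambda>\<omega>. case (z, \<omega>) of (z, \<omega>) \<Rightarrow> (S z \<omega>)\<^sup>2)"
      using S2 by simp
  qed
  note ms = P.mean_square_integral[OF Smeas sq]
  define X where "X \<omega> = (LINT z|?N. S z \<omega>)" for \<omega>
  have X[measurable]: "X \<in> borel_measurable M" and X2: "integrable M (\<lambda>\<omega>. (X \<omega>)\<^sup>2)"
    using ms(2,3) by (auto simp: X_def[abs_def])
  define D where "D = (string_variance t x + string_variance t x - string_variance (t + t) 0) / 2"
  have YY: "expectation (\<lambda>\<omega>. Y \<omega> * Y \<omega>) = D"
    using component_noise' h t by (simp add: Y_def white_noise_def init_kernel_inner D_def)
  have vt: "has_bochner_integral ?N (\<lambda>z. (string_variance 0 z + string_variance t x - string_variance t (z - x)) / 2) D"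
  proof -
    have "has_bochner_integral ?N (\<lambda>z. string_variance t x) (string_variance t x)"
      using N.prob_space by (simp add: has_bochner_integral_iff)
    from has_bochner_integral_divide_zero[OF has_bochner_integral_diff[OF has_bochner_integral_add[OF v0 this] heat_measure_string_variance[OF t, of t x x]], of 2]
    show ?thesis using t by (simp add: D_def)
  qed
  \<comment> \<open>Averaging the covariances of \<open>U 0 z\<close> with \<open>Y\<close>, and below those with \<open>X\<close>, over \<open>z\<close>.\<close>
  have XY: "expectation (\<lambda>\<omega>. X \<omega> * Y \<omega>) = D"
    using ms(4)[OF Y Y2] vt unfolding X_def SY by (simp add: has_bochner_integral_iff)
  have SX: "expectation (\<lambda>\<omega>. S z \<omega> * X \<omega>) = (string_variance 0 z + string_variance t x - string_variance t (z - x)) / 2" for z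
  proof -
    have "has_bochner_integral ?N (\<lambda>y. string_variance 0 z) (string_variance 0 z)"
      using N.prob_space by (simp add: has_bochner_integral_iff)
    from has_bochner_integral_divide_zero[OF has_bochner_integral_diff[OF has_bochner_integral_add[OF v0 this] heat_measure_string_variance[OF t, of 0 x z]], of 2]
    have "(LINT y|?N. (string_variance 0 y + string_variance 0 z - string_variance 0 (y - z)) / 2) =
      (string_variance t x + string_variance 0 z - string_variance t (x - z)) / 2"
      by (simp add: has_bochner_integral_iff)
    then have "expectation (\<lambda>\<omega>. X \<omega> * S z \<omega>) = (string_variance t x + string_variance 0 z - string_variance t (x - z)) / 2"
      using ms(4)[OF S1 S2, of z] unfolding X_def SS by simp
    then show ?thesis by (simp add: mult.commute string_variance_commute[of t x z])
  qed
  have XX: "expectation (\<lambda>\<omega>. X \<omega> * X \<omega>) = D"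
    using ms(4)[OF X X2] vt unfolding X_def[symmetric] SX by (simp add: has_bochner_integral_iff)
  note i = integrable_mult_of_squares[OF X X X2 X2] integrable_mult_of_squares[OF X Y X2 Y2]
    integrable_mult_of_squares[OF Y Y Y2 Y2]
  have "expectation (\<lambda>\<omega>. (X \<omega> - Y \<omega>)\<^sup>2) = expectation (\<lambda>\<omega>. X \<omega> * X \<omega> - 2 * (X \<omega> * Y \<omega>) + Y \<omega> * Y \<omega>)"
    by (intro Bochner_Integration.integral_cong refl) (simp add: power2_eq_square algebra_simps)
  also have "\<dots> = 0" using i by (simp add: XX XY YY)
  finally have "expectation (\<lambda>\<omega>. (X \<omega> - Y \<omega>)\<^sup>2) = 0" .
  moreover have "integrable M (\<lambda>\<omega>. (X \<omega> - Y \<omega>)\<^sup>2)"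
  proof -
    have "integrable M (\<lambda>\<omega>. X \<omega> * X \<omega> - 2 * (X \<omega> * Y \<omega>) + Y \<omega> * Y \<omega>)" using i by simp
    then show ?thesis by (simp add: power2_eq_square algebra_simps)
  qed
  ultimately have "AE \<omega> in M. (X \<omega> - Y \<omega>)\<^sup>2 = 0"
    by (subst (asm) integral_nonneg_eq_0_iff_AE) auto
  then show ?thesis using good ms(1) AE_space
  proof eventually_elim
    case (elim \<omega>)
    have [measurable]: "(\<lambda>z. S z \<omega>) \<in> borel_measurable borel"
    proof -
      have "(\<lambda>z. case_prod S (z, \<omega>)) \<in> borel_measurable ?N" using elim(4) by measurable
      then show ?thesis by simp
    qed
    have SUw: "S z \<omega> = U 0 z \<omega> $ k" for z using elim(2) by auto
    show ?case using elim(1,3) unfolding X_def Y_def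
      by (simp add: integral_heat_measure) (simp add: SUw)
  qed
qed

text \<open>
  The vector-valued Bochner integral is evaluated by components once its integrability is known,
  which follows from that of the components.
\<close>

lemma smoothed_initial_state:
  assumes t: "t > 0"
  shows "AE \<omega> in M. \<forall>k. (LINT z|lborel. heat_kernel t (x - z) *\<^sub>R U 0 z \<omega>) $ k = W' (init_kernel t x) \<omega> $ k"
proof -
  have "AE \<omega> in M. \<forall>k. integrable lborel (\<lambda>z. heat_kernel t (x - z) * U 0 z \<omega> $ k) \<and>
    (LINT z|lborel. heat_kernel t (x - z) * U 0 z \<omega> $ k) = W' (init_kernel t x) \<omega> $ k"
    using smoothed_initial_component[OF t] by (simp add: AE_all_countable)
  then show ?thesis
  proof eventually_elim
    case (elim \<omega>)
    let ?v = "\<lambda>z. heat_kernel t (x - z) *\<^sub>R U 0 z \<omega>"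
    have "integrable lborel (\<lambda>z. \<Sum>k\<in>UNIV. (heat_kernel t (x - z) * U 0 z \<omega> $ k) *\<^sub>R axis k (1::real))"
      using elim by (intro Bochner_Integration.integrable_sum integrable_scaleR_left) auto
    also have "(\<lambda>z. \<Sum>k\<in>UNIV. (heat_kernel t (x - z) * U 0 z \<omega> $ k) *\<^sub>R axis k (1::real)) = ?v"
    proof
      fix z
      show "(\<Sum>k\<in>UNIV. (heat_kernel t (x - z) * U 0 z \<omega> $ k) *\<^sub>R axis k (1::real)) = ?v z"
        using basis_expansion[of "?v z"] by (simp add: scalar_mult_eq_scaleR)
    qed
    finally have int: "integrable lborel ?v" .
    show ?case
    proof
      fix k
      have "(LINT z|lborel. ?v z) $ k = (LINT z|lborel. ?v z $ k)"
        using integral_bounded_linear[OF bounded_linear_vec_nth int] by simp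
      then show "(LINT z|lborel. ?v z) $ k = W' (init_kernel t x) \<omega> $ k" using elim by simp
    qed
  qed
qed

lemma string_representation:
  assumes t: "t > 0"
  shows "AE \<omega> in M. \<forall>k. U t x \<omega> $ k = W' (init_kernel t x) \<omega> $ k + W (noise_kernel t x) \<omega> $ k"
proof -
  have "AE \<omega> in M. U t x \<omega> =
        (LINT z|lborel. heat_kernel t (x - z) *\<^sub>R U 0 z \<omega>) +
        W (noise_kernel t x) \<omega>"
    using string t by (simp add: stationary_pinned_string_def noise_kernel_def)
  then show ?thesis using smoothed_initial_state[OF t, of x] by eventually_elim simp
qed

text \<open>
  The contributions of \<open>W\<close> and \<open>W'\<close> are independent, so their variances add; the terms at time
  \<open>t + s\<close> cancel and leave the stationary expression in \<open>\<bar>t - s\<bar>\<close> and \<open>x - y\<close>.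
\<close>

lemma component_char:
  assumes t: "t > 0" "s > 0"
  shows "(LINT \<omega>|M. iexp (u * (W' (init_kernel t x) \<omega> $ k + W (noise_kernel t x) \<omega> $ k) +
      v * (W' (init_kernel s y) \<omega> $ k + W (noise_kernel s y) \<omega> $ k))) =
    complex_of_real (exp (- (u\<^sup>2 * string_variance t x + 2 * u * v * string_covariance t x s y +
      v\<^sup>2 * string_variance s y) / 2))"
proof -
  let ?a = "init_kernel t x" and ?b = "init_kernel s y" and ?g = "noise_kernel t x" and ?h = "noise_kernel s y"
  have L2: "?a \<in> L2_spacetime" "?b \<in> L2_spacetime" "?g \<in> L2_spacetime" "?h \<in> L2_spacetime"
    using t by (auto intro: init_kernel_L2 noise_kernel_L2)
  define A where "A \<omega> = iexp (u * W ?g \<omega> $ k + v * W ?h \<omega> $ k)" for \<omega>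
  define B where "B \<omega> = iexp (u * W' ?a \<omega> $ k + v * W' ?b \<omega> $ k)" for \<omega>
  have "indep_var borel ((\<lambda>\<phi>. iexp (u * \<phi> ?g $ k + v * \<phi> ?h $ k)) \<circ> (\<lambda>\<omega>. \<lambda>f\<in>L2_spacetime. W f \<omega>))
    borel ((\<lambda>\<phi>. iexp (u * \<phi> ?a $ k + v * \<phi> ?b $ k)) \<circ> (\<lambda>\<omega>. \<lambda>f\<in>L2_spacetime. W' f \<omega>))"
    by (rule indep_var_compose[OF noises_indep[unfolded independent_noises_def]]) (use L2 in measurable)
  then have ind: "indep_var borel A borel B"
    using L2 by (simp add: comp_def A_def[abs_def] B_def[abs_def])
  then have [measurable]: "A \<in> borel_measurable M" "B \<in> borel_measurable M"
    by (auto dest: indep_var_rv1 indep_var_rv2)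
  have int: "integrable M A" "integrable M B"
    by (rule integrable_const_bound[where B=1]; simp add: A_def B_def)+
  have "(LINT \<omega>|M. iexp (u * (W' ?a \<omega> $ k + W ?g \<omega> $ k) + v * (W' ?b \<omega> $ k + W ?h \<omega> $ k))) =
    (LINT \<omega>|M. A \<omega> * B \<omega>)"
    by (intro Bochner_Integration.integral_cong refl) (simp add: A_def B_def exp_add[symmetric] algebra_simps)
  also have "\<dots> = (LINT \<omega>|M. A \<omega>) * (LINT \<omega>|M. B \<omega>)"
    by (rule indep_var_lebesgue_integral[OF ind int])
  also have "(LINT \<omega>|M. A \<omega>) = complex_of_real (exp (-
     (u\<^sup>2 * (LINT p|spacetime. ?g p * ?g p) + 2 * u * v * (LINT p|spacetime. ?g p * ?h p) +
      v\<^sup>2 * (LINT p|spacetime. ?h p * ?h p)) / 2))"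
    unfolding A_def by (rule white_noise_char[OF component_noise L2(3,4)])
  also have "(LINT \<omega>|M. B \<omega>) = complex_of_real (exp (-
     (u\<^sup>2 * (LINT p|spacetime. ?a p * ?a p) + 2 * u * v * (LINT p|spacetime. ?a p * ?b p) +
      v\<^sup>2 * (LINT p|spacetime. ?b p * ?b p)) / 2))"
    unfolding B_def by (rule white_noise_char[OF component_noise' L2(1,2)])
  also have "(LINT p|spacetime. ?g p * ?g p) = (string_variance (t + t) 0 - 0) / 2"
    using has_bochner_integral_integral_eq[OF noise_kernel_inner[OF t(1) t(1), of x x]] by simp
  also have "(LINT p|spacetime. ?h p * ?h p) = (string_variance (s + s) 0 - 0) / 2"
    using has_bochner_integral_integral_eq[OF noise_kernel_inner[OF t(2) t(2), of y y]] by simp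
  also have "(LINT p|spacetime. ?g p * ?h p) = (string_variance (t + s) (x - y) - string_variance \<bar>t - s\<bar> (x - y)) / 2"
    by (rule has_bochner_integral_integral_eq[OF noise_kernel_inner[OF t]])
  also have "(LINT p|spacetime. ?a p * ?b p) = (string_variance t x + string_variance s y - string_variance (t + s) (x - y)) / 2"
    using t by (intro init_kernel_inner) auto
  also have "(LINT p|spacetime. ?a p * ?a p) = (string_variance t x + string_variance t x - string_variance (t + t) 0) / 2"
    using t init_kernel_inner[of t t x x] by auto
  also have "(LINT p|spacetime. ?b p * ?b p) = (string_variance s y + string_variance s y - string_variance (s + s) 0) / 2"
    using t init_kernel_inner[of s s y y] by auto
  finally show ?thesis
    unfolding of_real_mult[symmetric] exp_add[symmetric] string_covariance_def
    by (simp add: field_simps)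
qed

text \<open>
  A characteristic function is bounded by one, so the quadratic form in its exponent is nonnegative.
\<close>

lemma string_covariance_sq_le:
  assumes t: "t > 0" "s > 0"
  shows "(string_covariance t x s y)\<^sup>2 \<le> string_variance t x * string_variance s y"
proof -
  let ?p = "string_variance t x" and ?q = "string_variance s y" and ?c = "string_covariance t x s y"
  have psd: "0 \<le> u\<^sup>2 * ?p + 2 * u * v * ?c + v\<^sup>2 * ?q" for u v
  proof -
    obtain k :: 'd where True by simp
    let ?Z = "\<lambda>\<omega>. u * (W' (init_kernel t x) \<omega> $ k + W (noise_kernel t x) \<omega> $ k) +
      v * (W' (init_kernel s y) \<omega> $ k + W (noise_kernel s y) \<omega> $ k)"
    have "norm (LINT \<omega>|M. iexp (?Z \<omega>)) \<le> (LINT \<omega>|M. norm (iexp (?Z \<omega>)))"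
      by (rule integral_norm_bound)
    also have "\<dots> = 1" by (simp add: prob_space)
    finally have "exp (- (u\<^sup>2 * ?p + 2 * u * v * ?c + v\<^sup>2 * ?q) / 2) \<le> 1"
      unfolding component_char[OF t] norm_of_real by simp
    then show ?thesis by simp
  qed
  have "0 \<le> ?q * (?p * ?q - ?c\<^sup>2)"
    using psd[of ?q "- ?c"] by (simp add: power2_eq_square algebra_simps)
  then show ?thesis using string_variance_pos[OF t(2), of y] by (simp add: zero_le_mult_iff)
qed

text \<open>
  The components of the pair \<open>(U\<^sub>t(x), U\<^sub>s(y))\<close> are independent, because each is a function of the
  corresponding components of the two noises, and they have the same characteristic function. The
  expectation of the product of the componentwise exponentials therefore is a power. The case
  \<open>m = 0\<close> gives the one-point expectation.
\<close>

lemma two_point_expectation: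
  assumes t: "t > 0" "s > 0" and lm: "0 \<le> l" "0 \<le> m"
  shows "expectation (\<lambda>\<omega>. exp (- (l * (norm (U t x \<omega>))\<^sup>2 + m * (norm (U s y \<omega>))\<^sup>2) / 2)) =
    (1 / sqrt ((1 + l * string_variance t x) * (1 + m * string_variance s y) -
      l * m * (string_covariance t x s y)\<^sup>2)) ^ CARD('d)"
proof -
  let ?a = "init_kernel t x" and ?b = "init_kernel s y" and ?g = "noise_kernel t x" and ?h = "noise_kernel s y"
  have L2: "?a \<in> L2_spacetime" "?b \<in> L2_spacetime" "?g \<in> L2_spacetime" "?h \<in> L2_spacetime"
    using t by (auto intro: init_kernel_L2 noise_kernel_L2)
  define A where "A k \<omega> = (W ?g \<omega> $ k, W ?h \<omega> $ k)" for k \<omega>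
  define B where "B k \<omega> = (W' ?a \<omega> $ k, W' ?b \<omega> $ k)" for k \<omega>
  define P where "P k \<omega> = W' ?a \<omega> $ k + W ?g \<omega> $ k" for k \<omega>
  define Q where "Q k \<omega> = W' ?b \<omega> $ k + W ?h \<omega> $ k" for k \<omega>
  define F where "F k \<omega> = exp (- (l * (P k \<omega>)\<^sup>2 + m * (Q k \<omega>)\<^sup>2) / 2)" for k \<omega>
  let ?M = "\<lambda>_ :: 'd. borel \<Otimes>\<^sub>M borel :: (real \<times> real) measure"
  have A: "indep_vars ?M A UNIV"
  proof -
    have "indep_vars ?M (\<lambda>i \<omega>. (\<lambda>\<phi>. (\<phi> ?g, \<phi> ?h)) (\<lambda>f\<in>L2_spacetime. W f \<omega> $ i)) UNIV"
      by (rule indep_vars_compose2[OF noise[unfolded vector_white_noise_def, THEN conjunct2]]) (use L2 in measurable)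
    then show ?thesis using L2 by (simp add: A_def[abs_def])
  qed
  have B: "indep_vars ?M B UNIV"
  proof -
    have "indep_vars ?M (\<lambda>i \<omega>. (\<lambda>\<phi>. (\<phi> ?a, \<phi> ?b)) (\<lambda>f\<in>L2_spacetime. W' f \<omega> $ i)) UNIV"
      by (rule indep_vars_compose2[OF noise'[unfolded vector_white_noise_def, THEN conjunct2]]) (use L2 in measurable)
    then show ?thesis using L2 by (simp add: B_def[abs_def])
  qed
  have AB: "indep_var (PiM UNIV ?M) (\<lambda>\<omega>. \<lambda>i\<in>UNIV. A i \<omega>) (PiM UNIV ?M) (\<lambda>\<omega>. \<lambda>i\<in>UNIV. B i \<omega>)"
  proof -
    have "indep_var (PiM UNIV ?M) ((\<lambda>\<phi>. \<lambda>i\<in>UNIV. (\<phi> ?g $ i, \<phi> ?h $ i)) \<circ> (\<lambda>\<omega>. \<lambda>f\<in>L2_spacetime. W f \<omega>))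
      (PiM UNIV ?M) ((\<lambda>\<phi>. \<lambda>i\<in>UNIV. (\<phi> ?a $ i, \<phi> ?b $ i)) \<circ> (\<lambda>\<omega>. \<lambda>f\<in>L2_spacetime. W' f \<omega>))"
      by (rule indep_var_compose[OF noises_indep[unfolded independent_noises_def]])
        (rule measurable_restrict; use L2 in measurable)+
    then show ?thesis using L2 by (simp add: comp_def A_def[abs_def] B_def[abs_def])
  qed
  have AB': "indep_vars (\<lambda>i. ?M i \<Otimes>\<^sub>M ?M i) (\<lambda>i \<omega>. (A i \<omega>, B i \<omega>)) UNIV"
    by (rule indep_vars_pair[OF _ _ A B AB]) auto
  have indF: "indep_vars (\<lambda>_. borel) F UNIV"
  proof -
    have "indep_vars (\<lambda>_. borel) (\<lambda>i \<omega>. (\<lambda>p. exp (- (l * (fst (snd p) + fst (fst p))\<^sup>2 + m * (snd (snd p) + snd (fst p))\<^sup>2) / 2)) (A i \<omega>, B i \<omega>)) UNIV"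
      by (rule indep_vars_compose2[OF AB']) measurable
    then show ?thesis by (simp add: A_def B_def F_def[abs_def] P_def Q_def)
  qed
  have F[measurable]: "F k \<in> borel_measurable M" for k
    using indF by (simp add: indep_vars_def)
  have Fint: "integrable M (F k)" for k
  proof (rule integrable_const_bound[where B=1])
    have "- (l * (P k \<omega>)\<^sup>2) \<le> m * (Q k \<omega>)\<^sup>2" for \<omega>
      using lm by (smt (verit) mult_nonneg_nonneg zero_le_power2)
    then show "AE \<omega> in M. norm (F k \<omega>) \<le> 1" unfolding F_def by (intro AE_I2) simp
  qed (rule F)
  note wm = white_noise_moments(1)[OF component_noise] white_noise_moments(1)[OF component_noise']
  have meas: "P k \<in> borel_measurable M" "Q k \<in> borel_measurable M" for k
    using wm(1)[OF L2(3), of k] wm(1)[OF L2(4), of k] wm(2)[OF L2(1), of k] wm(2)[OF L2(2), of k]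
    by (auto simp: P_def[abs_def] Q_def[abs_def])
  have EF: "expectation (F k) = 1 / sqrt ((1 + l * string_variance t x) * (1 + m * string_variance s y) -
      l * m * (string_covariance t x s y)\<^sup>2)" for k
    unfolding F_def
  proof (rule expectation_exp_sq[OF meas])
    show "(LINT \<omega>|M. iexp (u * P k \<omega> + v * Q k \<omega>)) = complex_of_real (exp (- (u\<^sup>2 * string_variance t x +
      2 * u * v * string_covariance t x s y + v\<^sup>2 * string_variance s y) / 2))" for u v
      unfolding P_def Q_def by (rule component_char[OF t])
  qed (use t lm in \<open>auto simp: string_covariance_sq_le string_variance_nonneg\<close>)
  have "AE \<omega> in M. exp (- (l * (norm (U t x \<omega>))\<^sup>2 + m * (norm (U s y \<omega>))\<^sup>2) / 2) = (\<Prod>k\<in>UNIV. F k \<omega>)"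
    using string_representation[OF t(1), of x] string_representation[OF t(2), of y]
  proof eventually_elim
    case (elim \<omega>)
    have nsq: "(norm v)\<^sup>2 = (\<Sum>k\<in>UNIV. (v $ k)\<^sup>2)" for v :: "real ^ 'd"
      unfolding power2_norm_eq_inner inner_vec_def by (simp add: power2_eq_square)
    have "- (l * (norm (U t x \<omega>))\<^sup>2 + m * (norm (U s y \<omega>))\<^sup>2) / 2 =
      (\<Sum>k\<in>UNIV. - (l * (P k \<omega>)\<^sup>2 + m * (Q k \<omega>)\<^sup>2) / 2)"
      unfolding nsq using elim
      by (simp add: P_def Q_def sum_distrib_left sum.distrib sum_negf sum_divide_distrib[symmetric] sum_subtractf)
    then show ?case by (simp add: F_def exp_sum)
  qed
  then have "expectation (\<lambda>\<omega>. exp (- (l * (norm (U t x \<omega>))\<^sup>2 + m * (norm (U s y \<omega>))\<^sup>2) / 2)) =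
    expectation (\<lambda>\<omega>. \<Prod>k\<in>UNIV. F k \<omega>)"
    using U_measurable[of t x] U_measurable[of s y] t by (intro integral_cong_AE) auto
  also have "\<dots> = (\<Prod>k\<in>UNIV. expectation (F k))"
    by (rule indep_vars_lebesgue_integral) (use indF Fint in auto)
  also have "\<dots> = (1 / sqrt ((1 + l * string_variance t x) * (1 + m * string_variance s y) -
      l * m * (string_covariance t x s y)\<^sup>2)) ^ CARD('d)"
    by (simp add: EF)
  finally show ?thesis .
qed

end

section \<open>Covariance estimates in parabolic boxes\<close>

lemma kappa_bounds: "1 / 4 \<le> \<kappa>" "\<kappa> \<le> 1 / 3"
proof -
  have "sqrt (4 * pi) \<le> sqrt (4\<^sup>2)" using pi_less_4 by (intro real_sqrt_le_mono) simp
  then show "1 / 4 \<le> \<kappa>" by (simp add: field_simps)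
  have "sqrt (3\<^sup>2) \<le> sqrt (4 * pi)" using pi_gt3 by (intro real_sqrt_le_mono) simp
  then show "\<kappa> \<le> 1 / 3" by (simp add: field_simps)
qed

lemma sqrt_diff_le:
  assumes "0 < c" "c\<^sup>2 \<le> s" "c\<^sup>2 \<le> t"
  shows "\<bar>sqrt t - sqrt s\<bar> \<le> \<bar>t - s\<bar> / (2 * c)"
proof -
  have c: "c \<le> sqrt s" "c \<le> sqrt t" using assms by (auto intro: real_le_rsqrt)
  have "\<bar>sqrt t - sqrt s\<bar> * (2 * c) \<le> \<bar>sqrt t - sqrt s\<bar> * (sqrt t + sqrt s)"
    using c by (intro mult_left_mono) auto
  also have "\<dots> = \<bar>(sqrt t - sqrt s) * (sqrt t + sqrt s)\<bar>"
    using c assms(1) by (simp add: abs_mult)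
  also have "(sqrt t - sqrt s) * (sqrt t + sqrt s) = t - s"
    using assms by (simp add: algebra_simps) (smt (verit) real_sqrt_mult_self zero_le_power2)
  finally show ?thesis using assms by (simp add: pos_le_divide_eq)
qed

text \<open>
  In a box at time \<open>4 A\<^sup>2\<close> and within distance \<open>A\<close> of the origin all variances are comparable to \<open>A\<close>.
\<close>

lemma string_variance_box:
  assumes A: "A > 0" and t: "4 * A\<^sup>2 \<le> t" "t \<le> 5 * A\<^sup>2" and x: "0 \<le> x" "x \<le> A"
  shows "4 * \<kappa> * A \<le> string_variance t x" "A \<le> string_variance t x" "string_variance t x \<le> 3 * A"
proof -
  have st: "2 * A \<le> sqrt t" using A t by (intro real_le_rsqrt) (simp add: power_mult_distrib)
  have t0: "t \<ge> 0" using t by (smt (verit) zero_le_power2)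
  have "sqrt t \<le> 5 / 2 * A"
  proof (rule real_le_lsqrt)
    have "(5 / 2 * A)\<^sup>2 = 25 / 4 * A\<^sup>2" by (simp add: power_mult_distrib power_divide)
    then show "t \<le> (5 / 2 * A)\<^sup>2" using t(2) zero_le_power2[of A] by linarith
  qed (use A in auto)
  then have "2 * \<kappa> * sqrt t + 4 * \<kappa> * \<bar>x\<bar> \<le> 2 * \<kappa> * (5 / 2 * A) + 4 * \<kappa> * A"
    using x by (intro add_mono mult_left_mono) auto
  also have "\<dots> = \<kappa> * (9 * A)" by simp
  also have "\<dots> \<le> 1 / 3 * (9 * A)" using kappa_bounds(2) A by (intro mult_right_mono) auto
  finally show "string_variance t x \<le> 3 * A" using string_variance_upper[OF t0, of x] by simp
  have "2 * \<kappa> * (2 * A) \<le> 2 * \<kappa> * sqrt t" using st by (intro mult_left_mono) auto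
  then show *: "4 * \<kappa> * A \<le> string_variance t x" using string_variance_lower[OF t0, of x] by simp
  have "A = 4 * (1 / 4) * A" by simp
  also have "\<dots> \<le> 4 * \<kappa> * A" using kappa_bounds(1) A by (intro mult_right_mono mult_left_mono) auto
  finally show "A \<le> string_variance t x" using * by linarith
qed

text \<open>
  Local nondegeneracy: with variances \<open>a\<close>, \<open>b\<close> and increment variance \<open>D\<close>, four times the determinant
  is \<open>D (2 (a + b) - D) - (a - b)\<^sup>2\<close>. Here \<open>a\<close> and \<open>b\<close> are of order \<open>A\<close>, while \<open>D\<close> is of the order of
  \<open>\<surd>\<bar>t - s\<bar> + \<bar>x - y\<bar>\<close>, and \<open>(a - b)\<^sup>2\<close> is only a small part of \<open>A D\<close> because the variance is smooth
  away from the origin of space-time. Starting the box at time \<open>4 A\<^sup>2\<close> makes the constants fit.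
\<close>

lemma string_covariance_nondegenerate:
  assumes A: "A > 0" and t: "4 * A\<^sup>2 \<le> t" "t \<le> 5 * A\<^sup>2" and x: "0 \<le> x" "x \<le> A"
    and s: "4 * A\<^sup>2 \<le> s" "s \<le> 5 * A\<^sup>2" and y: "0 \<le> y" "y \<le> A"
  shows "A / 16 * (sqrt \<bar>t - s\<bar> + \<bar>x - y\<bar>) \<le>
    string_variance t x * string_variance s y - (string_covariance t x s y)\<^sup>2"
proof -
  define a b where "a = string_variance t x" and "b = string_variance s y"
  define \<delta> h where "\<delta> = \<bar>t - s\<bar>" and "h = \<bar>x - y\<bar>"
  define D where "D = string_variance \<delta> (x - y)"
  define K where "K = \<kappa>"
  have k: "K > 0" "1 / 4 \<le> K" using kappa_bounds(1) by (simp_all add: K_def)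
  have \<delta>: "0 \<le> \<delta>" "\<delta> \<le> A\<^sup>2" using t s by (auto simp: \<delta>_def)
  have h: "0 \<le> h" "h \<le> A" using x y by (auto simp: h_def)
  have sd: "sqrt \<delta> \<le> A" "0 \<le> sqrt \<delta>" using \<delta> A by (auto intro: real_le_lsqrt)
  have s2: "2 * A \<le> sqrt s" using A s by (intro real_le_rsqrt) (simp add: power_mult_distrib)
  have s0: "s > 0" using s A by (smt (verit) zero_less_power)
  have t0: "t > 0" using t A by (smt (verit) zero_less_power)
  have ab: "4 * (K * A) \<le> a" "4 * (K * A) \<le> b"
    using string_variance_box(1)[OF A t x, folded K_def] string_variance_box(1)[OF A s y, folded K_def] by (simp_all add: a_def b_def mult.assoc)
  have "D \<le> 2 * K * sqrt \<delta> + 4 * K * h"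
    using string_variance_upper[OF \<delta>(1), of "x - y", folded K_def] by (simp add: D_def h_def)
  also have "\<dots> \<le> 2 * K * A + 4 * K * A"
    using sd h k by (intro add_mono mult_left_mono) auto
  also have "\<dots> = 6 * (K * A)" by (simp add: algebra_simps)
  finally have D_upper: "D \<le> 6 * (K * A)" .
  have D1: "2 * K * sqrt \<delta> \<le> D" unfolding D_def K_def by (rule string_variance_lower[OF \<delta>(1)])
  have D2: "K * h \<le> D"
    using string_variance_at_0[of "x - y", folded K_def] string_variance_time_bounds(1)[of 0 \<delta> "x - y"] \<delta>
    by (simp add: D_def h_def)
  have D0: "0 \<le> D" using D2 mult_nonneg_nonneg[of K h] h k by linarith
  have D_lower: "K * (sqrt \<delta> + h) \<le> 2 * D"
  proof -
    have "K * (sqrt \<delta> + h) = (2 * K * sqrt \<delta>) / 2 + K * h" by (simp add: algebra_simps)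
    then show ?thesis using D1 D2 D0 by linarith
  qed
  \<comment> \<open>Changing first the time, then the position.\<close>
  have "\<bar>a - b\<bar> \<le> K * (\<delta> / (2 * A) + h / 2)"
  proof -
    have "\<bar>string_variance t x - string_variance s x\<bar> \<le> 2 * K * \<bar>sqrt t - sqrt s\<bar>"
      using string_variance_time_bounds[of s t x, folded K_def] string_variance_time_bounds[of t s x, folded K_def] s0 t0
      by (cases "s \<le> t") auto
    also have "\<dots> \<le> 2 * K * (\<delta> / (2 * (2 * A)))"
      unfolding \<delta>_def using A s t k by (intro mult_left_mono sqrt_diff_le) (auto simp: power_mult_distrib)
    finally have 1: "\<bar>string_variance t x - string_variance s x\<bar> \<le> K * (\<delta> / (2 * A))" by simp
    have xy: "\<bar>x\<^sup>2 - y\<^sup>2\<bar> \<le> h * (2 * A)"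
    proof -
      have "\<bar>x\<^sup>2 - y\<^sup>2\<bar> = \<bar>x - y\<bar> * \<bar>x + y\<bar>" by (simp add: power2_eq_square abs_mult[symmetric] algebra_simps)
      also have "\<dots> \<le> h * (2 * A)" unfolding h_def using x y by (intro mult_left_mono) auto
      finally show ?thesis .
    qed
    have "\<bar>string_variance s x - string_variance s y\<bar> \<le> K * \<bar>x\<^sup>2 - y\<^sup>2\<bar> / (2 * sqrt s)"
      unfolding K_def by (rule string_variance_space_bound[OF s0])
    also have "\<dots> \<le> K * (h * (2 * A)) / (2 * (2 * A))"
      using xy s2 A k by (intro frac_le mult_left_mono) (auto simp: h)
    finally have 2: "\<bar>string_variance s x - string_variance s y\<bar> \<le> K * (h / 2)" using A by simp
    have "K * (\<delta> / (2 * A) + h / 2) = K * (\<delta> / (2 * A)) + K * (h / 2)" by (rule distrib_left)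
    then show ?thesis using 1 2 unfolding a_def b_def by linarith
  qed
  then have "\<bar>a - b\<bar>\<^sup>2 \<le> (K * (\<delta> / (2 * A) + h / 2))\<^sup>2" by (intro power_mono) auto
  then have "(a - b)\<^sup>2 \<le> (K * (\<delta> / (2 * A) + h / 2))\<^sup>2" by (simp only: power2_abs)
  also have "\<dots> = K\<^sup>2 / 4 * (\<delta> / A + h)\<^sup>2"
  proof -
    have "\<delta> / (2 * A) + h / 2 = (\<delta> / A + h) / 2" by (simp add: add_divide_distrib)
    then show ?thesis by (simp only: power_mult_distrib power_divide) simp
  qed
  also have "\<dots> \<le> K\<^sup>2 / 4 * (2 * (A * sqrt \<delta> + A * h))"
  proof (rule mult_left_mono)
    have "\<delta> / A \<le> sqrt \<delta>"
    proof -
      have "\<delta> = sqrt \<delta> * sqrt \<delta>" using \<delta> by simp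
      also have "\<dots> \<le> sqrt \<delta> * A" using sd by (intro mult_left_mono) auto
      finally show ?thesis using A by (simp add: pos_divide_le_eq)
    qed
    then have u: "(\<delta> / A)\<^sup>2 \<le> A * sqrt \<delta>"
      using mult_mono[of "\<delta> / A" A "\<delta> / A" "sqrt \<delta>"] sd \<delta> A by (simp add: power2_eq_square)
    have v: "h\<^sup>2 \<le> A * h" using h by (simp add: power2_eq_square mult_right_mono)
    have "(\<delta> / A + h)\<^sup>2 \<le> 2 * (\<delta> / A)\<^sup>2 + 2 * h\<^sup>2"
      using sum_squares_bound[of "\<delta> / A" h] by (simp add: power2_sum)
    also have "\<dots> \<le> 2 * (A * sqrt \<delta>) + 2 * (A * h)" using u v by (intro add_mono mult_left_mono) auto
    finally show "(\<delta> / A + h)\<^sup>2 \<le> 2 * (A * sqrt \<delta> + A * h)" by simp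
  qed simp
  also have "\<dots> = K * A / 2 * (K * (sqrt \<delta> + h))" by (simp add: power2_eq_square algebra_simps)
  also have "\<dots> \<le> K * A / 2 * (2 * D)" using D_lower A k by (intro mult_left_mono) auto
  finally have e: "(a - b)\<^sup>2 \<le> K * A * D" by simp
  \<comment> \<open>Here \<open>2 (a + b) \<ge> 16 K A\<close>, \<open>D \<le> 6 K A\<close>, and the last summand absorbs \<open>(a - b)\<^sup>2\<close>.\<close>
  have "9 * (K * A) \<le> 2 * (a + b) - D - K * A"
  proof -
    have "9 * P \<le> 2 * (a + b) - D - P" if "4 * P \<le> a" "4 * P \<le> b" "D \<le> 6 * P" for P :: real
      using that by (simp add: algebra_simps)
    from this[OF ab D_upper] show ?thesis .
  qed
  then have "D * (9 * (K * A)) \<le> D * (2 * (a + b) - D - K * A)" by (rule mult_left_mono[OF _ D0])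
  also have "\<dots> = D * (2 * (a + b) - D) - K * A * D" by (simp add: algebra_simps)
  also have "\<dots> \<le> D * (2 * (a + b) - D) - (a - b)\<^sup>2" using e by simp
  also have "\<dots> = 4 * (a * b - ((a + b - D) / 2)\<^sup>2)" by (simp add: power2_eq_square field_simps)
  finally have "2 * (K * A) * D \<le> a * b - ((a + b - D) / 2)\<^sup>2"
  proof -
    assume *: "D * (9 * (K * A)) \<le> 4 * (a * b - ((a + b - D) / 2)\<^sup>2)"
    have "0 \<le> (K * A) * D" using D0 A k by (intro mult_nonneg_nonneg) auto
    moreover have "D * (9 * (K * A)) = 9 * ((K * A) * D)" by (simp only: mult_ac)
    moreover have "2 * P \<le> X" if "0 \<le> P" "9 * P \<le> 4 * X" for P X :: real using that by simp
    ultimately have "2 * ((K * A) * D) \<le> a * b - ((a + b - D) / 2)\<^sup>2" using * by metis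
    then show ?thesis by (simp only: mult.assoc)
  qed
  moreover have "A / 16 * (sqrt \<delta> + h) \<le> 2 * (K * A) * D"
  proof -
    have "1 / 16 \<le> K * K" using mult_mono[OF k(2) k(2)] k(1) by simp
    then have "1 / 16 * (A * (sqrt \<delta> + h)) \<le> K * K * (A * (sqrt \<delta> + h))"
      using A h sd by (intro mult_right_mono) auto
    also have "\<dots> = K * A * (K * (sqrt \<delta> + h))" by (simp add: algebra_simps)
    also have "\<dots> \<le> K * A * (2 * D)" using D_lower A k by (intro mult_left_mono) auto
    finally show ?thesis by (simp add: algebra_simps)
  qed
  ultimately show ?thesis
    by (simp add: string_covariance_def a_def b_def D_def \<delta>_def h_def)
qed

text \<open>
  The larger time scale enters only through increments of \<open>string_variance\<close> over a time of order
  \<open>A\<^sup>2\<close> and a distance of order \<open>A\<close>, so the covariance is of the order of the smaller variance. Divided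
  by both variances, its square is then of order \<open>A / B\<close>.
\<close>

lemma string_covariance_decay:
  assumes A: "A > 0" and AB: "2 * A \<le> B"
    and t: "4 * A\<^sup>2 \<le> t" "t \<le> 5 * A\<^sup>2" and x: "0 \<le> x" "x \<le> A"
    and s: "4 * B\<^sup>2 \<le> s" "s \<le> 5 * B\<^sup>2" and y: "0 \<le> y" "y \<le> B"
  shows "(string_covariance t x s y)\<^sup>2 \<le> 7 * A\<^sup>2"
proof -
  have B: "B > 0" using A AB by simp
  have k: "\<kappa> > 0" by simp
  have "A\<^sup>2 * 4 \<le> B\<^sup>2" using power_mono[OF AB, of 2] A by (simp add: power_mult_distrib)
  then have st: "B\<^sup>2 \<le> s - t" using s t by simp
  have t0: "0 < t" using t A by (smt (verit) zero_less_power)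
  have st0: "0 < s - t" using st B by (smt (verit) zero_less_power)
  have sq: "B \<le> sqrt (s - t)" using st B by (intro real_le_rsqrt) auto
  have tt: "sqrt t \<le> 5 / 2 * A"
  proof (rule real_le_lsqrt)
    have "(5 / 2 * A)\<^sup>2 = 25 / 4 * A\<^sup>2" by (simp add: power_mult_distrib power_divide)
    then show "t \<le> (5 / 2 * A)\<^sup>2" using t(2) zero_le_power2[of A] by linarith
  qed (use A in auto)
  have "sqrt s \<le> sqrt (s - t) + sqrt t"
    using sqrt_add_le_add_sqrt[of "s - t" t] t0 st0 by simp
  then have "2 * \<kappa> * (sqrt s - sqrt (s - t)) \<le> 2 * \<kappa> * (5 / 2 * A)"
    using tt by (intro mult_left_mono) auto
  then have 1: "\<bar>string_variance s y - string_variance (s - t) y\<bar> \<le> 5 * \<kappa> * A"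
    using string_variance_time_bounds[of "s - t" s y] t0 st0 by simp
  have "\<bar>y\<^sup>2 - (y - x)\<^sup>2\<bar> \<le> A * (2 * B)"
  proof -
    have "\<bar>y\<^sup>2 - (y - x)\<^sup>2\<bar> = \<bar>x\<bar> * \<bar>2 * y - x\<bar>"
      by (simp add: power2_eq_square abs_mult[symmetric] algebra_simps)
    also have "\<dots> \<le> A * (2 * B)" using x y A AB by (intro mult_mono) auto
    finally show ?thesis .
  qed
  then have "\<kappa> * \<bar>y\<^sup>2 - (y - x)\<^sup>2\<bar> / (2 * sqrt (s - t)) \<le> \<kappa> * (A * (2 * B)) / (2 * B)"
    using sq A B by (intro frac_le mult_left_mono) auto
  then have 2: "\<bar>string_variance (s - t) y - string_variance (s - t) (y - x)\<bar> \<le> \<kappa> * A"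
    using string_variance_space_bound[OF st0, of y "y - x"] B by simp
  have 3: "0 \<le> string_variance t x" "string_variance t x \<le> 3 * A"
    using string_variance_box[OF A t x] A by auto
  have "\<bar>t - s\<bar> = s - t" using st0 by simp
  then have c: "2 * string_covariance t x s y =
    string_variance t x + (string_variance s y - string_variance (s - t) y) +
    (string_variance (s - t) y - string_variance (s - t) (y - x))"
    by (simp add: string_covariance_def string_variance_commute[of _ x y])
  have "6 * (\<kappa> * A) \<le> 6 * (1 / 3 * A)" using kappa_bounds(2) A by (intro mult_left_mono mult_right_mono) auto
  then have "\<bar>2 * string_covariance t x s y\<bar> \<le> 5 * A"
    using 1 2 3 unfolding c by linarith
  then have "\<bar>2 * string_covariance t x s y\<bar>\<^sup>2 \<le> (5 * A)\<^sup>2" by (intro power_mono) auto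
  then have "4 * (string_covariance t x s y)\<^sup>2 \<le> 25 * A\<^sup>2" by (simp add: power_mult_distrib)
  then show ?thesis using zero_le_power2[of A] by linarith
qed

section \<open>A second moment criterion\<close>

lemma sum_dist_le:
  fixes f :: "nat \<Rightarrow> real"
  assumes f: "\<And>k. 0 \<le> f k" and i: "i < n"
  shows "(\<Sum>j<n. f ((i - j) + (j - i))) \<le> 2 * (\<Sum>k<n. f k)"
proof -
  have "(\<Sum>j<n. f ((i - j) + (j - i))) = (\<Sum>j\<in>{..<Suc i}. f ((i - j) + (j - i))) + (\<Sum>j\<in>{Suc i..<n}. f ((i - j) + (j - i)))"
    using i by (subst sum.union_disjoint[symmetric]) (auto intro!: sum.cong)
  also have "(\<Sum>j\<in>{..<Suc i}. f ((i - j) + (j - i))) = (\<Sum>j\<in>{..<Suc i}. f (Suc i - Suc j))"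
    by (intro sum.cong) auto
  also have "\<dots> = (\<Sum>k<Suc i. f k)" by (rule sum.nat_diff_reindex)
  also have "\<dots> \<le> (\<Sum>k<n. f k)" using i by (intro sum_mono2 f) auto
  also have "(\<Sum>j\<in>{Suc i..<n}. f ((i - j) + (j - i))) = (\<Sum>k\<in>{1..<n - i}. f k)"
    by (rule sum.reindex_bij_witness[of _ "\<lambda>k. k + i" "\<lambda>j. j - i"]) auto
  also have "\<dots> \<le> (\<Sum>k<n. f k)" by (intro sum_mono2 f) auto
  finally show ?thesis by simp
qed

text \<open>
  The summand is dominated by a telescoping difference of \<open>2 / w\<^sup>2\<close>.
\<close>

lemma sum_inverse_cube_le:
  fixes y :: real
  assumes y: "y \<ge> 1"
  shows "(\<Sum>j<n. 1 / (y + real j) ^ 3) \<le> 2 / y\<^sup>2"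
proof -
  have step: "1 / (y + real j) ^ 3 \<le> 2 / (y + real j)\<^sup>2 - 2 / (y + real (Suc j))\<^sup>2" for j
  proof -
    define w where "w = y + real j"
    have w: "w \<ge> 1" using y by (simp add: w_def)
    have "2 / w\<^sup>2 - 2 / (w + 1)\<^sup>2 = (2 * (w + 1)\<^sup>2 - 2 * w\<^sup>2) / (w\<^sup>2 * (w + 1)\<^sup>2)"
      using w by (intro diff_frac_eq) auto
    moreover have "2 * (w + 1)\<^sup>2 - 2 * w\<^sup>2 = 2 * (2 * w + 1)"
      by (simp add: power2_eq_square algebra_simps)
    moreover have "1 / w ^ 3 \<le> 2 * (2 * w + 1) / (w\<^sup>2 * (w + 1)\<^sup>2)"
    proof -
      have "(w + 1)\<^sup>2 \<le> 2 * (2 * w + 1) * w"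
        using w mult_mono[OF w w] by (simp add: power2_eq_square algebra_simps)
      then have "1 * (w\<^sup>2 * (w + 1)\<^sup>2) \<le> w\<^sup>2 * (2 * (2 * w + 1) * w)"
        by (simp add: mult_left_mono)
      also have "\<dots> = 2 * (2 * w + 1) * w ^ 3" by (simp add: power2_eq_square power3_eq_cube)
      finally show ?thesis using w by (intro divide_le_eq[THEN iffD2] frac_le_eq[THEN iffD2]) (auto simp: divide_simps)
    qed
    ultimately have "1 / w ^ 3 \<le> 2 / w\<^sup>2 - 2 / (w + 1)\<^sup>2" by metis
    moreover have "y + real (Suc j) = w + 1" by (simp add: w_def)
    ultimately show ?thesis by (simp only: w_def)
  qed
  have "(\<Sum>j<n. 1 / (y + real j) ^ 3) \<le> (\<Sum>j<n. 2 / (y + real j)\<^sup>2 - 2 / (y + real (Suc j))\<^sup>2)"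
    by (intro sum_mono step)
  also have "\<dots> = 2 / (y + real 0)\<^sup>2 - 2 / (y + real n)\<^sup>2"
    by (rule sum_lessThan_telescope')
  also have "\<dots> \<le> 2 / y\<^sup>2" by simp
  finally show ?thesis .
qed

text \<open>
  Each dyadic block contributes at most one. The numbers of cells are powers of two, so this avoids
  logarithms.
\<close>

lemma harmonic_dyadic_le: "(\<Sum>k<2 ^ m. 1 / (1 + real k)) \<le> 1 + real m"
proof (induction m)
  case 0 then show ?case by simp
next
  case (Suc m)
  have "(\<Sum>k<2 ^ Suc m. 1 / (1 + real k)) = (\<Sum>k<2 ^ m. 1 / (1 + real k)) + (\<Sum>k\<in>{2 ^ m..<2 ^ Suc m}. 1 / (1 + real k))"
    by (subst sum.union_disjoint[symmetric]) (auto intro!: sum.cong)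
  also have "(\<Sum>k\<in>{2 ^ m..<2 ^ Suc m}. 1 / (1 + real k)) \<le> (\<Sum>k\<in>{2 ^ m..<(2::nat) ^ Suc m}. 1 / 2 ^ m)"
  proof (intro sum_mono frac_le)
    fix k :: nat assume "k \<in> {2 ^ m..<2 ^ Suc m}"
    then have "real (2 ^ m) \<le> real k" by (intro of_nat_mono) auto
    then show "2 ^ m \<le> 1 + real k" unfolding of_nat_power of_nat_numeral by linarith
  qed auto
  also have "\<dots> = 1" by simp
  finally show ?case using Suc by simp
qed

text \<open>
  The logarithmic growth in the critical dimension: summing over \<open>j'\<close> first turns the cube into a
  square, \<open>1 / (1 + \<surd>k)\<^sup>2 \<le> 1 / (1 + k)\<close>, and a harmonic sum over the time distance \<open>k\<close> remains.
\<close>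

lemma parabolic_sum_le:
  fixes J m :: nat
  assumes J: "J\<^sup>2 = 2 ^ m"
  shows "(\<Sum>(i, j)\<in>{..<J\<^sup>2} \<times> {..<J}. \<Sum>(i', j')\<in>{..<J\<^sup>2} \<times> {..<J}.
      1 / (1 + sqrt \<bar>real i - real i'\<bar> + \<bar>real j - real j'\<bar>) ^ 3) \<le> 8 * real J ^ 3 * (1 + real m)"
proof -
  let ?f = "\<lambda>k l :: nat. 1 / (1 + sqrt (real k) + real l) ^ 3"
  let ?d = "\<lambda>i j :: nat. (i - j) + (j - i)"
  have d: "\<bar>real i - real i'\<bar> = real (?d i i')" for i i' by linarith
  have f0: "0 \<le> ?f k l" for k l by simp
  have inner: "(\<Sum>(i', j')\<in>{..<J\<^sup>2} \<times> {..<J}. ?f (?d i i') (?d j j')) \<le> 8 * (1 + real m)"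
    if "i < J\<^sup>2" "j < J" for i j
  proof -
    have "(\<Sum>(i', j')\<in>{..<J\<^sup>2} \<times> {..<J}. ?f (?d i i') (?d j j')) =
      (\<Sum>i'<J\<^sup>2. \<Sum>j'<J. ?f (?d i i') (?d j j'))" by (rule sum.cartesian_product[symmetric])
    also have "\<dots> \<le> (\<Sum>i'<J\<^sup>2. 2 * (\<Sum>l<J. ?f (?d i i') l))"
      using that by (intro sum_mono sum_dist_le f0)
    also have "\<dots> \<le> 2 * (\<Sum>k<J\<^sup>2. 2 * (\<Sum>l<J. ?f k l))"
      using that by (intro sum_dist_le mult_nonneg_nonneg sum_nonneg f0) auto
    also have "\<dots> \<le> 2 * (\<Sum>k<J\<^sup>2. 2 * (2 * (1 / (1 + real k))))"
    proof (intro mult_left_mono sum_mono)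
      fix k
      have "(\<Sum>l<J. ?f k l) \<le> 2 / (1 + sqrt (real k))\<^sup>2"
        by (rule sum_inverse_cube_le) simp
      also have "\<dots> \<le> 2 / (1 + real k)" by (intro divide_left_mono) (auto simp: power2_sum add_pos_nonneg)
      finally show "(\<Sum>l<J. ?f k l) \<le> 2 * (1 / (1 + real k))" by simp
    qed auto
    also have "\<dots> = 8 * (\<Sum>k<2 ^ m. 1 / (1 + real k))"
      unfolding J by (simp add: sum_distrib_left)
    also have "\<dots> \<le> 8 * (1 + real m)" using harmonic_dyadic_le[of m] by simp
    finally show ?thesis .
  qed
  have "(\<Sum>(i, j)\<in>{..<J\<^sup>2} \<times> {..<J}. \<Sum>(i', j')\<in>{..<J\<^sup>2} \<times> {..<J}.
      1 / (1 + sqrt \<bar>real i - real i'\<bar> + \<bar>real j - real j'\<bar>) ^ 3) \<le>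
    (\<Sum>(i, j)\<in>{..<J\<^sup>2} \<times> {..<J}. 8 * (1 + real m))"
    unfolding d using inner by (intro sum_mono) (auto split: prod.split)
  also have "\<dots> = 8 * real J ^ 3 * (1 + real m)"
    by (simp add: card_cartesian_product power2_eq_square power3_eq_cube)
  finally show ?thesis .
qed

lemma harmonic_tail_unbounded:
  assumes "k \<ge> 1"
  shows "\<exists>N\<ge>k. c \<le> (\<Sum>n=k..N. 1 / real n)"
proof (rule ccontr)
  assume "\<not> ?thesis"
  then have b: "(\<Sum>n=k..N. 1 / real n) \<le> c" if "N \<ge> k" for N using that by force
  have "summable (\<lambda>n. 1 / real (n + k))"
  proof (rule bounded_imp_summable)
    fix n
    have "(\<Sum>i\<le>n. 1 / real (i + k)) = (\<Sum>n=k..n + k. 1 / real n)"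
      by (rule sum.reindex_bij_witness[of _ "\<lambda>j. j - k" "\<lambda>i. i + k"]) auto
    then show "(\<Sum>i\<le>n. 1 / real (i + k)) \<le> c" using b[of "n + k"] by simp
  qed simp
  then have "summable (\<lambda>n. 1 / real n)" by (subst (asm) summable_iff_shift)
  then show False using not_summable_harmonic[where 'a=real] by (simp add: inverse_eq_divide)
qed

text \<open>
  For \<open>Z = \<Sum> Y\<^sub>n / n\<close> over a range of scales the bound on the moments makes the variance at
  most \<open>4 C\<close> times the mean \<open>L\<close>, because the diagonal terms are of order \<open>n / n\<^sup>2\<close> and the others decay
  geometrically. If all \<open>Y\<^sub>n \<le> 1/2\<close> then \<open>Z \<le> L / 2\<close>, which by Chebyshev's inequality has probability at
  most \<open>16 C / L\<close>; and \<open>L\<close> is a tail of the harmonic series.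
\<close>

lemma (in prob_space) second_moment_infinitely_often:
  fixes Y :: "nat \<Rightarrow> 'a \<Rightarrow> real"
  assumes Y[measurable]: "\<And>n. Y n \<in> borel_measurable M"
    and sq: "\<And>n. integrable M (\<lambda>\<omega>. (Y n \<omega>)\<^sup>2)"
    and mean: "\<And>n. n \<ge> 1 \<Longrightarrow> expectation (Y n) = 1"
    and cov: "\<And>n m. 1 \<le> n \<Longrightarrow> n \<le> m \<Longrightarrow> expectation (\<lambda>\<omega>. Y n \<omega> * Y m \<omega>) \<le> 1 + C * real n / 2 ^ (m - n)"
    and C: "C \<ge> 0"
  shows "AE \<omega> in M. \<exists>n\<ge>k. Y n \<omega> > 1 / 2"
proof -
  define k' where "k' = max 1 k"
  have k': "k' \<ge> 1" "k' \<ge> k" by (auto simp: k'_def)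
  have prod_int: "integrable M (\<lambda>\<omega>. Y n \<omega> * Y m \<omega>)" for n m
    by (rule integrable_mult_of_squares[OF Y Y sq sq])
  have int: "integrable M (Y n)" for n by (rule square_integrable_imp_integrable[OF Y sq])
  define L where "L N = (\<Sum>n=k'..N. 1 / real n)" for N
  define Z where "Z N \<omega> = (\<Sum>n=k'..N. Y n \<omega> / real n)" for N \<omega>
  have Z[measurable]: "Z N \<in> borel_measurable M" for N unfolding Z_def[abs_def] by measurable
  have Zsq: "(Z N \<omega>)\<^sup>2 = (\<Sum>n=k'..N. \<Sum>m=k'..N. 1 / (real n * real m) * (Y n \<omega> * Y m \<omega>))" for N \<omega>
    unfolding Z_def power2_eq_square sum_product by (intro sum.cong refl) simp
  have Z2: "integrable M (\<lambda>\<omega>. (Z N \<omega>)\<^sup>2)" for N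
    unfolding Zsq using prod_int by (intro Bochner_Integration.integrable_sum integrable_mult_right) auto
  have EZ: "expectation (Z N) = L N" for N
    unfolding Z_def L_def using int k' by (subst Bochner_Integration.integral_sum) (auto simp: mean intro!: sum.cong)
  \<comment> \<open>A bound for the covariance of \<open>Y n / n\<close> and \<open>Y m / m\<close> when \<open>n \<le> m\<close>.\<close>
  define B where "B n m = (if n \<le> m then C / real n / 2 ^ (m - n) else 0)" for n m :: nat
  have B0: "0 \<le> B n m" for n m using C by (simp add: B_def)
  have var: "variance (Z N) \<le> 4 * C * L N" for N
  proof -
    have "variance (Z N) = expectation (\<lambda>\<omega>. (Z N \<omega>)\<^sup>2) - (L N)\<^sup>2"
      using variance_eq[of "Z N"] Z2 square_integrable_imp_integrable[OF Z Z2] EZ by simp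
    also have "\<dots> = (\<Sum>n=k'..N. \<Sum>m=k'..N. 1 / (real n * real m) * expectation (\<lambda>\<omega>. Y n \<omega> * Y m \<omega>)) -
      (\<Sum>n=k'..N. \<Sum>m=k'..N. 1 / (real n * real m))"
      unfolding Zsq L_def power2_eq_square[of "sum _ _"] sum_product
      using prod_int by (simp add: Bochner_Integration.integral_sum)
    also have "\<dots> = (\<Sum>n=k'..N. \<Sum>m=k'..N. 1 / (real n * real m) * (expectation (\<lambda>\<omega>. Y n \<omega> * Y m \<omega>) - 1))"
      by (simp add: sum_subtractf right_diff_distrib)
    also have "\<dots> \<le> (\<Sum>n=k'..N. \<Sum>m=k'..N. B n m + B m n)"
    proof (intro sum_mono)
      fix n m assume "n \<in> {k'..N}" "m \<in> {k'..N}"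
      then have nm: "n \<ge> 1" "m \<ge> 1" using k' by auto
      have le: "1 / (real n * real m) * (expectation (\<lambda>\<omega>. Y n \<omega> * Y m \<omega>) - 1) \<le> B n m"
        if "1 \<le> n" "n \<le> m" for n m
      proof -
        have "1 / (real n * real m) * (expectation (\<lambda>\<omega>. Y n \<omega> * Y m \<omega>) - 1) \<le>
          1 / (real n * real m) * (C * real n / 2 ^ (m - n))"
          using cov[OF that] by (intro mult_left_mono) auto
        also have "\<dots> = C / real m / 2 ^ (m - n)" using that by simp
        also have "\<dots> \<le> C / real n / 2 ^ (m - n)"
          using that C by (intro divide_right_mono divide_left_mono) auto
        finally show ?thesis using that by (simp add: B_def)
      qed
      show "1 / (real n * real m) * (expectation (\<lambda>\<omega>. Y n \<omega> * Y m \<omega>) - 1) \<le> B n m + B m n"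
      proof (cases "n \<le> m")
        case True
        then show ?thesis using le[of n m] nm B0[of m n] by simp
      next
        case False
        then show ?thesis using le[of m n] nm B0[of n m] by (simp add: mult.commute)
      qed
    qed
    also have "\<dots> = 2 * (\<Sum>n=k'..N. \<Sum>m=k'..N. B n m)"
      unfolding sum.distrib by (subst (2) sum.swap) simp
    also have "\<dots> \<le> 2 * (\<Sum>n=k'..N. 2 * C * (1 / real n))"
    proof (intro mult_left_mono sum_mono)
      fix n assume "n \<in> {k'..N}"
      have "(\<Sum>m=k'..N. B n m) \<le> (\<Sum>m\<in>{n..<n + Suc N}. C / real n / 2 ^ (m - n))"
      proof -
        have "(\<Sum>m=k'..N. B n m) = (\<Sum>m | m \<in> {k'..N} \<and> n \<le> m. C / real n / 2 ^ (m - n))"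
          by (subst sum.inter_filter) (auto simp: B_def)
        also have "\<dots> \<le> (\<Sum>m\<in>{n..<n + Suc N}. C / real n / 2 ^ (m - n))"
          by (rule sum_mono2) (use C in auto)
        finally show ?thesis .
      qed
      also have "\<dots> = (\<Sum>j<Suc N. C / real n / 2 ^ j)"
        by (rule sum.reindex_bij_witness[of _ "\<lambda>j. j + n" "\<lambda>m. m - n"]) auto
      also have "\<dots> = C / real n * (\<Sum>j<Suc N. (1 / 2) ^ j)"
        by (simp only: sum_distrib_left power_one_over) simp
      also have "\<dots> \<le> C / real n * 2"
      proof (rule mult_left_mono)
        show "(\<Sum>j<Suc N. (1 / 2) ^ j) \<le> (2::real)" by (subst geometric_sum) auto
      qed (use C in simp)
      finally show "(\<Sum>m=k'..N. B n m) \<le> 2 * C * (1 / real n)" by (simp add: mult.commute)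
    qed auto
    also have "\<dots> = 4 * C * L N" by (simp add: L_def sum_distrib_left)
    finally show ?thesis .
  qed
  \<comment> \<open>On this event \<open>Z N \<le> L N / 2\<close> for every \<open>N\<close>, so its probability is at most \<open>16 C / L N\<close> for every \<open>N\<close>.\<close>
  let ?Bad = "{\<omega> \<in> space M. \<forall>n\<ge>k. Y n \<omega> \<le> 1 / 2}"
  have bad: "prob ?Bad \<le> 16 * C / L N" if L: "L N > 0" for N
  proof -
    have "?Bad \<subseteq> {\<omega> \<in> space M. \<bar>Z N \<omega> - expectation (Z N)\<bar> \<ge> L N / 2}"
    proof (intro subsetI CollectI conjI)
      fix \<omega> assume \<omega>: "\<omega> \<in> ?Bad"
      then show "\<omega> \<in> space M" by simp
      have "Z N \<omega> \<le> (\<Sum>n=k'..N. 1 / 2 * (1 / real n))"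
        unfolding Z_def using \<omega> k' by (intro sum_mono) (auto simp: divide_simps)
      also have "\<dots> = L N / 2" unfolding L_def sum_distrib_left[symmetric] by simp
      finally show "\<bar>Z N \<omega> - expectation (Z N)\<bar> \<ge> L N / 2" unfolding EZ by linarith
    qed
    then have "prob ?Bad \<le> prob {\<omega> \<in> space M. \<bar>Z N \<omega> - expectation (Z N)\<bar> \<ge> L N / 2}"
      by (intro finite_measure_mono) measurable
    also have "\<dots> \<le> variance (Z N) / (L N / 2)\<^sup>2"
      by (rule Chebyshev_inequality[OF Z Z2]) (use L in simp)
    also have "\<dots> \<le> (4 * C * L N) / (L N / 2)\<^sup>2" using var by (intro divide_right_mono) auto
    also have "\<dots> = 16 * C / L N" using L by (simp add: power2_eq_square field_simps)
    finally show ?thesis .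
  qed
  have "prob ?Bad \<le> e" if e: "e > 0" for e
  proof -
    obtain N where N: "16 * C / e + 1 \<le> L N"
      using harmonic_tail_unbounded[OF k'(1), of "16 * C / e + 1"] unfolding L_def by blast
    then have L: "L N > 0" using C e by (smt (verit) divide_nonneg_nonneg)
    have "16 * C / L N \<le> e" using N L e by (simp add: field_simps)
    then show ?thesis using bad[OF L] by simp
  qed
  then have "prob ?Bad \<le> 0" by (rule field_le_epsilon[where y=0, simplified])
  then have "prob ?Bad = 0" by (simp add: measure_le_0_iff)
  then have "AE \<omega> in M. \<omega> \<notin> ?Bad" by (subst (asm) prob_eq_0) auto
  then show ?thesis using AE_space by eventually_elim (auto simp: not_le)
qed

section \<open>Bumps along a parabolic grid\<close>

text \<open>
  At scale \<open>n\<close> let \<open>A = 16\<^sup>n\<close> and \<open>\<lambda> = 16\<^sup>b\<^sup>n\<close>. The box \<open>[4 A\<^sup>2, 5 A\<^sup>2) \<times> [0, A)\<close> is divided with mesh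
  \<open>1 / \<lambda>\<^sup>2\<close> in time and \<open>1 / \<lambda>\<close> in space, so that neighbouring values of the string differ by about
  \<open>\<lambda>\<^sup>-\<^sup>1\<^sup>/\<^sup>2\<close>. There are \<open>J = A \<lambda>\<close> cells in space and \<open>J\<^sup>2\<close> in time.
\<close>

definition cells :: "nat \<Rightarrow> nat \<Rightarrow> nat" where
  "cells b n = 16 ^ ((b + 1) * n)"

definition grid :: "nat \<Rightarrow> nat \<Rightarrow> (nat \<times> nat) set" where
  "grid b n = {..<(cells b n)\<^sup>2} \<times> {..<cells b n}"

definition grid_time :: "nat \<Rightarrow> nat \<Rightarrow> nat \<times> nat \<Rightarrow> real" where
  "grid_time b n p = 4 * (16 ^ n)\<^sup>2 + real (fst p) / (16 ^ (b * n))\<^sup>2"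

definition grid_pos :: "nat \<Rightarrow> nat \<Rightarrow> nat \<times> nat \<Rightarrow> real" where
  "grid_pos b n p = real (snd p) / 16 ^ (b * n)"

lemma real_cells: "real (cells b n) = 16 ^ n * 16 ^ (b * n)"
  by (simp add: cells_def power_add)

lemma cells_ge_1: "1 \<le> real (cells b n)"
  by (simp add: cells_def)

lemma finite_grid [simp]: "finite (grid b n)"
  by (simp add: grid_def)

lemma card_grid: "real (card (grid b n)) = real (cells b n) ^ 3"
  by (simp add: grid_def card_cartesian_product power2_eq_square power3_eq_cube)

lemma grid_box:
  assumes "p \<in> grid b n"
  shows "4 * (16 ^ n)\<^sup>2 \<le> grid_time b n p" "grid_time b n p \<le> 5 * (16 ^ n)\<^sup>2"
    "0 \<le> grid_pos b n p" "grid_pos b n p \<le> 16 ^ n" "grid_time b n p > 0"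
proof -
  have i: "real (fst p) \<le> (real (cells b n))\<^sup>2"
    using assms by (auto simp: grid_def simp flip: of_nat_power)
  have "real (fst p) / (16 ^ (b * n))\<^sup>2 \<le> (16 ^ n)\<^sup>2"
    using i by (simp add: divide_le_eq real_cells power_mult_distrib)
  then show "grid_time b n p \<le> 5 * (16 ^ n)\<^sup>2" by (simp add: grid_time_def)
  show "4 * (16 ^ n)\<^sup>2 \<le> grid_time b n p" by (simp add: grid_time_def)
  show "grid_time b n p > 0" unfolding grid_time_def by (rule add_pos_nonneg) auto
  show "0 \<le> grid_pos b n p" by (simp add: grid_pos_def)
  have "real (snd p) \<le> real (cells b n)" using assms by (auto simp: grid_def)
  then show "grid_pos b n p \<le> 16 ^ n" by (simp add: grid_pos_def divide_le_eq real_cells)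
qed

lemma sixth_power_inverse_sqrt: "X > 0 \<Longrightarrow> (1 / sqrt X) ^ 6 = 1 / X ^ 3"
proof -
  assume "X > 0"
  then have "((sqrt X)\<^sup>2) ^ 3 = X ^ 3" by simp
  then show ?thesis by (simp add: power_divide flip: power_mult)
qed

text \<open>
  After multiplication by \<open>(1 - r)\<^sup>3\<close> the difference of the two sides is \<open>r (1 - 2 r)\<close> times a quadratic
  that is positive on the interval.
\<close>

lemma inverse_cube_le:
  fixes r :: real
  assumes "0 \<le> r" "r \<le> 1 / 2"
  shows "1 / (1 - r) ^ 3 \<le> 1 + 14 * r"
proof -
  have "0 \<le> r * ((1 - 2 * r) * (11 - 17 * r + 7 * r\<^sup>2))"
    using assms by (intro mult_nonneg_nonneg) (auto intro!: add_nonneg_nonneg)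
  also have "\<dots> = (1 + 14 * r) * (1 - r) ^ 3 - 1"
    by (simp add: power2_eq_square power3_eq_cube algebra_simps)
  finally show ?thesis using assms by (simp add: pos_divide_le_eq)
qed

text \<open>
  A smooth substitute for the indicator of \<open>\<bar>U\<bar>\<^sup>2 \<le> 16\<^sup>-\<^sup>b\<^sup>n\<close> with explicit moments.
\<close>

definition (in pinned_string) bump :: "nat \<Rightarrow> nat \<Rightarrow> nat \<times> nat \<Rightarrow> 'a \<Rightarrow> real" where
  "bump b n p \<omega> = exp (- (16 ^ (b * n) * (norm (U (grid_time b n p) (grid_pos b n p) \<omega>))\<^sup>2) / 2)"

definition (in pinned_string) mass :: "nat \<Rightarrow> nat \<Rightarrow> real" where
  "mass b n = (\<Sum>p\<in>grid b n. expectation (bump b n p))"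

definition (in pinned_string) occupation :: "nat \<Rightarrow> nat \<Rightarrow> 'a \<Rightarrow> real" where
  "occupation b n \<omega> = (\<Sum>p\<in>grid b n. bump b n p \<omega>) / mass b n"

abbreviation (input) "grid_variance b n p \<equiv> string_variance (grid_time b n p) (grid_pos b n p)"

abbreviation (input) "grid_covariance b n p m q \<equiv>
  string_covariance (grid_time b n p) (grid_pos b n p) (grid_time b m q) (grid_pos b m q)"

lemma grid_variance_bounds:
  assumes "p \<in> grid b n"
  shows "real (cells b n) \<le> 16 ^ (b * n) * grid_variance b n p"
    "1 + 16 ^ (b * n) * grid_variance b n p \<le> 4 * real (cells b n)"
proof -
  note box = string_variance_box[of "16 ^ n", OF _ grid_box(1-4)[OF assms]]
  show "real (cells b n) \<le> 16 ^ (b * n) * grid_variance b n p"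
    using box(2) by (simp add: real_cells mult.commute)
  have "16 ^ (b * n) * grid_variance b n p \<le> 16 ^ (b * n) * (3 * 16 ^ n)"
    using box(3) by (intro mult_left_mono) auto
  also have "\<dots> = 3 * real (cells b n)" by (simp add: real_cells mult_ac)
  finally show "1 + 16 ^ (b * n) * grid_variance b n p \<le> 4 * real (cells b n)"
    using cells_ge_1[of b n] by linarith
qed

text \<open>
  The scaling of the mesh turns the determinant estimate into one with integer distances; the
  variances on the diagonal supply the summand \<open>1\<close>, so that the case \<open>p = q\<close> is included.
\<close>

lemma grid_determinant:
  assumes p: "p \<in> grid b n" and q: "q \<in> grid b n"
  shows "real (cells b n) / 16 * (1 + sqrt \<bar>real (fst p) - real (fst q)\<bar> + \<bar>real (snd p) - real (snd q)\<bar>) \<le>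
    (1 + 16 ^ (b * n) * grid_variance b n p) * (1 + 16 ^ (b * n) * grid_variance b n q) -
      16 ^ (b * n) * 16 ^ (b * n) * (grid_covariance b n p n q)\<^sup>2"
proof -
  define A l :: real where "A = 16 ^ n" and "l = 16 ^ (b * n)"
  have pos: "A > 0" "l > 0" by (simp_all add: A_def l_def)
  define a c d where "a = grid_variance b n p" and "c = grid_variance b n q" and "d = grid_covariance b n p n q"
  let ?s = "sqrt \<bar>real (fst p) - real (fst q)\<bar>" and ?h = "\<bar>real (snd p) - real (snd q)\<bar>"
  have "A / 16 * (sqrt \<bar>grid_time b n p - grid_time b n q\<bar> + \<bar>grid_pos b n p - grid_pos b n q\<bar>) \<le> a * c - d\<^sup>2"
    unfolding a_def c_def d_def A_def
    by (rule string_covariance_nondegenerate) (use grid_box[OF p] grid_box[OF q] in auto)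
  moreover have "\<bar>grid_time b n p - grid_time b n q\<bar> = \<bar>real (fst p) - real (fst q)\<bar> / l\<^sup>2"
    unfolding grid_time_def l_def by (simp add: diff_divide_distrib[symmetric])
  moreover have "\<bar>grid_pos b n p - grid_pos b n q\<bar> = ?h / l"
    unfolding grid_pos_def l_def by (simp add: diff_divide_distrib[symmetric])
  ultimately have "A / 16 * (?s / l + ?h / l) \<le> a * c - d\<^sup>2"
    using pos by (simp add: real_sqrt_divide)
  then have "l\<^sup>2 * (A / 16 * (?s / l + ?h / l)) \<le> l\<^sup>2 * (a * c - d\<^sup>2)"
    by (rule mult_left_mono) simp
  also have "l\<^sup>2 * (A / 16 * (?s / l + ?h / l)) = A * l / 16 * (?s + ?h)"
    using pos by (simp add: power2_eq_square field_simps)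
  finally have 1: "A * l / 16 * (?s + ?h) \<le> l\<^sup>2 * (a * c - d\<^sup>2)" .
  have 2: "A * l \<le> l * a" "A * l \<le> l * c"
    using grid_variance_bounds(1)[OF p] grid_variance_bounds(1)[OF q]
    by (simp_all add: real_cells A_def l_def a_def c_def)
  have 3: "A * l / 16 \<le> 1 + l * a + l * c"
  proof -
    have "0 \<le> A * l" using pos by simp
    then show ?thesis using 2 by linarith
  qed
  have "A * l / 16 * (1 + ?s + ?h) = A * l / 16 + A * l / 16 * (?s + ?h)" by (simp add: algebra_simps)
  also have "\<dots> \<le> 1 + l * a + l * c + l\<^sup>2 * (a * c - d\<^sup>2)"
    by (rule add_mono[OF 3 1])
  also have "\<dots> = (1 + l * a) * (1 + l * c) - l * l * d\<^sup>2"
    by (simp add: power2_eq_square algebra_simps)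
  finally show ?thesis by (simp add: real_cells A_def l_def a_def c_def d_def add.assoc)
qed

text \<open>
  The left-hand side over the product on the right is the squared correlation of the two values,
  regularized by the width of the bumps.
\<close>

lemma grid_decorrelation:
  assumes p: "p \<in> grid b n" and q: "q \<in> grid b m" and nm: "n < m"
  shows "16 ^ (b * n) * 16 ^ (b * m) * (grid_covariance b n p m q)\<^sup>2 \<le>
    7 / 16 ^ (m - n) * ((1 + 16 ^ (b * n) * grid_variance b n p) * (1 + 16 ^ (b * m) * grid_variance b m q))"
proof -
  define A B l k :: real where "A = 16 ^ n" and "B = 16 ^ m" and "l = 16 ^ (b * n)" and "k = 16 ^ (b * m)"
  have pos: "A > 0" "B > 0" "l > 0" "k > 0" by (simp_all add: A_def B_def l_def k_def)
  have BA: "B = A * 16 ^ (m - n)" using nm by (simp add: A_def B_def power_add[symmetric])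
  have "(16::real) ^ 1 \<le> 16 ^ (m - n)" using nm by (intro power_increasing) auto
  then have AB: "2 * A \<le> B" unfolding BA using pos by simp
  have "(grid_covariance b n p m q)\<^sup>2 \<le> 7 * A\<^sup>2"
    unfolding A_def
    by (rule string_covariance_decay[where B="16 ^ m"])
      (use grid_box[OF p] grid_box[OF q] AB[unfolded A_def B_def] in auto)
  then have "l * k * (grid_covariance b n p m q)\<^sup>2 \<le> l * k * (7 * A\<^sup>2)"
    using pos by (intro mult_left_mono) auto
  also have "\<dots> = 7 / 16 ^ (m - n) * ((A * l) * (B * k))"
    unfolding BA by (simp add: power2_eq_square)
  also have "\<dots> \<le> 7 / 16 ^ (m - n) * ((1 + l * grid_variance b n p) * (1 + k * grid_variance b m q))"
  proof (intro mult_left_mono[OF mult_mono])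
    show 1: "A * l \<le> 1 + l * grid_variance b n p"
      using grid_variance_bounds(1)[OF p] unfolding real_cells A_def l_def by linarith
    show "B * k \<le> 1 + k * grid_variance b m q"
      using grid_variance_bounds(1)[OF q] unfolding real_cells B_def k_def by linarith
    have "0 \<le> A * l" using pos by simp
    then show "0 \<le> 1 + l * grid_variance b n p" using 1 by linarith
  qed (use pos in auto)
  finally show ?thesis by (simp add: l_def k_def)
qed

context pinned_string begin

lemma bump_bounds: "0 < bump b n p \<omega>" "bump b n p \<omega> \<le> 1"
  by (simp_all add: bump_def)

lemma bump_measurable:
  assumes "p \<in> grid b n"
  shows "bump b n p \<in> borel_measurable M"
proof -
  have "U (grid_time b n p) (grid_pos b n p) \<in> borel_measurable M"
    using grid_box(5)[OF assms] by (intro U_measurable) simp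
  then show ?thesis unfolding bump_def[abs_def] by measurable
qed

lemma bump_mult_integrable:
  assumes "p \<in> grid b n" "q \<in> grid b m"
  shows "integrable M (\<lambda>\<omega>. bump b n p \<omega> * bump b m q \<omega>)"
proof (rule integrable_const_bound[where B=1])
  show "AE \<omega> in M. norm (bump b n p \<omega> * bump b m q \<omega>) \<le> 1"
    using bump_bounds by (intro AE_I2) (simp add: abs_mult mult_le_one less_imp_le)
qed (use bump_measurable assms in measurable)

lemma bump_integrable: "p \<in> grid b n \<Longrightarrow> integrable M (bump b n p)"
  using bump_bounds by (intro integrable_const_bound[where B=1] bump_measurable AE_I2) (auto simp: less_imp_le)

lemma expectation_bump:
  assumes dim: "CARD('d) = 6" and p: "p \<in> grid b n"
  shows "expectation (bump b n p) = 1 / (1 + 16 ^ (b * n) * grid_variance b n p) ^ 3"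
proof -
  have "0 \<le> grid_variance b n p" using grid_box(5)[OF p] by (intro string_variance_nonneg) simp
  then have "1 + 16 ^ (b * n) * grid_variance b n p > 0" by (intro add_pos_nonneg) auto
  then show ?thesis
    using two_point_expectation[OF grid_box(5)[OF p] grid_box(5)[OF p], of "16 ^ (b * n)" 0 "grid_pos b n p" "grid_pos b n p"]
    by (simp add: bump_def[abs_def] dim sixth_power_inverse_sqrt)
qed

lemma expectation_bump_mult:
  assumes dim: "CARD('d) = 6" and p: "p \<in> grid b n" and q: "q \<in> grid b m"
    and X: "X = (1 + 16 ^ (b * n) * grid_variance b n p) * (1 + 16 ^ (b * m) * grid_variance b m q) -
      16 ^ (b * n) * 16 ^ (b * m) * (grid_covariance b n p m q)\<^sup>2" "X > 0"
  shows "expectation (\<lambda>\<omega>. bump b n p \<omega> * bump b m q \<omega>) = 1 / X ^ 3"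
proof -
  have "expectation (\<lambda>\<omega>. bump b n p \<omega> * bump b m q \<omega>) =
    expectation (\<lambda>\<omega>. exp (- (16 ^ (b * n) * (norm (U (grid_time b n p) (grid_pos b n p) \<omega>))\<^sup>2 +
      16 ^ (b * m) * (norm (U (grid_time b m q) (grid_pos b m q) \<omega>))\<^sup>2) / 2))"
    by (intro Bochner_Integration.integral_cong refl)
      (simp add: bump_def exp_add[symmetric] add_divide_distrib diff_divide_distrib)
  also have "\<dots> = (1 / sqrt X) ^ CARD('d)"
    unfolding X(1) by (rule two_point_expectation) (use grid_box[OF p] grid_box[OF q] in auto)
  finally show ?thesis using X(2) by (simp add: dim sixth_power_inverse_sqrt)
qed

lemma expectation_bump_lower:
  assumes dim: "CARD('d) = 6" and p: "p \<in> grid b n"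
  shows "1 / (64 * real (cells b n) ^ 3) \<le> expectation (bump b n p)"
proof -
  have v: "real (cells b n) \<le> 16 ^ (b * n) * grid_variance b n p" by (rule grid_variance_bounds(1)[OF p])
  have "(1 + 16 ^ (b * n) * grid_variance b n p) ^ 3 \<le> (4 * real (cells b n)) ^ 3"
    using grid_variance_bounds(2)[OF p] v by (intro power_mono) auto
  moreover have "0 < (1 + 16 ^ (b * n) * grid_variance b n p) ^ 3" using v by (intro zero_less_power) auto
  ultimately show ?thesis unfolding expectation_bump[OF assms]
    by (intro divide_left_mono) (auto simp: power_mult_distrib cells_def)
qed

text \<open>
  The \<open>J\<^sup>3\<close> grid points just compensate the expectation of a single bump, which is of order \<open>J\<^sup>-\<^sup>3\<close>
  in dimension six.
\<close>

lemma mass_lower: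
  assumes dim: "CARD('d) = 6"
  shows "1 / 64 \<le> mass b n"
proof -
  have "1 / 64 = (\<Sum>p\<in>grid b n. 1 / (64 * real (cells b n) ^ 3))"
    using cells_ge_1[of b n] by (simp add: card_grid)
  also have "\<dots> \<le> mass b n" unfolding mass_def by (intro sum_mono expectation_bump_lower dim)
  finally show ?thesis .
qed

lemma occupation_product:
  "expectation (\<lambda>\<omega>. occupation b n \<omega> * occupation b m \<omega>) =
    (\<Sum>p\<in>grid b n. \<Sum>q\<in>grid b m. expectation (\<lambda>\<omega>. bump b n p \<omega> * bump b m q \<omega>)) / (mass b n * mass b m)"
proof -
  have "expectation (\<lambda>\<omega>. occupation b n \<omega> * occupation b m \<omega>) =
    expectation (\<lambda>\<omega>. (\<Sum>p\<in>grid b n. \<Sum>q\<in>grid b m. bump b n p \<omega> * bump b m q \<omega>) / (mass b n * mass b m))"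
    by (simp add: occupation_def sum_product)
  also have "\<dots> = expectation (\<lambda>\<omega>. (\<Sum>p\<in>grid b n. \<Sum>q\<in>grid b m. bump b n p \<omega> * bump b m q \<omega>)) / (mass b n * mass b m)"
    by simp
  also have "expectation (\<lambda>\<omega>. (\<Sum>p\<in>grid b n. \<Sum>q\<in>grid b m. bump b n p \<omega> * bump b m q \<omega>)) =
    (\<Sum>p\<in>grid b n. \<Sum>q\<in>grid b m. expectation (\<lambda>\<omega>. bump b n p \<omega> * bump b m q \<omega>))"
  proof -
    have "expectation (\<lambda>\<omega>. \<Sum>p\<in>grid b n. \<Sum>q\<in>grid b m. bump b n p \<omega> * bump b m q \<omega>) =
      (\<Sum>p\<in>grid b n. expectation (\<lambda>\<omega>. \<Sum>q\<in>grid b m. bump b n p \<omega> * bump b m q \<omega>))"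
      by (rule Bochner_Integration.integral_sum) (intro Bochner_Integration.integrable_sum bump_mult_integrable)
    also have "\<dots> = (\<Sum>p\<in>grid b n. \<Sum>q\<in>grid b m. expectation (\<lambda>\<omega>. bump b n p \<omega> * bump b m q \<omega>))"
      by (intro sum.cong refl Bochner_Integration.integral_sum bump_mult_integrable)
    finally show ?thesis .
  qed
  finally show ?thesis .
qed

text \<open>
  The two-point expectation at parabolic lattice distance \<open>\<rho>\<close> is \<open>O((J \<rho>)\<^sup>-\<^sup>3)\<close>; summing over all pairs
  of the \<open>J\<^sup>3\<close> points leaves the logarithm of \<open>J\<close>, which is of order \<open>(b + 1) n\<close>.
\<close>

lemma occupation_second_moment:
  assumes dim: "CARD('d) = 6" and n: "n \<ge> 1"
  shows "expectation (\<lambda>\<omega>. occupation b n \<omega> * occupation b n \<omega>) \<le> 64\<^sup>2 * 32768 * 9 * (real b + 1) * real n"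
proof -
  let ?J = "real (cells b n)"
  let ?S = "\<lambda>p q :: nat \<times> nat. 1 + sqrt \<bar>real (fst p) - real (fst q)\<bar> + \<bar>real (snd p) - real (snd q)\<bar>"
  have each: "expectation (\<lambda>\<omega>. bump b n p \<omega> * bump b n q \<omega>) \<le> 4096 / ?J ^ 3 * (1 / ?S p q ^ 3)"
    if p: "p \<in> grid b n" and q: "q \<in> grid b n" for p q
  proof -
    define X where "X = (1 + 16 ^ (b * n) * grid_variance b n p) * (1 + 16 ^ (b * n) * grid_variance b n q) -
      16 ^ (b * n) * 16 ^ (b * n) * (grid_covariance b n p n q)\<^sup>2"
    have le: "?J / 16 * ?S p q \<le> X" unfolding X_def by (rule grid_determinant[OF p q])
    have S: "?S p q > 0" by (intro add_pos_nonneg) auto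
    have pos: "0 < ?J / 16 * ?S p q" using S cells_ge_1[of b n] by (intro mult_pos_pos) auto
    have "expectation (\<lambda>\<omega>. bump b n p \<omega> * bump b n q \<omega>) = 1 / X ^ 3"
      using le pos by (intro expectation_bump_mult[OF dim p q X_def]) linarith
    also have "\<dots> \<le> 1 / (?J / 16 * ?S p q) ^ 3"
      by (rule frac_le[OF _ _ zero_less_power[OF pos] power_mono[OF le less_imp_le[OF pos]]]) auto
    also have "\<dots> = 4096 / ?J ^ 3 * (1 / ?S p q ^ 3)"
      by (simp add: power_mult_distrib power_divide)
    finally show ?thesis .
  qed
  have J2: "(cells b n)\<^sup>2 = 2 ^ (8 * ((b + 1) * n))"
  proof -
    have "(cells b n)\<^sup>2 = ((2 ^ 4) ^ ((b + 1) * n))\<^sup>2" by (simp add: cells_def)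
    also have "\<dots> = 2 ^ (8 * ((b + 1) * n))" by (simp only: power_mult[symmetric]) simp
    finally show ?thesis .
  qed
  have "(\<Sum>p\<in>grid b n. \<Sum>q\<in>grid b n. expectation (\<lambda>\<omega>. bump b n p \<omega> * bump b n q \<omega>)) \<le>
    (\<Sum>p\<in>grid b n. \<Sum>q\<in>grid b n. 4096 / ?J ^ 3 * (1 / ?S p q ^ 3))"
    by (intro sum_mono each)
  also have "\<dots> = 4096 / ?J ^ 3 * (\<Sum>p\<in>grid b n. \<Sum>q\<in>grid b n. 1 / ?S p q ^ 3)"
    by (simp only: sum_distrib_left)
  also have "\<dots> \<le> 4096 / ?J ^ 3 * (8 * ?J ^ 3 * (1 + real (8 * ((b + 1) * n))))"
    using parabolic_sum_le[OF J2] by (intro mult_left_mono) (auto simp: grid_def split_beta)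
  also have "\<dots> = 32768 * (1 + 8 * ((real b + 1) * real n))"
    using cells_ge_1[of b n] by (simp add: field_simps)
  also have "\<dots> \<le> 32768 * (9 * ((real b + 1) * real n))"
  proof (rule mult_left_mono)
    have "1 * 1 \<le> (real b + 1) * real n" using n by (intro mult_mono) auto
    then show "1 + 8 * ((real b + 1) * real n) \<le> 9 * ((real b + 1) * real n)" by linarith
  qed simp
  finally have le: "(\<Sum>p\<in>grid b n. \<Sum>q\<in>grid b n. expectation (\<lambda>\<omega>. bump b n p \<omega> * bump b n q \<omega>)) \<le>
    32768 * (9 * ((real b + 1) * real n))" .
  have "(1 / 64)\<^sup>2 \<le> mass b n * mass b n"
    unfolding power2_eq_square using mass_lower[OF dim, of b n] by (intro mult_mono) auto
  then have "expectation (\<lambda>\<omega>. occupation b n \<omega> * occupation b n \<omega>) \<le>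
    32768 * (9 * ((real b + 1) * real n)) / (1 / 64)\<^sup>2"
    unfolding occupation_product using le by (intro frac_le) auto
  then show ?thesis by (simp add: power_divide algebra_simps)
qed

text \<open>
  With \<open>r\<close> the squared correlation, the two-point expectation is the product of the one-point
  expectations times \<open>(1 - r)\<^sup>-\<^sup>3\<close>, and \<open>r \<le> 7 / 16\<^sup>m\<^sup>-\<^sup>n \<le> 1 / 2\<close>.
\<close>

lemma occupation_decorrelation:
  assumes dim: "CARD('d) = 6" and nm: "n < m"
  shows "expectation (\<lambda>\<omega>. occupation b n \<omega> * occupation b m \<omega>) \<le> 1 + 98 / 16 ^ (m - n)"
proof -
  let ?r = "7 / 16 ^ (m - n) :: real"
  have each: "expectation (\<lambda>\<omega>. bump b n p \<omega> * bump b m q \<omega>) \<le>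
    (1 + 14 * ?r) * (expectation (bump b n p) * expectation (bump b m q))"
    if p: "p \<in> grid b n" and q: "q \<in> grid b m" for p q
  proof -
    define a c e where "a = 1 + 16 ^ (b * n) * grid_variance b n p"
      and "c = 1 + 16 ^ (b * m) * grid_variance b m q"
      and "e = 16 ^ (b * n) * 16 ^ (b * m) * (grid_covariance b n p m q)\<^sup>2"
    have pos: "a > 0" "c > 0"
      using grid_variance_bounds(1)[OF p] grid_variance_bounds(1)[OF q] cells_ge_1[of b n] cells_ge_1[of b m]
      by (auto simp: a_def c_def)
    define r where "r = e / (a * c)"
    have "(16::real) ^ 1 \<le> 16 ^ (m - n)" using nm by (intro power_increasing) auto
    then have r2: "?r \<le> 1 / 2" by (simp add: field_simps)
    have e: "e \<le> ?r * (a * c)" unfolding a_def c_def e_def by (rule grid_decorrelation[OF p q nm])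
    then have r: "0 \<le> r" "r \<le> ?r" using pos by (auto simp: r_def e_def divide_le_eq)
    have X: "a * c * (1 - r) = a * c - e" using pos by (simp add: r_def field_simps)
    have "r < 1" using r r2 by linarith
    then have "0 < a * c * (1 - r)" using pos by (intro mult_pos_pos) auto
    then have "expectation (\<lambda>\<omega>. bump b n p \<omega> * bump b m q \<omega>) = 1 / (a * c * (1 - r)) ^ 3"
      by (intro expectation_bump_mult[OF dim p q]) (simp_all only: a_def c_def X[unfolded a_def c_def e_def])
    also have "\<dots> = 1 / a ^ 3 * (1 / c ^ 3) * (1 / (1 - r) ^ 3)" by (simp add: power_mult_distrib)
    also have "\<dots> \<le> 1 / a ^ 3 * (1 / c ^ 3) * (1 + 14 * ?r)"
    proof (rule mult_left_mono)
      have "1 / (1 - r) ^ 3 \<le> 1 + 14 * r" using r r2 by (intro inverse_cube_le) linarith+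
      then show "1 / (1 - r) ^ 3 \<le> 1 + 14 * ?r" using r by linarith
    qed (use pos in simp)
    also have "\<dots> = (1 + 14 * ?r) * (expectation (bump b n p) * expectation (bump b m q))"
      by (simp add: expectation_bump[OF dim p] expectation_bump[OF dim q] a_def c_def)
    finally show ?thesis .
  qed
  have "(\<Sum>p\<in>grid b n. \<Sum>q\<in>grid b m. expectation (\<lambda>\<omega>. bump b n p \<omega> * bump b m q \<omega>)) \<le>
    (\<Sum>p\<in>grid b n. \<Sum>q\<in>grid b m. (1 + 14 * ?r) * (expectation (bump b n p) * expectation (bump b m q)))"
    by (intro sum_mono each)
  also have "\<dots> = (1 + 14 * ?r) * (mass b n * mass b m)"
    unfolding mass_def sum_product by (simp only: sum_distrib_left)
  finally have "expectation (\<lambda>\<omega>. occupation b n \<omega> * occupation b m \<omega>) \<le> (1 + 14 * ?r)"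
    unfolding occupation_product using mass_lower[OF dim, of b n] mass_lower[OF dim, of b m]
    by (subst pos_divide_le_eq) auto
  then show ?thesis by simp
qed

lemma occupied_infinitely_often:
  assumes dim: "CARD('d) = 6"
  shows "AE \<omega> in M. \<exists>n\<ge>k. occupation b n \<omega> > 1 / 2"
proof (rule second_moment_infinitely_often)
  fix n
  have m: "mass b n > 0" using mass_lower[OF dim, of b n] by simp
  show meas: "occupation b n \<in> borel_measurable M"
    unfolding occupation_def[abs_def] by (intro borel_measurable_divide borel_measurable_sum bump_measurable) auto
  show "integrable M (\<lambda>\<omega>. (occupation b n \<omega>)\<^sup>2)"
    unfolding occupation_def power_divide power2_eq_square[of "sum _ _"] sum_product
    by (intro integrable_divide Bochner_Integration.integrable_sum bump_mult_integrable)
  show "expectation (occupation b n) = 1"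
    unfolding occupation_def[abs_def] using m bump_integrable
    by (simp add: Bochner_Integration.integral_sum mass_def[symmetric])
  fix k :: nat assume n: "1 \<le> n" and nk: "n \<le> k"
  let ?C = "64\<^sup>2 * 32768 * 9 * (real b + 1)"
  show "expectation (\<lambda>\<omega>. occupation b n \<omega> * occupation b k \<omega>) \<le> 1 + ?C * real n / 2 ^ (k - n)"
  proof (cases "n = k")
    case True
    then show ?thesis using occupation_second_moment[OF dim n, of b] by simp
  next
    case False
    then have nk: "n < k" using nk by simp
    have "98 / 16 ^ (k - n) \<le> 98 / (2::real) ^ (k - n)"
      by (intro divide_left_mono power_mono) auto
    also have "\<dots> \<le> ?C * real n / 2 ^ (k - n)"
    proof (rule divide_right_mono)
      have "1 * 1 \<le> (real b + 1) * real n" using n by (intro mult_mono) auto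
      moreover have "98 \<le> 64\<^sup>2 * 32768 * 9 * X" if "1 \<le> X" for X :: real using that by simp
      ultimately show "98 \<le> ?C * real n" by (simp only: mult.assoc mult_1)
    qed simp
    finally show ?thesis using occupation_decorrelation[OF dim nk, of b] by linarith
  qed
qed simp

text \<open>
  If the occupation exceeds half its mean, some bump exceeds half the smallest expectation of a bump.
  Taking logarithms of this polynomially small bound gives a factor of order \<open>n\<close>.
\<close>

lemma occupied_imp_near_origin:
  assumes dim: "CARD('d) = 6" and n: "n \<ge> 1" and occ: "occupation b n \<omega> > 1 / 2"
  obtains t x where "4 * (16 ^ n)\<^sup>2 \<le> t" "t \<le> 5 * (16 ^ n)\<^sup>2"
    "(norm (U t x \<omega>))\<^sup>2 \<le> 38 * (real b + 1) * real n / 16 ^ (b * n)"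
proof -
  let ?J = "real (cells b n)"
  \<comment> \<open>Otherwise the sum of the bumps would be at most half of the mass.\<close>
  have "\<exists>p\<in>grid b n. bump b n p \<omega> > 1 / (128 * ?J ^ 3)"
  proof (rule ccontr)
    assume no: "\<not> ?thesis"
    have "(\<Sum>p\<in>grid b n. bump b n p \<omega>) \<le> (\<Sum>p\<in>grid b n. 1 / 2 * (1 / (64 * ?J ^ 3)))"
      using no by (intro sum_mono) (auto simp: not_less)
    also have "\<dots> = 1 / 2 * (\<Sum>p\<in>grid b n. 1 / (64 * ?J ^ 3))" by (simp only: sum_distrib_left)
    also have "\<dots> \<le> 1 / 2 * mass b n"
      unfolding mass_def by (intro mult_left_mono sum_mono expectation_bump_lower dim) auto
    finally show False using occ mass_lower[OF dim, of b n] by (simp add: occupation_def pos_less_divide_eq)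
  qed
  then obtain p where p: "p \<in> grid b n" and gt: "bump b n p \<omega> > 1 / (128 * ?J ^ 3)" by blast
  define N where "N = (norm (U (grid_time b n p) (grid_pos b n p) \<omega>))\<^sup>2"
  define K where "K = 7 + 12 * ((b + 1) * n)"
  have "128 * ?J ^ 3 = 2 ^ 7 * ((2 ^ 4) ^ ((b + 1) * n)) ^ 3" by (simp add: cells_def)
  also have "\<dots> = 2 ^ K" unfolding K_def by (simp only: power_mult[symmetric] power_add[symmetric]) simp
  finally have J: "128 * ?J ^ 3 = 2 ^ K" .
  have "ln (1 / 2 ^ K) < - (16 ^ (b * n) * N) / 2"
  proof -
    have "1 / 2 ^ K < exp (- (16 ^ (b * n) * N) / 2)"
      using gt unfolding J bump_def N_def .
    then have "ln (1 / 2 ^ K) < ln (exp (- (16 ^ (b * n) * N) / 2))"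
      by (subst ln_less_cancel_iff) auto
    then show ?thesis by (simp only: ln_exp)
  qed
  then have "16 ^ (b * n) * N < 2 * (real K * ln 2)"
    by (simp add: ln_div ln_realpow)
  also have "\<dots> \<le> 2 * (real K * 1)"
    using ln_le_minus_one[of 2] by (intro mult_left_mono) auto
  also have "\<dots> = 14 + 24 * ((real b + 1) * real n)" by (simp add: K_def algebra_simps)
  also have "\<dots> \<le> 38 * (real b + 1) * real n"
  proof -
    have "1 * 1 \<le> (real b + 1) * real n" using n by (intro mult_mono) auto
    moreover have "14 + 24 * X \<le> 38 * X" if "1 \<le> X" for X :: real using that by simp
    ultimately show ?thesis by (simp only: mult.assoc mult_1)
  qed
  finally have "N \<le> 38 * (real b + 1) * real n / 16 ^ (b * n)"
    by (simp add: pos_le_divide_eq mult.commute)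
  with grid_box(1,2)[OF p] show ?thesis by (intro that[of "grid_time b n p" "grid_pos b n p"]) (auto simp: N_def)
qed

end

section \<open>The lower limit\<close>

text \<open>
  At scale \<open>n\<close> the time is at most \<open>16\<^sup>3\<^sup>n\<close>, so \<open>t\<^sup>2\<^sup>\<alpha> \<le> 16\<^sup>6\<^sup>\<alpha>\<^sup>n\<close>, and any \<open>b \<ge> 6 \<alpha> + 1\<close> leaves a
  factor \<open>n 16\<^sup>-\<^sup>n\<close>.
\<close>

lemma Liminf_inf_norm_eq_0:
  fixes u :: "real \<Rightarrow> real \<Rightarrow> 'b :: real_normed_vector"
  assumes \<alpha>: "\<alpha> > 0"
    and near: "\<And>b k. \<exists>n\<ge>k. \<exists>t x. 4 * (16 ^ n)\<^sup>2 \<le> t \<and> t \<le> 5 * (16 ^ n)\<^sup>2 \<and>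
      (norm (u t x))\<^sup>2 \<le> 38 * (real b + 1) * real n / 16 ^ (b * n)"
  shows "Liminf at_top (\<lambda>t. ereal ((INF x. norm (u t x)) / t powr (- \<alpha>))) = 0"
proof (rule antisym)
  let ?f = "\<lambda>t. (INF x. norm (u t x)) / t powr (- \<alpha>)"
  have bdd: "bdd_below (range (\<lambda>x. norm (u t x)))" for t by (intro bdd_belowI[of _ 0]) auto
  have f0: "0 \<le> ?f t" for t by (intro divide_nonneg_nonneg cINF_greatest) auto
  then show "0 \<le> Liminf at_top (\<lambda>t. ereal (?f t))"
    by (intro Liminf_bounded always_eventually allI) simp
  show "Liminf at_top (\<lambda>t. ereal (?f t)) \<le> 0"
  proof (rule ccontr)
    assume "\<not> ?thesis"
    then have "0 < Liminf at_top (\<lambda>t. ereal (?f t))" by (simp only: not_le)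
    then obtain r where r: "0 < ereal r" "ereal r < Liminf at_top (\<lambda>t. ereal (?f t))"
      using ereal_dense2 by blast
    from less_LiminfD[OF r(2)] obtain T where T: "\<And>t. t \<ge> T \<Longrightarrow> r < ?f t"
      by (auto simp: eventually_at_top_linorder)
    \<comment> \<open>Then \<open>t\<^sup>2\<^sup>\<alpha> 16\<^sup>-\<^sup>b\<^sup>n \<le> 16\<^sup>-\<^sup>n\<close> for all times of scale \<open>n\<close>.\<close>
    obtain b :: nat where b: "6 * \<alpha> + 1 \<le> real b" using real_arch_simple by blast
    have "(\<lambda>n. 38 * (real b + 1) * (real n * (1 / 16) ^ n)) \<longlonglongrightarrow> 38 * (real b + 1) * 0"
      by (intro tendsto_mult tendsto_const powser_times_n_limit_0) auto
    moreover have "38 * (real b + 1) * 0 < r\<^sup>2" using r(1) by simp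
    ultimately have "eventually (\<lambda>n. 38 * (real b + 1) * (real n * (1 / 16) ^ n) < r\<^sup>2) sequentially"
      by (rule order_tendstoD(2))
    then obtain k1 where k1: "\<And>n. n \<ge> k1 \<Longrightarrow> 38 * (real b + 1) * (real n * (1 / 16) ^ n) < r\<^sup>2"
      by (auto simp: eventually_sequentially)
    obtain k2 :: nat where k2: "T \<le> real k2" using real_arch_simple by blast
    define k where "k = max k1 k2"
    obtain n t x where n: "n \<ge> max 1 k" and t: "4 * (16 ^ n)\<^sup>2 \<le> t" "t \<le> 5 * (16 ^ n)\<^sup>2"
      and u: "(norm (u t x))\<^sup>2 \<le> 38 * (real b + 1) * real n / 16 ^ (b * n)"
      using near[of "max 1 k" b] by blast
    have big: "real n \<le> (16 ^ n)\<^sup>2"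
    proof -
      have "real n \<le> 2 ^ n" by (rule less_imp_le[OF of_nat_less_two_power])
      also have "\<dots> \<le> 16 ^ n" by (rule power_mono) auto
      also have "\<dots> \<le> (16 ^ n)\<^sup>2" by (rule self_le_power) auto
      finally show ?thesis .
    qed
    then have tT: "T \<le> t" and t0: "t > 0" using k2 n t by (auto simp: k_def)
    have "t \<le> 16 ^ (3 * n)"
    proof -
      have "(5::real) \<le> 16 ^ n" using n power_increasing[of 1 n "16::real"] by simp
      then have "5 * (16 ^ n)\<^sup>2 \<le> (16 ^ n :: real) * (16 ^ n)\<^sup>2" by (rule mult_right_mono) simp
      also have "\<dots> = 16 ^ (3 * n)" by (simp add: power2_eq_square flip: power_add)
      finally show ?thesis using t by simp
    qed
    then have "(t powr \<alpha>)\<^sup>2 \<le> ((16 ^ (3 * n)) powr \<alpha>)\<^sup>2"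
      using \<alpha> t0 by (intro power_mono powr_mono2) auto
    also have "\<dots> = 16 powr (6 * \<alpha> * real n)"
    proof -
      have "(16::real) ^ (3 * n) = 16 powr real (3 * n)" by (rule powr_realpow[symmetric]) simp
      moreover have "real (3 * n) * \<alpha> + real (3 * n) * \<alpha> = 6 * \<alpha> * real n" by simp
      ultimately show ?thesis by (simp only: powr_powr power2_eq_square powr_add[symmetric])
    qed
    also have "\<dots> \<le> 16 powr ((real b - 1) * real n)"
      using b by (intro powr_mono mult_right_mono) auto
    also have "\<dots> = 16 ^ (b * n) * (1 / 16) ^ n"
    proof -
      have "(real b - 1) * real n = real (b * n) - real n" by (simp add: left_diff_distrib)
      then have "16 powr ((real b - 1) * real n) = 16 powr real (b * n) / 16 powr real n"
        by (simp only: powr_diff)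
      also have "16 powr real (b * n) = (16::real) ^ (b * n)" by (rule powr_realpow) simp
      also have "16 powr real n = (16::real) ^ n" by (rule powr_realpow) simp
      finally show ?thesis by (simp add: power_one_over)
    qed
    finally have tp: "(t powr \<alpha>)\<^sup>2 \<le> 16 ^ (b * n) * (1 / 16) ^ n" .
    have "(norm (u t x) * t powr \<alpha>)\<^sup>2 \<le> 38 * (real b + 1) * real n / 16 ^ (b * n) * (16 ^ (b * n) * (1 / 16) ^ n)"
      unfolding power_mult_distrib using u tp by (intro mult_mono) auto
    also have "\<dots> = 38 * (real b + 1) * (real n * (1 / 16) ^ n)" by simp
    also have "\<dots> < r\<^sup>2" using k1[of n] n by (simp add: k_def)
    finally have "norm (u t x) * t powr \<alpha> < r"
      by (rule power2_less_imp_less) (use r(1) in simp)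
    moreover have "?f t \<le> norm (u t x) * t powr \<alpha>"
    proof -
      have "(INF x. norm (u t x)) \<le> norm (u t x)" by (rule cINF_lower[OF bdd]) simp
      then have "(INF x. norm (u t x)) * t powr \<alpha> \<le> norm (u t x) * t powr \<alpha>" by (rule mult_right_mono) simp
      then show ?thesis by (simp only: powr_minus divide_inverse inverse_inverse_eq)
    qed
    ultimately show False using T[OF tT] by simp
  qed
qed

theorem theorem1p3:
  fixes M :: "'a measure"
    and F :: "real \<Rightarrow> 'a measure"
    and W W' :: "(real \<times> real \<Rightarrow> real) \<Rightarrow> 'a \<Rightarrow> real ^ 6"
    and U :: "real \<Rightarrow> real \<Rightarrow> 'a \<Rightarrow> real ^ 6"
  assumes "prob_space M"
    and "complete_measure M"
    and "right_continuous_filtration M F"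
    and "vector_white_noise M W"
    and "adapted_noise F W"
    and "vector_white_noise M W'"
    and "independent_noises M W W'"
    and "stationary_pinned_string M W W' U"
  shows "AE \<omega> in M. \<forall>\<alpha>>0.
    Liminf at_top (\<lambda>t. ereal ((INF x. norm (U t x \<omega>)) / t powr (- \<alpha>))) = 0"
proof -
  interpret prob_space M by (rule assms(1))
  interpret pinned_string M W W' U
    by unfold_locales (use assms in auto)
  have dim: "CARD(6) = 6" by simp
  have "AE \<omega> in M. \<forall>b k. \<exists>n\<ge>max 1 k. occupation b n \<omega> > 1 / 2"
    unfolding AE_all_countable by (intro allI occupied_infinitely_often dim)
  then show ?thesis
  proof eventually_elim
    case (elim \<omega>)
    show ?case
    proof (intro allI impI Liminf_inf_norm_eq_0)
      fix b k :: nat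
      obtain n where n: "n \<ge> max 1 k" "occupation b n \<omega> > 1 / 2" using elim by blast
      then obtain t x where "4 * (16 ^ n)\<^sup>2 \<le> t" "t \<le> 5 * (16 ^ n)\<^sup>2"
        "(norm (U t x \<omega>))\<^sup>2 \<le> 38 * (real b + 1) * real n / 16 ^ (b * n)"
        using occupied_imp_near_origin[OF dim, of n b \<omega>] by auto
      then show "\<exists>n\<ge>k. \<exists>t x. 4 * (16 ^ n)\<^sup>2 \<le> t \<and> t \<le> 5 * (16 ^ n)\<^sup>2 \<and>
        (norm (U t x \<omega>))\<^sup>2 \<le> 38 * (real b + 1) * real n / 16 ^ (b * n)"
        using n by (intro exI[of _ n]) auto
    qed
  qed
qed

end
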